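(* Fix $\tau>0$. There exists a constant $c>0$, not depending on $p_1,p_2,r,t$, such that the following holds. Let $p_1,p_2,r\ge1$ be integers with $r\le\min(p_1/16,\,p_2/2)$, let $t>0$, and let $$\mathcal F_{r,t}=\{X\in\mathbb{R}^{p_1\times p_2}:\ \mathrm{rank}(X)=r,\ \sigma_r(X)\ge t\}.$$ Suppose one observes $Y=X+Z$ where $X\in\mathcal F_{r,t}$ and $Z=(Z_{ij})\in\mathbb{R}^{p_1\times p_2}$ has i.i.d. entries $Z_{ij}\sim\mathcal G_\tau$ (unit-variance sub-Gaussian noise, defined in the context), and let $U\in\mathbb{O}_{p_1,r}$, $V\in\mathbb{O}_{p_2,r}$ denote the left and right singular vectors of $X$. Then, with the infima over all estimators $\tilde V\in\mathbb{O}_{p_2,r}$, respectively $\tilde U\in\mathbb{O}_{p_1,r}$, based on $Y$, $$\inf_{\tilde V}\sup_{X\in\mathcal F_{r,t}}\mathbb{E}\|\sin\Theta(V,\tilde V)\|^2\ge c\min\left\{\frac{p_2(t^2+p_1)}{t^4},1\right\},\qquad \inf_{\tilde V}\sup_{X\in\mathcal F_{r,t}}\mathbb{E}\|\sin\Theta(V,\tilde V)\|_F^2\ge c\min\left\{\frac{p_2r(t^2+p_1)}{t^4},r\right\},$$ $$\inf_{\tilde U}\sup_{X\in\mathcal F_{r,t}}\mathbb{E}\|\sin\Theta(U,\tilde U)\|^2\ge c\min\left\{\frac{p_1(t^2+p_2)}{t^4},1\right\},\qquad \inf_{\tilde U}\sup_{X\in\mathcal F_{r,t}}\mathbb{E}\|\sin\Theta(U,\tilde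 U)\|_F^2\ge c\min\left\{\frac{p_1r(t^2+p_2)}{t^4},r\right\}.$$
   Context: $\mathbb{O}_{p,r}=\{V\in\mathbb{R}^{p\times r}:V^\top V=I_r\}$; $\sigma_1(A)\ge\sigma_2(A)\ge\cdots$ are the singular values of $A$; $\|\cdot\|$ is the spectral norm and $\|\cdot\|_F$ the Frobenius norm. $\mathcal G_\tau$ is the class of distributions of real random variables $\zeta$ with $\mathbb{E}\zeta=0$, $\mathrm{Var}(\zeta)=1$ and $\mathbb{E}\exp(s\zeta)\le\exp(\tau s^2)$ for all $s\in\mathbb{R}$. For $V,\hat V\in\mathbb{O}_{p,r}$ with $\sigma_1\ge\cdots\ge\sigma_r\ge0$ the singular values of $V^\top\hat V$, $\Theta(V,\hat V)=\mathrm{diag}(\cos^{-1}\sigma_1,\dots,\cos^{-1}\sigma_r)$ and $\sin\Theta$ applies $\sin$ to the diagonal entries; the $\sin\Theta$ norms depend only on the column spaces of the two matrices. *)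

theory Defs
  imports
    "HOL-Probability.Probability"
    "HOL-Computational_Algebra.Polynomial"
    "Jordan_Normal_Form.Char_Poly"
    "Jordan_Normal_Form.DL_Rank"
begin

definition orthonormal_cols :: "nat \<Rightarrow> nat \<Rightarrow> real mat set" where
  "orthonormal_cols p r = {V \<in> carrier_mat p r. transpose_mat V * V = 1\<^sub>m r}"

text \<open>The singular values of an \<open>m \<times> n\<close> matrix are the square roots of the eigenvalues of
  \<open>A\<^sup>T A\<close> with multiplicity, in decreasing order. The list has length \<open>n\<close>; entries beyond
  position \<open>min m n\<close> are \<open>0\<close>. Indices of \<open>sing_val\<close> start at \<open>1\<close>.\<close>

definition sing_vals :: "real mat \<Rightarrow> real list" where
  "sing_vals A =
     map sqrt (rev (sorted_list_of_multiset (proots (char_poly (transpose_mat A * A)))))"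

definition sing_val :: "nat \<Rightarrow> real mat \<Rightarrow> real" where
  "sing_val k A = sing_vals A ! (k - 1)"

definition spectral_norm :: "real mat \<Rightarrow> real" where
  "spectral_norm A =
     (SUP v \<in> {v \<in> carrier_vec (dim_col A). v \<bullet> v \<le> 1}. sqrt ((A *\<^sub>v v) \<bullet> (A *\<^sub>v v)))"

definition frobenius_norm :: "real mat \<Rightarrow> real" where
  "frobenius_norm A = sqrt (\<Sum>i<dim_row A. \<Sum>j<dim_col A. (A $$ (i, j))\<^sup>2)"

definition Theta :: "real mat \<Rightarrow> real mat \<Rightarrow> real mat" where
  "Theta V W = mat_diag (dim_col V) (\<lambda>i. arccos (sing_val (Suc i) (transpose_mat V * W)))"

definition sin_Theta :: "real mat \<Rightarrow> real mat \<Rightarrow> real mat" where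
  "sin_Theta V W = mat_diag (dim_col V) (\<lambda>i. sin (Theta V W $$ (i, i)))"

definition low_rank_class :: "nat \<Rightarrow> nat \<Rightarrow> nat \<Rightarrow> real \<Rightarrow> real mat set" where
  "low_rank_class p1 p2 r t =
     {X \<in> carrier_mat p1 p2. vec_space.rank p1 X = r \<and> sing_val r X \<ge> t}"

definition compact_svd :: "nat \<Rightarrow> real mat \<Rightarrow> real mat \<Rightarrow> real mat \<Rightarrow> bool" where
  "compact_svd r X U V \<longleftrightarrow>
     U \<in> orthonormal_cols (dim_row X) r \<and> V \<in> orthonormal_cols (dim_col X) r \<and>
     X = U * mat_diag r (\<lambda>i. sing_val (Suc i) X) * transpose_mat V"

text \<open>For \<open>X\<close> of rank \<open>r\<close>, the singular vectors are determined up to an orthogonal change of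
  basis inside each singular subspace, so the column spaces of the two matrices below, and with
  them all \<open>sin_Theta\<close> norms, do not depend on the choice.\<close>

definition left_sing_vecs :: "nat \<Rightarrow> real mat \<Rightarrow> real mat" where
  "left_sing_vecs r X = (SOME U. \<exists>V. compact_svd r X U V)"

definition right_sing_vecs :: "nat \<Rightarrow> real mat \<Rightarrow> real mat" where
  "right_sing_vecs r X = (SOME V. \<exists>U. compact_svd r X U V)"

definition subgaussian_class :: "real \<Rightarrow> real measure set" where
  "subgaussian_class \<tau> =
     {\<mu>. prob_space \<mu> \<and> sets \<mu> = sets borel \<and>
         integrable \<mu> (\<lambda>x. x) \<and> (\<integral>x. x \<partial>\<mu>) = 0 \<and>
         integrable \<mu> (\<lambda>x. x\<^sup>2) \<and> prob_space.variance \<mu> (\<lambda>x. x) = 1 \<and>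
         (\<forall>s. integrable \<mu> (\<lambda>x. exp (s * x)) \<and>
              (\<integral>x. exp (s * x) \<partial>\<mu>) \<le> exp (\<tau> * s\<^sup>2))}"

text \<open>A \<open>p1 \<times> p2\<close> random matrix is given by its family of entries, indexed by
  \<open>{..<p1} \<times> {..<p2}\<close>. Under \<open>iid_entries \<mu> p1 p2\<close> the entries are independent with common
  law \<open>\<mu>\<close>.\<close>

definition iid_entries :: "real measure \<Rightarrow> nat \<Rightarrow> nat \<Rightarrow> (nat \<times> nat \<Rightarrow> real) measure" where
  "iid_entries \<mu> p1 p2 = PiM ({..<p1} \<times> {..<p2}) (\<lambda>_. \<mu>)"

text \<open>Estimators with values in the \<open>q \<times> r\<close> matrices with orthonormal columns: Borel measurable
  functions of the observed \<open>p1 \<times> p2\<close> matrix, where measurability is required entrywise.\<close>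

definition estimators :: "nat \<Rightarrow> nat \<Rightarrow> nat \<Rightarrow> nat \<Rightarrow> (real mat \<Rightarrow> real mat) set" where
  "estimators p1 p2 q r =
     {W. (\<forall>Y \<in> carrier_mat p1 p2. W Y \<in> orthonormal_cols q r) \<and>
         (\<forall>i<q. \<forall>j<r. (\<lambda>y. W (mat p1 p2 y) $$ (i, j)) \<in>
            borel_measurable (PiM ({..<p1} \<times> {..<p2}) (\<lambda>_. borel)))}"

text \<open>The minimax risk is over the whole model: neither the signal \<open>X\<close> nor the noise law \<open>\<mu>\<close>
  (any member of the sub-Gaussian class) is revealed to the estimator. Here \<open>N\<close> is the norm
  applied to \<open>sin_Theta\<close> and \<open>S X\<close> the matrix of singular vectors to be estimated.\<close>

definition minimax_risk ::
  "real \<Rightarrow> nat \<Rightarrow> nat \<Rightarrow> nat \<Rightarrow> real \<Rightarrow> (real mat \<Rightarrow> real) \<Rightarrow> (real mat \<Rightarrow> real mat) \<Rightarrow>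
     (real mat \<Rightarrow> real mat) set \<Rightarrow> ennreal" where
  "minimax_risk \<tau> p1 p2 r t N S E =
     (INF W \<in> E. SUP \<mu> \<in> subgaussian_class \<tau>. SUP X \<in> low_rank_class p1 p2 r t.
        \<integral>\<^sup>+ z. ennreal ((N (sin_Theta (S X) (W (X + mat p1 p2 z))))\<^sup>2) \<partial>iid_entries \<mu> p1 p2)"

end

theory Submission
  imports Defs "HOL-Combinatorics.List_Permutation"
begin

text \<open>For standard Gaussian noise, which lies in every nonempty sub-Gaussian class because then
  \<open>\<tau> \<ge> 1/2\<close>, let \<open>X = a G W\<^sup>T\<close> where the lower block of \<open>W\<close> is \<open>\<epsilon>\<close> times a random sign
  matrix \<open>T\<close> below an identity block and \<open>G\<close> is, up to padding, an independent random sign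
  matrix \<open>R\<close>. By a net argument both sign matrices are well conditioned with high probability,
  so \<open>X\<close> lies in the class and \<open>W\<close> spans its right singular space. Averaging out \<open>R\<close>, the laws of
  the data for two values of \<open>T\<close> that differ in one entry keep a constant overlap as long as
  \<open>\<epsilon>\<^sup>2\<close> is at most a constant times \<open>(t\<^sup>2 + p) / t\<^sup>4\<close>: the gain over a known left factor comes
  from mixing over the sign of a single column of \<open>R\<close>. Hence no estimator recovers a constant fraction of the
  \<open>q r\<close> signs, each of which costs \<open>\<epsilon>\<^sup>2\<close> in squared Frobenius \<open>sin \<Theta>\<close> distance. The spectral
  bounds follow since the squared spectral norm is at least the average squared sine, and the
  left singular vectors are handled by transposition.\<close>

section \<open>Random sign matrices\<close>

text \<open>The term p in t^2 + p is what shapes the construction. With a known left factor of scale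
  \<open>a\<close>, changing one entry of \<open>W\<close> by 2 \<open>e\<close> costs about e^2 a^2
  of affinity per data row. When the sign of the affected column of \<open>R\<close> is averaged
  out, the leading term cancels and the cost for a <= 1 is about e^2 a^4. Over \<open>n\<close> rows
  with a^2 = 4 t^2 / n this amounts to e^2 min (t^2, t^4 / n) up to constants, and keeping it
  bounded allows e^2 of order (t^2 + n) / t^4. Two obstacles follow. The data law factors over rows
  only if \<open>R\<close> ranges over all sign matrices, while only well conditioned ones give
  admissible signals; so overlaps are computed for the full mixture, and the restricted one pays for
  the removed mass. And the net argument for the smallest singular value of \<open>R\<close> needs
  far more rows than columns, while only n >= r is guaranteed; so only a fixed fraction of the
  columns is random, or a single one if \<open>r\<close> is small. This loses a constant factor and
  explains the size of \<open>rate_const\<close>.\<close>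

definition avg :: "'a set \<Rightarrow> ('a \<Rightarrow> real) \<Rightarrow> real" where
  "avg A f = (\<Sum>x\<in>A. f x) / real (card A)"

definition signs :: "'a set \<Rightarrow> ('a \<Rightarrow> real) set" where
  "signs K = PiE K (\<lambda>_. {-1, 1})"

lemma avg_mono: "(\<And>x. x \<in> A \<Longrightarrow> f x \<le> g x) \<Longrightarrow> avg A f \<le> avg A g"
  by (simp add: avg_def divide_right_mono sum_mono)

lemma avg_nonneg: "(\<And>x. x \<in> A \<Longrightarrow> 0 \<le> f x) \<Longrightarrow> 0 \<le> avg A f"
  by (simp add: avg_def sum_nonneg)

lemma avg_cong: "(\<And>x. x \<in> A \<Longrightarrow> f x = g x) \<Longrightarrow> avg A f = avg A g"
  by (simp add: avg_def)

lemma avg_const: "finite A \<Longrightarrow> A \<noteq> {} \<Longrightarrow> avg A (\<lambda>_. c) = c"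
  by (simp add: avg_def)

lemma avg_add: "avg A (\<lambda>x. f x + g x) = avg A f + avg A g"
  by (simp add: avg_def sum.distrib add_divide_distrib)

lemma avg_diff: "avg A (\<lambda>x. f x - g x) = avg A f - avg A g"
  by (simp add: avg_def sum_subtractf diff_divide_distrib)

lemma avg_cmult: "avg A (\<lambda>x. c * f x) = c * avg A f"
  by (simp add: avg_def sum_distrib_left[symmetric])

lemma avg_sum: "avg A (\<lambda>x. \<Sum>b\<in>B. f x b) = (\<Sum>b\<in>B. avg A (\<lambda>x. f x b))"
  by (simp add: avg_def sum.swap[of _ B A] sum_divide_distrib)

text \<open>The finite change of variables: it lets a sign pattern be paired with the one in which a
  single sign is flipped.\<close>

lemma avg_involution:
  assumes "\<And>x. x \<in> A \<Longrightarrow> h x \<in> A" and "\<And>x. x \<in> A \<Longrightarrow> h (h x) = x"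
  shows "avg A (\<lambda>x. f (h x)) = avg A f"
proof -
  have "(\<Sum>x\<in>A. f (h x)) = (\<Sum>x\<in>A. f x)"
    by (rule sum.reindex_bij_witness[of _ h h]) (auto simp: assms)
  then show ?thesis by (simp add: avg_def)
qed

lemma avg_PiE_prod:
  assumes "finite I" "\<And>i. i \<in> I \<Longrightarrow> finite (A i)"
  shows "avg (PiE I A) (\<lambda>R. \<Prod>i\<in>I. f i (R i)) = (\<Prod>i\<in>I. avg (A i) (f i))"
  using assms by (simp add: avg_def prod_sum_PiE card_PiE prod_dividef)

lemma finite_signs [simp]: "finite K \<Longrightarrow> finite (signs K)"
  by (simp add: signs_def finite_PiE)

lemma signs_nonempty [simp]: "signs K \<noteq> {}"
  by (auto simp: signs_def PiE_eq_empty_iff)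

lemma signs_sq: "\<omega> \<in> signs K \<Longrightarrow> k \<in> K \<Longrightarrow> \<omega> k * \<omega> k = 1"
  by (auto simp: signs_def PiE_iff)

lemma avg_signs_empty: "avg (signs {}) f = f (\<lambda>_. undefined)"
  by (simp add: avg_def signs_def)

lemma avg_signs_insert:
  assumes "finite K" "k \<notin> K"
  shows "avg (signs (insert k K)) f =
    (avg (signs K) (\<lambda>\<omega>. f (fun_upd \<omega> k 1)) + avg (signs K) (\<lambda>\<omega>. f (fun_upd \<omega> k (-1)))) / 2"
proof -
  have *: "signs (insert k K) = (\<lambda>(y, g). fun_upd g k y) ` ({-1, 1} \<times> signs K)"
    by (simp add: signs_def PiE_insert_eq)
  have inj: "inj_on (\<lambda>(y, g). fun_upd g k y) ({-1, 1 :: real} \<times> signs K)"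
    using inj_combinator'[OF assms(2), of "\<lambda>_. {-1, 1 :: real}"]
    by (auto simp: signs_def inj_on_def split: prod.splits)
  have c: "card (signs (insert k K)) = 2 * card (signs K)"
    unfolding * card_image[OF inj] by (simp add: card_cartesian_product)
  have s: "(\<Sum>\<omega>\<in>signs (insert k K). f \<omega>) =
      (\<Sum>\<omega>\<in>signs K. f (fun_upd \<omega> k 1)) + (\<Sum>\<omega>\<in>signs K. f (fun_upd \<omega> k (-1)))"
    unfolding * sum.reindex[OF inj]
    using sum.cartesian_product[of "\<lambda>y g. f (fun_upd g k y)" "signs K" "{-1, 1 :: real}"]
    by (simp add: o_def split_def add.commute)
  show ?thesis unfolding avg_def s c by (simp add: add_divide_distrib)
qed

text \<open>The recursion behind the moment estimates below: a new sign shifts the linear form by x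
  k or - x k, so each estimate is an induction on \<open>K\<close>.\<close>

lemma avg_signs_linear_insert:
  assumes "finite K" "k \<notin> K"
  shows "avg (signs (insert k K)) (\<lambda>\<omega>. f (\<Sum>l\<in>insert k K. \<omega> l * x l)) =
    (avg (signs K) (\<lambda>\<omega>. f (x k + (\<Sum>l\<in>K. \<omega> l * x l))) +
     avg (signs K) (\<lambda>\<omega>. f (- x k + (\<Sum>l\<in>K. \<omega> l * x l)))) / 2"
proof -
  have "(\<Sum>l\<in>insert k K. (fun_upd \<omega> k s) l * x l) = s * x k + (\<Sum>l\<in>K. \<omega> l * x l)" for \<omega> s
  proof -
    have "(\<Sum>l\<in>K. (fun_upd \<omega> k s) l * x l) = (\<Sum>l\<in>K. \<omega> l * x l)"
      using assms by (intro sum.cong) auto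
    then show ?thesis using assms by simp
  qed
  then show ?thesis by (simp add: avg_signs_insert[OF assms])
qed

section \<open>Moments and exponential moments of random sign sums\<close>

lemma two_pow_fact_le: "(2::real) ^ n * fact n \<le> fact (2 * n)"
proof (induction n)
  case (Suc n)
  have "2 * Suc n = Suc (Suc (2 * n))" by simp
  then have e: "(fact (2 * Suc n) :: real) = (2 * real n + 2) * (2 * real n + 1) * fact (2 * n)"
    by (simp only: fact_Suc) (simp add: add.commute)
  have "(2::real) ^ Suc n * fact (Suc n) = (2 * real n + 2) * 1 * (2 ^ n * fact n)"
    unfolding fact_Suc power_Suc by (simp add: distrib_right distrib_left)
  also have "\<dots> \<le> (2 * real n + 2) * (2 * real n + 1) * fact (2 * n)"
    using Suc by (intro mult_mono) auto
  finally show ?case unfolding e .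
qed simp

lemma cosh_sums_even: "(\<lambda>n. (x\<^sup>2) ^ n / fact (2 * n)) sums cosh (x::real)"
proof -
  have "(\<lambda>n. (\<lambda>n. if even n then x ^ n /\<^sub>R fact n else 0) (2 * n)) sums cosh x"
  proof (subst sums_mono_reindex)
    show "strict_mono (\<lambda>n. 2 * n :: nat)" by (simp add: strict_mono_def)
    show "(if even n then x ^ n /\<^sub>R fact n else 0) = 0" if "n \<notin> range (\<lambda>n. 2 * n :: nat)" for n
    proof -
      have "odd n" using that by (metis evenE rangeI)
      then show ?thesis by simp
    qed
  qed (rule cosh_converges)
  moreover have "(if even (2 * n) then x ^ (2 * n) /\<^sub>R fact (2 * n) else 0) = (x\<^sup>2) ^ n / fact (2 * n)" for n
    by (simp only: power_mult) (simp add: divide_inverse mult.commute)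
  ultimately show ?thesis by simp
qed

text \<open>Termwise comparison of the two power series in x^2, using (2 n)! >= 2^n n!. A random
  sign is thus sub-Gaussian with the Gaussian constant.\<close>

lemma cosh_le_exp_sq: "cosh (x::real) \<le> exp (x\<^sup>2 / 2)"
proof (rule sums_le[OF _ cosh_sums_even exp_converges])
  fix n
  have "(x\<^sup>2) ^ n / fact (2 * n) \<le> (x\<^sup>2) ^ n / (2 ^ n * fact n)"
    using two_pow_fact_le[of n] by (intro divide_left_mono) auto
  also have "\<dots> = (x\<^sup>2 / 2) ^ n /\<^sub>R fact n"
    unfolding power_divide by (simp add: divide_inverse mult.commute)
  finally show "(x\<^sup>2) ^ n / fact (2 * n) \<le> (x\<^sup>2 / 2) ^ n /\<^sub>R fact n" .
qed

text \<open>The right side is the expectation of exp ((c + x g)^2 / (2 B)) for a standard Gaussian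
  \<open>g\<close>. With u = x^2 / B, both exp u and 1 + u are at most 1 / (1 - u), which produces
  the two Gaussian factors.\<close>

lemma exp_sq_step:
  assumes B: "x\<^sup>2 < (B::real)"
  shows "(exp ((x + c)\<^sup>2 / (2 * B)) + exp ((- x + c)\<^sup>2 / (2 * B))) / 2
    \<le> sqrt (B / (B - x\<^sup>2)) * exp (c\<^sup>2 / (2 * (B - x\<^sup>2)))"
proof -
  have B0: "B > 0" using B by (smt (verit) zero_le_power2)
  define u where "u = x\<^sup>2 / B"
  have u: "0 \<le> u" "u < 1" using B B0 by (auto simp: u_def)
  have eq1: "(x + c)\<^sup>2 / (2 * B) = (x\<^sup>2 + c\<^sup>2) / (2 * B) + c * x / B"
    and eq2: "(- x + c)\<^sup>2 / (2 * B) = (x\<^sup>2 + c\<^sup>2) / (2 * B) - c * x / B"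
    using B0 by (simp_all add: field_simps power2_eq_square)
  have "(exp ((x + c)\<^sup>2 / (2 * B)) + exp ((- x + c)\<^sup>2 / (2 * B))) / 2
      = exp ((x\<^sup>2 + c\<^sup>2) / (2 * B)) * cosh (c * x / B)"
    unfolding eq1 eq2 cosh_def exp_add exp_diff by (simp add: exp_minus field_simps)
  also have "\<dots> \<le> exp ((x\<^sup>2 + c\<^sup>2) / (2 * B)) * exp ((c * x / B)\<^sup>2 / 2)"
    by (intro mult_left_mono cosh_le_exp_sq) simp
  also have "\<dots> = exp (u / 2) * exp (c\<^sup>2 / (2 * B) * (1 + u))"
    using B0 by (simp add: exp_add[symmetric] u_def field_simps power2_eq_square)
  also have "\<dots> \<le> sqrt (1 / (1 - u)) * exp (c\<^sup>2 / (2 * B) * (1 / (1 - u)))"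
  proof (intro mult_mono)
    have "1 - u \<le> exp (- u)" using exp_ge_add_one_self[of "- u"] by simp
    then have "exp u \<le> 1 / (1 - u)" using u by (simp add: exp_minus field_simps)
    moreover have "exp (u / 2) = sqrt (exp u)"
      using real_sqrt_unique[of "exp (u / 2)" "exp u"] by (simp add: exp_double[symmetric])
    ultimately show "exp (u / 2) \<le> sqrt (1 / (1 - u))"
      using real_sqrt_le_mono by presburger
    have "(1 + u) * (1 - u) \<le> 1" by (simp add: algebra_simps)
    then have "1 + u \<le> 1 / (1 - u)" using u by (simp add: field_simps)
    then show "exp (c\<^sup>2 / (2 * B) * (1 + u)) \<le> exp (c\<^sup>2 / (2 * B) * (1 / (1 - u)))"
      using B0 by (intro exp_le_cancel_iff[THEN iffD2] mult_left_mono) auto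
  qed (use u in auto)
  also have "\<dots> = sqrt (B / (B - x\<^sup>2)) * exp (c\<^sup>2 / (2 * (B - x\<^sup>2)))"
    using B0 B by (simp add: u_def field_simps)
  finally show ?thesis .
qed

text \<open>The bound has the form of a Gaussian integral, which is reproduced by averaging over one
  more sign; this is why the shift \<open>c\<close> is needed in the induction.\<close>

lemma avg_signs_exp_sq:
  assumes "finite K" "(\<Sum>k\<in>K. (x k)\<^sup>2) < (A::real)"
  shows "avg (signs K) (\<lambda>\<omega>. exp ((c + (\<Sum>k\<in>K. \<omega> k * x k))\<^sup>2 / (2 * A)))
    \<le> sqrt (A / (A - (\<Sum>k\<in>K. (x k)\<^sup>2))) * exp (c\<^sup>2 / (2 * (A - (\<Sum>k\<in>K. (x k)\<^sup>2))))"
  using assms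
proof (induction K arbitrary: c rule: finite_induct)
  case empty
  then show ?case by (simp add: avg_signs_empty)
next
  case (insert k K)
  define s where "s = (\<Sum>k\<in>K. (x k)\<^sup>2)"
  have s0: "0 \<le> s" by (simp add: s_def sum_nonneg)
  have lt: "s + (x k)\<^sup>2 < A" using insert by (simp add: s_def add.commute)
  then have lt': "s < A" by (smt (verit) zero_le_power2)
  have IH: "avg (signs K) (\<lambda>\<omega>. exp ((d + (\<Sum>k\<in>K. \<omega> k * x k))\<^sup>2 / (2 * A)))
    \<le> sqrt (A / (A - s)) * exp (d\<^sup>2 / (2 * (A - s)))" for d
    using insert.IH[of d] lt' by (simp add: s_def)
  have "avg (signs (insert k K)) (\<lambda>\<omega>. exp ((c + (\<Sum>k\<in>insert k K. \<omega> k * x k))\<^sup>2 / (2 * A)))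
     = (avg (signs K) (\<lambda>\<omega>. exp (((x k + c) + (\<Sum>k\<in>K. \<omega> k * x k))\<^sup>2 / (2 * A))) +
        avg (signs K) (\<lambda>\<omega>. exp (((- x k + c) + (\<Sum>k\<in>K. \<omega> k * x k))\<^sup>2 / (2 * A)))) / 2"
    unfolding avg_signs_linear_insert[OF insert(1,2), of "\<lambda>t. exp ((c + t)\<^sup>2 / (2 * A))" x]
    by (simp add: algebra_simps)
  also have "\<dots> \<le> (sqrt (A / (A - s)) * exp ((x k + c)\<^sup>2 / (2 * (A - s))) +
      sqrt (A / (A - s)) * exp ((- x k + c)\<^sup>2 / (2 * (A - s)))) / 2"
    by (intro divide_right_mono add_mono IH) simp
  also have "\<dots> = sqrt (A / (A - s)) * ((exp ((x k + c)\<^sup>2 / (2 * (A - s))) +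
      exp ((- x k + c)\<^sup>2 / (2 * (A - s)))) / 2)"
    by (simp add: algebra_simps)
  also have "\<dots> \<le> sqrt (A / (A - s)) * (sqrt ((A - s) / (A - s - (x k)\<^sup>2)) * exp (c\<^sup>2 / (2 * (A - s - (x k)\<^sup>2))))"
    using lt lt' s0 by (intro mult_left_mono exp_sq_step) auto
  also have "\<dots> = sqrt (A / (A - s - (x k)\<^sup>2)) * exp (c\<^sup>2 / (2 * (A - s - (x k)\<^sup>2)))"
    using lt lt' s0 by (simp add: real_sqrt_mult[symmetric] mult.assoc[symmetric])
  finally show ?case using insert by (simp add: s_def algebra_simps)
qed

lemma avg_signs_sq:
  "finite K \<Longrightarrow> avg (signs K) (\<lambda>\<omega>. (\<Sum>k\<in>K. \<omega> k * x k)\<^sup>2) = (\<Sum>k\<in>K. (x k)\<^sup>2)"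
proof (induction K rule: finite_induct)
  case empty
  then show ?case by (simp add: avg_signs_empty)
next
  case (insert k K)
  define S where "S = (\<lambda>\<omega>. \<Sum>k\<in>K. \<omega> k * x k)"
  have "avg (signs (insert k K)) (\<lambda>\<omega>. (\<Sum>k\<in>insert k K. \<omega> k * x k)\<^sup>2) =
     avg (signs K) (\<lambda>\<omega>. 1/2 * ((x k + S \<omega>)\<^sup>2 + (- x k + S \<omega>)\<^sup>2))"
    unfolding avg_signs_linear_insert[OF insert(1,2), of "\<lambda>t. t\<^sup>2" x] avg_cmult avg_add S_def by simp
  also have "(\<lambda>\<omega>. 1/2 * ((x k + S \<omega>)\<^sup>2 + (- x k + S \<omega>)\<^sup>2)) = (\<lambda>\<omega>. (S \<omega>)\<^sup>2 + (x k)\<^sup>2)"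
    by (rule ext) (simp add: power2_eq_square field_simps)
  also have "avg (signs K) \<dots> = (\<Sum>k\<in>K. (x k)\<^sup>2) + (x k)\<^sup>2"
    unfolding avg_add using insert by (simp add: avg_const S_def)
  finally show ?case using insert by simp
qed

text \<open>Averaging over the new sign removes the odd powers and adds 6 x^2 s + x^4, where s is
  the sum of the earlier squares. The right side grows by 6 x^2 s + 3 x^4.\<close>

lemma avg_signs_pow4:
  "finite K \<Longrightarrow> avg (signs K) (\<lambda>\<omega>. (\<Sum>k\<in>K. \<omega> k * x k) ^ 4) \<le> 3 * (\<Sum>k\<in>K. (x k)\<^sup>2)\<^sup>2"
proof (induction K rule: finite_induct)
  case empty
  then show ?case by (simp add: avg_signs_empty)
next
  case (insert k K)
  define S where "S = (\<lambda>\<omega>. \<Sum>k\<in>K. \<omega> k * x k)"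
  have "avg (signs (insert k K)) (\<lambda>\<omega>. (\<Sum>k\<in>insert k K. \<omega> k * x k) ^ 4) =
     avg (signs K) (\<lambda>\<omega>. ((x k + S \<omega>) ^ 4 + (- x k + S \<omega>) ^ 4) / 2)"
    unfolding avg_signs_linear_insert[OF insert(1,2), of "\<lambda>t. t ^ 4" x]
    using avg_cmult[of "signs K" "1/2" "\<lambda>\<omega>. (x k + S \<omega>) ^ 4 + (- x k + S \<omega>) ^ 4"]
    by (simp add: avg_add S_def)
  also have "(\<lambda>\<omega>. ((x k + S \<omega>) ^ 4 + (- x k + S \<omega>) ^ 4) / 2) =
      (\<lambda>\<omega>. (S \<omega>) ^ 4 + (6 * (x k)\<^sup>2 * (S \<omega>)\<^sup>2 + (x k) ^ 4))"
    by (rule ext) (simp add: power4_eq_xxxx power2_eq_square field_simps)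
  also have "avg (signs K) \<dots> = avg (signs K) (\<lambda>\<omega>. S \<omega> ^ 4) + (6 * (x k)\<^sup>2 * (\<Sum>k\<in>K. (x k)\<^sup>2) + (x k) ^ 4)"
    using insert by (simp add: avg_add avg_cmult avg_const avg_signs_sq S_def)
  also have "\<dots> \<le> 3 * (\<Sum>k\<in>K. (x k)\<^sup>2)\<^sup>2 + (6 * (x k)\<^sup>2 * (\<Sum>k\<in>K. (x k)\<^sup>2) + (x k) ^ 4)"
    using insert by (simp add: S_def)
  also have "\<dots> \<le> 3 * ((x k)\<^sup>2 + (\<Sum>k\<in>K. (x k)\<^sup>2))\<^sup>2"
  proof -
    have "(x k) ^ 4 = ((x k)\<^sup>2)\<^sup>2" by simp
    then show ?thesis using zero_le_power2[of "(x k)\<^sup>2"] by (simp add: power2_sum)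
  qed
  finally show ?case using insert by simp
qed

text \<open>Reciprocal of the quadratic Taylor bound for exp u: with w = u^2 / 2 the product (1 - u
  + w) (1 + u + w) equals 1 + w^2 >= 1.\<close>

lemma exp_neg_le_quadratic: "0 \<le> u \<Longrightarrow> exp (- u) \<le> 1 - u + u\<^sup>2 / (2::real)"
proof -
  assume u: "0 \<le> u"
  have p: "0 < 1 + u + u\<^sup>2 / 2" using u by (intro add_pos_nonneg) auto
  have "exp (- u) = 1 / exp u" by (simp add: exp_minus divide_inverse)
  also have "\<dots> \<le> 1 / (1 + u + u\<^sup>2 / 2)"
    by (intro divide_left_mono exp_lower_Taylor_quadratic u mult_pos_pos p) auto
  also have "\<dots> \<le> 1 - u + u\<^sup>2 / 2"
  proof -
    define w where "w = u\<^sup>2 / 2"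
    have "(1 - u + w) * (1 + u + w) = (1 + w)\<^sup>2 - u\<^sup>2"
      by (simp add: algebra_simps power2_eq_square)
    also have "\<dots> = 1 + w\<^sup>2" by (simp add: power2_sum w_def)
    finally have "1 \<le> (1 - u + u\<^sup>2 / 2) * (1 + u + u\<^sup>2 / 2)" by (simp add: w_def)
    then show ?thesis using p by (simp add: divide_le_eq)
  qed
  finally show ?thesis .
qed

text \<open>A small-ball estimate from the second and fourth moments only: at scale 6 s the
  quadratic bound for exp averages to at most 1 - 1/6 + 3/72 = 1 - 1/8.\<close>

lemma avg_signs_exp_neg_sq:
  assumes K: "finite K" and s: "s = (\<Sum>k\<in>K. (x k)\<^sup>2)" "0 < s"
  shows "avg (signs K) (\<lambda>\<omega>. exp (- ((\<Sum>k\<in>K. \<omega> k * x k)\<^sup>2 / (6 * s)))) \<le> exp (- 1/8)"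
proof -
  define S where "S = (\<lambda>\<omega>. \<Sum>k\<in>K. \<omega> k * x k)"
  have "avg (signs K) (\<lambda>\<omega>. exp (- ((S \<omega>)\<^sup>2 / (6 * s)))) \<le>
     avg (signs K) (\<lambda>\<omega>. 1 - ((1 / (6 * s)) * (S \<omega>)\<^sup>2 - (1 / (72 * s\<^sup>2)) * S \<omega> ^ 4))"
  proof (rule avg_mono)
    fix \<omega>
    have "exp (- ((S \<omega>)\<^sup>2 / (6 * s))) \<le> 1 - ((S \<omega>)\<^sup>2 / (6 * s)) + ((S \<omega>)\<^sup>2 / (6 * s))\<^sup>2 / 2"
      using s(2) by (intro exp_neg_le_quadratic) auto
    also have "\<dots> = 1 - ((1 / (6 * s)) * (S \<omega>)\<^sup>2 - (1 / (72 * s\<^sup>2)) * S \<omega> ^ 4)"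
    proof -
      have "((S \<omega>)\<^sup>2 / (6 * s))\<^sup>2 / 2 = (1 / (72 * s\<^sup>2)) * S \<omega> ^ 4"
        by (simp add: power_divide power_mult_distrib)
      then show ?thesis by simp
    qed
    finally show "exp (- ((S \<omega>)\<^sup>2 / (6 * s))) \<le> \<dots>" .
  qed
  also have "\<dots> = 1 - ((1 / (6 * s)) * s - (1 / (72 * s\<^sup>2)) * avg (signs K) (\<lambda>\<omega>. S \<omega> ^ 4))"
  proof -
    have "avg (signs K) (\<lambda>\<omega>. (S \<omega>)\<^sup>2) = s" unfolding S_def s(1) by (rule avg_signs_sq[OF K])
    then show ?thesis
      using avg_const[OF finite_signs[OF K] signs_nonempty, of 1] by (simp only: avg_diff avg_cmult)
  qed
  also have "\<dots> \<le> 1 - ((1 / (6 * s)) * s - (1 / (72 * s\<^sup>2)) * (3 * s\<^sup>2))"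
    using avg_signs_pow4[OF K, of x] unfolding S_def s(1)[symmetric]
    by (simp add: divide_right_mono)
  also have "\<dots> = 1 + (- 1/8)" using s(2) by (simp add: power2_eq_square)
  also have "\<dots> \<le> exp (- 1/8)" by (rule exp_ge_add_one_self)
  finally show ?thesis by (simp add: S_def)
qed

section \<open>Integer nets and the extreme singular values of sign matrices\<close>

definition grid :: "'a set \<Rightarrow> nat \<Rightarrow> ('a \<Rightarrow> int) set" where
  "grid K B = {z \<in> PiE K (\<lambda>_. {- int B..int B}). (\<Sum>k\<in>K. \<bar>z k\<bar>) \<le> int B}"

lemma finite_grid [simp]: "finite K \<Longrightarrow> finite (grid K B)"
  by (simp add: grid_def finite_PiE)

lemma sum_half_pow_abs: "(\<Sum>i\<in>{- int B..int B}. (1/2::real) ^ nat \<bar>i\<bar>) = 3 - 2 * (1/2) ^ B"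
proof (induction B)
  case (Suc B)
  have "{- int (Suc B)..int (Suc B)} = insert (- int (Suc B)) (insert (int (Suc B)) {- int B..int B})"
    by auto
  then have "(\<Sum>i\<in>{- int (Suc B)..int (Suc B)}. (1/2::real) ^ nat \<bar>i\<bar>) =
      (1/2) ^ Suc B + ((1/2) ^ Suc B + (\<Sum>i\<in>{- int B..int B}. (1/2::real) ^ nat \<bar>i\<bar>))"
    by (simp add: nat_add_distrib)
  then show ?case using Suc by simp
qed simp

text \<open>Counting by weights: give z the weight 2 to the power minus its l^1 norm. Each grid
  point weighs at least 2^(- B), while all integer vectors together weigh at most 3 per
  coordinate.\<close>

lemma card_grid_le:
  assumes "finite K"
  shows "real (card (grid K B)) \<le> 2 ^ B * 3 ^ card K"
proof -
  let ?P = "PiE K (\<lambda>_. {- int B..int B})"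
  have fin: "finite ?P" using assms by (simp add: finite_PiE)
  have "real (card (grid K B)) = (\<Sum>z\<in>grid K B. 1)" by simp
  also have "\<dots> \<le> (\<Sum>z\<in>grid K B. 2 ^ B * (\<Prod>k\<in>K. (1/2) ^ nat \<bar>z k\<bar>))"
  proof (rule sum_mono)
    fix z assume z: "z \<in> grid K B"
    have "int (\<Sum>k\<in>K. nat \<bar>z k\<bar>) \<le> int B" using z by (simp add: grid_def)
    then have le: "(\<Sum>k\<in>K. nat \<bar>z k\<bar>) \<le> B" by linarith
    have "(\<Prod>k\<in>K. (1/2::real) ^ nat \<bar>z k\<bar>) = (1/2) ^ (\<Sum>k\<in>K. nat \<bar>z k\<bar>)"
      by (simp add: power_sum)
    moreover have "(1/2::real) ^ B \<le> (1/2) ^ (\<Sum>k\<in>K. nat \<bar>z k\<bar>)"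
      using le by (intro power_decreasing) auto
    ultimately have "2 ^ B * (1/2::real) ^ B \<le> 2 ^ B * (\<Prod>k\<in>K. (1/2) ^ nat \<bar>z k\<bar>)"
      by simp
    then show "1 \<le> 2 ^ B * (\<Prod>k\<in>K. (1/2::real) ^ nat \<bar>z k\<bar>)"
      by (simp add: power_mult_distrib[symmetric])
  qed
  also have "\<dots> \<le> (\<Sum>z\<in>?P. 2 ^ B * (\<Prod>k\<in>K. (1/2) ^ nat \<bar>z k\<bar>))"
    using fin by (intro sum_mono2) (auto simp: grid_def prod_nonneg)
  also have "\<dots> = 2 ^ B * (\<Prod>k\<in>K. \<Sum>i\<in>{- int B..int B}. (1/2) ^ nat \<bar>i\<bar>)"
    unfolding sum_distrib_left[symmetric]
    by (subst prod_sum_PiE) (use assms in auto)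
  also have "\<dots> \<le> 2 ^ B * (\<Prod>k\<in>K. 3)"
    unfolding sum_half_pow_abs
    using power_le_one[of "1/2::real" B] by (intro mult_left_mono prod_mono) auto
  finally show ?thesis by simp
qed

lemma L2_set_sq: "(L2_set f A)\<^sup>2 = (\<Sum>i\<in>A. (f i)\<^sup>2)"
  by (simp add: L2_set_def sum_nonneg)

text \<open>Rounding down with mesh 1 / (N sqrt |K|) errs by at most 1 / N in Euclidean norm. The
  rounded vector has norm at most 2, so the squares of its integer coordinates sum to at most 4 N^2
  |K|. Since |z| <= z^2 for integers, this also bounds the l^1 norm, which
  \<open>card_grid_le\<close> controls.\<close>

lemma grid_approx:
  fixes x :: "'a \<Rightarrow> real"
  assumes K: "finite K" "K \<noteq> {}" and N: "N \<ge> (1::nat)" and x: "L2_set x K \<le> 1"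
  obtains z where "z \<in> grid K (4 * N\<^sup>2 * card K)"
    "L2_set (\<lambda>k. x k - real_of_int (z k) / (real N * sqrt (card K))) K \<le> 1 / real N"
proof -
  define r where "r = card K"
  have r: "r \<ge> 1" using K by (simp add: r_def Suc_leI card_gt_0_iff)
  define h where "h = real N * sqrt r"
  have h: "h > 0" using r N by (simp add: h_def)
  define z where "z = restrict (\<lambda>k. \<lfloor>x k * h\<rfloor>) K"
  define y where "y = (\<lambda>k. real_of_int (z k) / h)"
  have "\<bar>x k - y k\<bar> \<le> 1 / h" if "k \<in> K" for k
  proof -
    have "\<bar>x k * h - of_int \<lfloor>x k * h\<rfloor>\<bar> \<le> 1" by linarith
    then have "\<bar>(x k - y k) * h\<bar> \<le> 1" using that h by (simp add: y_def z_def algebra_simps)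
    then show ?thesis using h by (simp add: abs_mult pos_le_divide_eq)
  qed
  then have "(\<Sum>k\<in>K. (x k - y k)\<^sup>2) \<le> (\<Sum>k\<in>K. (1 / h)\<^sup>2)"
    using h by (intro sum_mono) (simp add: abs_le_square_iff[symmetric])
  also have "\<dots> = (1 / real N)\<^sup>2" using r N
    by (simp add: h_def r_def[symmetric] power_divide power_mult_distrib)
  finally have d: "L2_set (\<lambda>k. x k - y k) K \<le> 1 / real N"
    unfolding L2_set_def by (intro real_le_lsqrt) auto
  have "L2_set y K = L2_set (\<lambda>k. x k + (y k - x k)) K" by simp
  also have "\<dots> \<le> L2_set x K + L2_set (\<lambda>k. y k - x k) K" by (rule L2_set_triangle_ineq)
  also have "L2_set (\<lambda>k. y k - x k) K = L2_set (\<lambda>k. x k - y k) K"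
    by (simp add: L2_set_def power2_commute)
  also have "L2_set x K + \<dots> \<le> 1 + 1 / real N" using x d by simp
  also have "\<dots> \<le> 2" using N by simp
  finally have "(L2_set y K)\<^sup>2 \<le> 2\<^sup>2" by (intro power_mono) auto
  then have "(\<Sum>k\<in>K. (real_of_int (z k))\<^sup>2) / h\<^sup>2 \<le> 4"
    by (simp add: L2_set_sq y_def power_divide sum_divide_distrib)
  then have "(\<Sum>k\<in>K. (real_of_int (z k))\<^sup>2) \<le> 4 * h\<^sup>2" using h by (simp add: divide_le_eq)
  then have "real_of_int (\<Sum>k\<in>K. (z k)\<^sup>2) \<le> real_of_int (int (4 * N\<^sup>2 * r))"
    by (simp add: h_def power_mult_distrib)
  then have z2: "(\<Sum>k\<in>K. (z k)\<^sup>2) \<le> int (4 * N\<^sup>2 * r)" by linarith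
  have "(\<Sum>k\<in>K. \<bar>z k\<bar>) \<le> (\<Sum>k\<in>K. (z k)\<^sup>2)"
  proof (rule sum_mono)
    fix k
    have "\<bar>z k\<bar> * 1 \<le> \<bar>z k\<bar> * \<bar>z k\<bar>"
      by (cases "z k = 0") (simp, intro mult_left_mono, auto)
    then show "\<bar>z k\<bar> \<le> (z k)\<^sup>2" by (simp add: power2_eq_square)
  qed
  then have z1: "(\<Sum>k\<in>K. \<bar>z k\<bar>) \<le> int (4 * N\<^sup>2 * r)" using z2 by linarith
  have "\<bar>z k\<bar> \<le> int (4 * N\<^sup>2 * r)" if "k \<in> K" for k
    using member_le_sum[of k K "\<lambda>k. \<bar>z k\<bar>"] that K z1 by simp
  then have "z \<in> PiE K (\<lambda>_. {- int (4 * N\<^sup>2 * r)..int (4 * N\<^sup>2 * r)})"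
    by (force simp: PiE_iff z_def abs_le_iff)
  then have "z \<in> grid K (4 * N\<^sup>2 * r)" using z1 by (simp add: grid_def)
  then show thesis using that d by (simp add: r_def h_def y_def)
qed

definition sign_mats :: "'a set \<Rightarrow> 'b set \<Rightarrow> ('a \<Rightarrow> 'b \<Rightarrow> real) set" where
  "sign_mats I K = PiE I (\<lambda>_. signs K)"

lemma finite_sign_mats [simp]: "finite I \<Longrightarrow> finite K \<Longrightarrow> finite (sign_mats I K)"
  by (simp add: sign_mats_def finite_PiE)

lemma sign_mats_nonempty [simp]: "sign_mats I K \<noteq> {}"
  by (simp add: sign_mats_def PiE_eq_empty_iff)

lemma avg_of_bool_union:
  assumes "finite Z"
  shows "avg A (\<lambda>R. of_bool (\<exists>z\<in>Z. P z R)) \<le> (\<Sum>z\<in>Z. avg A (\<lambda>R. of_bool (P z R)))"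
  unfolding avg_sum[symmetric]
proof (rule avg_mono)
  fix R
  show "of_bool (\<exists>z\<in>Z. P z R) \<le> (\<Sum>z\<in>Z. of_bool (P z R) :: real)"
  proof (cases "\<exists>z\<in>Z. P z R")
    case True
    then obtain z where "z \<in> Z" "P z R" by blast
    then have "(1::real) = of_bool (P z R)" by simp
    also have "\<dots> \<le> (\<Sum>z\<in>Z. of_bool (P z R))"
      using assms \<open>z \<in> Z\<close> by (intro member_le_sum) auto
    finally show ?thesis using True by simp
  qed (simp add: sum_nonneg)
qed

text \<open>Chernoff bound over independent rows. Taking A = 8 in \<open>avg_signs_exp_sq\<close>
  gives the exponent S^2 / 16 and a factor at most sqrt (8 / (8 - 4)) per row. Squared norms up to 4
  are allowed because rounded unit vectors may leave the unit ball.\<close>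

lemma sign_mats_upper_tail:
  assumes I: "finite I" and K: "finite K" and x: "(\<Sum>k\<in>K. (x k)\<^sup>2) \<le> 4"
  shows "avg (sign_mats I K) (\<lambda>R. of_bool (T \<le> (\<Sum>i\<in>I. (\<Sum>k\<in>K. R i k * x k)\<^sup>2)))
    \<le> exp (- T / 16) * sqrt 2 ^ card I"
proof -
  define S where "S = (\<lambda>\<omega>. \<Sum>k\<in>K. \<omega> k * x k)"
  have one: "avg (signs K) (\<lambda>\<omega>. exp ((S \<omega>)\<^sup>2 / 16)) \<le> sqrt 2"
  proof -
    have "avg (signs K) (\<lambda>\<omega>. exp ((S \<omega>)\<^sup>2 / 16)) \<le> sqrt (8 / (8 - (\<Sum>k\<in>K. (x k)\<^sup>2)))"
      using avg_signs_exp_sq[OF K, of x 8 0] x by (simp add: S_def)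
    also have "\<dots> \<le> sqrt 2" using x by (simp add: divide_le_eq)
    finally show ?thesis .
  qed
  have "avg (sign_mats I K) (\<lambda>R. of_bool (T \<le> (\<Sum>i\<in>I. (S (R i))\<^sup>2))) \<le>
      avg (sign_mats I K) (\<lambda>R. exp (- T / 16) * (\<Prod>i\<in>I. exp ((S (R i))\<^sup>2 / 16)))"
  proof (rule avg_mono)
    fix R
    have "exp (- T / 16) * (\<Prod>i\<in>I. exp ((S (R i))\<^sup>2 / 16)) = exp (((\<Sum>i\<in>I. (S (R i))\<^sup>2) - T) / 16)"
      by (simp add: exp_sum[OF I, symmetric] exp_add[symmetric] sum_divide_distrib[symmetric] diff_divide_distrib)
    then show "of_bool (T \<le> (\<Sum>i\<in>I. (S (R i))\<^sup>2)) \<le> exp (- T / 16) * (\<Prod>i\<in>I. exp ((S (R i))\<^sup>2 / 16))"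
      by (auto simp: of_bool_def)
  qed
  also have "\<dots> = exp (- T / 16) * (\<Prod>i\<in>I. avg (signs K) (\<lambda>\<omega>. exp ((S \<omega>)\<^sup>2 / 16)))"
    unfolding avg_cmult sign_mats_def using avg_PiE_prod[OF I, of "\<lambda>_. signs K" "\<lambda>_ \<omega>. exp ((S \<omega>)\<^sup>2 / 16)"] K
    by simp
  also have "\<dots> \<le> exp (- T / 16) * (\<Prod>i\<in>I. sqrt 2)"
    by (intro mult_left_mono prod_mono conjI one avg_nonneg) auto
  finally show ?thesis by (simp add: S_def)
qed

text \<open>At scale 1 / (6 s) the threshold |I| s / 2 contributes exp (|I| / 12), and the rows
  contribute exp (- |I| / 8).\<close>

lemma sign_mats_lower_tail:
  fixes s :: real
  assumes I: "finite I" and K: "finite K" and s: "s = (\<Sum>k\<in>K. (x k)\<^sup>2)" "0 < s"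
  shows "avg (sign_mats I K) (\<lambda>R. of_bool ((\<Sum>i\<in>I. (\<Sum>k\<in>K. R i k * x k)\<^sup>2) \<le> card I * s / 2))
    \<le> exp (- real (card I) / 24)"
proof -
  define S where "S = (\<lambda>\<omega>. \<Sum>k\<in>K. \<omega> k * x k)"
  define m where "m = real (card I)"
  have one: "avg (signs K) (\<lambda>\<omega>. exp (- ((S \<omega>)\<^sup>2 / (6 * s)))) \<le> exp (- 1/8)"
    using avg_signs_exp_neg_sq[OF K s] by (simp add: S_def)
  have "avg (sign_mats I K) (\<lambda>R. of_bool ((\<Sum>i\<in>I. (S (R i))\<^sup>2) \<le> m * s / 2)) \<le>
      avg (sign_mats I K) (\<lambda>R. exp (m / 12) * (\<Prod>i\<in>I. exp (- ((S (R i))\<^sup>2 / (6 * s)))))"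
  proof (rule avg_mono)
    fix R
    have eq: "exp (m / 12) * (\<Prod>i\<in>I. exp (- ((S (R i))\<^sup>2 / (6 * s)))) =
        exp (m / 12 - (\<Sum>i\<in>I. (S (R i))\<^sup>2) / (6 * s))"
      by (simp add: exp_sum[OF I, symmetric] exp_add[symmetric] sum_divide_distrib[symmetric] sum_negf)
    show "of_bool ((\<Sum>i\<in>I. (S (R i))\<^sup>2) \<le> m * s / 2) \<le> exp (m / 12) * (\<Prod>i\<in>I. exp (- ((S (R i))\<^sup>2 / (6 * s))))"
      unfolding eq using s(2) by (auto simp: of_bool_def field_simps)
  qed
  also have "\<dots> = exp (m / 12) * (\<Prod>i\<in>I. avg (signs K) (\<lambda>\<omega>. exp (- ((S \<omega>)\<^sup>2 / (6 * s)))))"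
    unfolding avg_cmult sign_mats_def
    using avg_PiE_prod[OF I, of "\<lambda>_. signs K" "\<lambda>_ \<omega>. exp (- ((S \<omega>)\<^sup>2 / (6 * s)))"] K by simp
  also have "\<dots> \<le> exp (m / 12) * (\<Prod>i\<in>I. exp (- 1/8))"
    by (intro mult_left_mono prod_mono conjI one avg_nonneg) auto
  also have "\<dots> = exp (- m / 24)"
    by (simp add: m_def exp_of_nat_mult[symmetric] exp_add[symmetric])
  finally show ?thesis by (simp add: S_def m_def)
qed

lemma L2_set_scale: "L2_set (\<lambda>i. c * f i) A = \<bar>c\<bar> * L2_set f A"
  by (simp add: L2_set_def power_mult_distrib sum_distrib_left[symmetric] real_sqrt_mult)

text \<open>If \<open>s\<close> is the norm of \<open>A\<close>, rounding to the grid gives \<open>s \<le> B + s / 2\<close>.\<close>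

lemma op_bound_from_grid:
  fixes A :: "'a \<Rightarrow> 'b \<Rightarrow> real"
  assumes I: "finite I" and K: "finite K" "K \<noteq> {}"
    and B: "\<And>z. z \<in> grid K (16 * card K) \<Longrightarrow>
      L2_set (\<lambda>k. real_of_int (z k) / (2 * sqrt (card K))) K \<le> 2 \<Longrightarrow>
      L2_set (\<lambda>i. \<Sum>k\<in>K. A i k * (real_of_int (z k) / (2 * sqrt (card K)))) I \<le> B"
  shows "L2_set (\<lambda>i. \<Sum>k\<in>K. A i k * x k) I \<le> 2 * B * L2_set x K"
proof -
  define f where "f = (\<lambda>x. L2_set (\<lambda>i. \<Sum>k\<in>K. A i k * x k) I)"
  define U where "U = {x. L2_set x K \<le> 1}"
  have f_add: "f (\<lambda>k. x k + y k) \<le> f x + f y" for x y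
    unfolding f_def distrib_left sum.distrib by (rule L2_set_triangle_ineq)
  have f_scale: "f (\<lambda>k. c * x k) = \<bar>c\<bar> * f x" for c x
    unfolding f_def L2_set_scale[symmetric] by (simp add: sum_distrib_left mult_ac)
  \<comment> \<open>The supremum must be known to be finite before s <= B + s / 2 can be solved for
    s; a crude bound by the entries of \<open>A\<close> is enough.\<close>
  have bdd: "bdd_above (f ` U)"
  proof (rule bdd_aboveI2)
    fix x assume "x \<in> U"
    then have x: "L2_set x K \<le> 1" by (simp add: U_def)
    have "f x \<le> (\<Sum>i\<in>I. \<bar>\<Sum>k\<in>K. A i k * x k\<bar>)" unfolding f_def by (rule L2_set_le_sum_abs)
    also have "\<dots> \<le> (\<Sum>i\<in>I. \<Sum>k\<in>K. \<bar>A i k\<bar>)"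
    proof (rule sum_mono)
      fix i
      have "\<bar>\<Sum>k\<in>K. A i k * x k\<bar> \<le> (\<Sum>k\<in>K. \<bar>A i k * x k\<bar>)" by (rule sum_abs)
      also have "\<dots> \<le> (\<Sum>k\<in>K. \<bar>A i k\<bar> * 1)"
      proof (rule sum_mono)
        fix k assume k: "k \<in> K"
        have "\<bar>x k\<bar> = L2_set x {k}" by (simp add: L2_set_def)
        also have "\<dots> \<le> L2_set x K"
          unfolding L2_set_def using k K by (intro real_sqrt_le_mono sum_mono2) auto
        finally show "\<bar>A i k * x k\<bar> \<le> \<bar>A i k\<bar> * 1"
          using x by (simp add: abs_mult mult_left_le)
      qed
      finally show "\<bar>\<Sum>k\<in>K. A i k * x k\<bar> \<le> (\<Sum>k\<in>K. \<bar>A i k\<bar>)" by simp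
    qed
    finally show "f x \<le> (\<Sum>i\<in>I. \<Sum>k\<in>K. \<bar>A i k\<bar>)" .
  qed
  define s where "s = Sup (f ` U)"
  have le_s: "f x \<le> s" if "x \<in> U" for x unfolding s_def using bdd that by (intro cSUP_upper) auto
  have "f x \<le> B + s / 2" if "x \<in> U" for x
  proof -
    have x: "L2_set x K \<le> 1" using that by (simp add: U_def)
    obtain z where z: "z \<in> grid K (4 * 2\<^sup>2 * card K)"
      "L2_set (\<lambda>k. x k - real_of_int (z k) / (real 2 * sqrt (card K))) K \<le> 1 / real 2"
      by (rule grid_approx[OF K _ x, of 2]) auto
    define y where "y = (\<lambda>k. real_of_int (z k) / (2 * sqrt (card K)))"
    have d: "L2_set (\<lambda>k. x k - y k) K \<le> 1/2" using z by (simp add: y_def)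
    have d': "L2_set (\<lambda>k. y k - x k) K = L2_set (\<lambda>k. x k - y k) K"
      by (simp add: L2_set_def power2_commute)
    have "L2_set y K = L2_set (\<lambda>k. x k + (y k - x k)) K" by simp
    also have "\<dots> \<le> L2_set x K + L2_set (\<lambda>k. y k - x k) K" by (rule L2_set_triangle_ineq)
    finally have "L2_set y K \<le> 2" using x d d' by simp
    then have fy: "f y \<le> B" using B[of z] z(1) by (simp add: f_def y_def)
    have "f x = f (\<lambda>k. y k + (x k - y k))" by simp
    also have "\<dots> \<le> f y + f (\<lambda>k. x k - y k)" by (rule f_add)
    also have "f (\<lambda>k. x k - y k) = 1/2 * f (\<lambda>k. 2 * (x k - y k))" unfolding f_scale by simp
    also have "f (\<lambda>k. 2 * (x k - y k)) \<le> s"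
    proof (intro le_s)
      have "L2_set (\<lambda>k. 2 * (x k - y k)) K = \<bar>2\<bar> * L2_set (\<lambda>k. x k - y k) K" by (rule L2_set_scale)
      then show "(\<lambda>k. 2 * (x k - y k)) \<in> U" using d unfolding U_def mem_Collect_eq by linarith
    qed
    finally show ?thesis using fy by simp
  qed
  moreover have "(\<lambda>_. 0) \<in> U" by (simp add: U_def L2_set_def)
  ultimately have "s \<le> B + s / 2" unfolding s_def by (intro cSUP_least) auto
  then have s: "s \<le> 2 * B" by simp
  show ?thesis
  proof (cases "L2_set x K = 0")
    case True
    then have "\<forall>k\<in>K. x k = 0" using K by (simp add: L2_set_eq_0_iff)
    then show ?thesis using True by (simp add: L2_set_def)
  next
    case False
    then have p: "L2_set x K > 0" using L2_set_nonneg[of x K] by linarith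
    define u where "u = (\<lambda>k. (1 / L2_set x K) * x k)"
    have "u \<in> U" using p by (simp only: U_def u_def L2_set_scale mem_Collect_eq) simp
    then have "f u \<le> 2 * B" using le_s s by fastforce
    moreover have "f u = f x / L2_set x K" unfolding u_def f_scale using p by simp
    ultimately have "f x \<le> 2 * B * L2_set x K" using p by (simp add: divide_le_eq)
    then show ?thesis by (simp add: f_def)
  qed
qed

text \<open>Number of grid points times the tail of one point. Since 2 <= e and 3 <= 4, two of the
  seven extra units in the exponent pay for 3^r and the other five give 2^(- 5 r) <= 1/32.\<close>

lemma grid_union_bound:
  assumes "r \<ge> (1::nat)"
  shows "2 ^ (D * r) * 3 ^ r * exp (- (real D + 7) * real r) \<le> 1/32"
proof -
  have "exp (- (real D + 7) * real r) = exp (real ((D + 7) * r) * (- 1))"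
    by (rule arg_cong[of _ _ exp]) (simp add: algebra_simps)
  also have "\<dots> = exp (- 1) ^ ((D + 7) * r)" by (rule exp_of_nat_mult)
  also have "\<dots> \<le> (1/2) ^ ((D + 7) * r)"
  proof (intro power_mono)
    have "(2::real) \<le> exp 1" using exp_ge_add_one_self[of "1::real"] by simp
    then have "inverse (exp 1) \<le> inverse (2::real)" by (rule le_imp_inverse_le) (rule zero_less_numeral)
    then show "exp (- 1 :: real) \<le> 1/2" unfolding exp_minus inverse_eq_divide .
  qed auto
  finally have e: "exp (- (real D + 7) * real r) \<le> (1/2) ^ ((D + 7) * r)" .
  have reorder: "t ^ a * t ^ b * h ^ (a + b + c) = (t ^ a * h ^ a) * (t ^ b * h ^ b) * h ^ c"
    for t h :: real and a b c
    by (simp add: power_add)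
  have half: "2 ^ n * (1/2::real) ^ n = 1" for n
    unfolding power_mult_distrib[symmetric] by simp
  have "(3::real) ^ r \<le> (2 ^ 2) ^ r" by (intro power_mono) auto
  also have "\<dots> = 2 ^ (2 * r)" by (rule power_mult[symmetric])
  finally have t: "(3::real) ^ r \<le> 2 ^ (2 * r)" .
  have "2 ^ (D * r) * 3 ^ r * exp (- (real D + 7) * real r)
      \<le> 2 ^ (D * r) * 2 ^ (2 * r) * (1/2) ^ ((D + 7) * r)"
    by (rule mult_mono[OF mult_left_mono[OF t] e]) simp_all
  also have "(D + 7) * r = D * r + 2 * r + 5 * r" by (simp add: algebra_simps)
  also have "2 ^ (D * r) * 2 ^ (2 * r) * (1/2::real) ^ (D * r + 2 * r + 5 * r)
     = (2 ^ (D * r) * (1/2) ^ (D * r)) * (2 ^ (2 * r) * (1/2) ^ (2 * r)) * (1/2) ^ (5 * r)"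
    by (rule reorder)
  also have "\<dots> = (1/2) ^ (5 * r)" unfolding half mult_1 ..
  also have "\<dots> \<le> (1/2) ^ 5" using assms by (intro power_decreasing) auto
  also have "(1/2::real) ^ 5 = 1/32" by (simp add: power_divide)
  finally show ?thesis .
qed

text \<open>Union bound over the grid with N = 2, so D = 4 N^2 = 16. The threshold 384 m yields exp
  (- 24 m); one unit is spent on the factor sqrt 2 per row, and 23 = 16 + 7 is what
  \<open>grid_union_bound\<close> asks for, once r <= m.\<close>

lemma sign_mats_upper:
  fixes I :: "'a set" and K :: "'b set"
  assumes I: "finite I" and K: "finite K" "K \<noteq> {}" and le: "card K \<le> card I"
  shows "avg (sign_mats I K) (\<lambda>R. of_bool (\<not> (\<forall>x. L2_set (\<lambda>i. \<Sum>k\<in>K. R i k * x k) I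
      \<le> 2 * sqrt (384 * card I) * L2_set x K))) \<le> 1/32"
proof -
  define r m where "r = card K" and "m = card I"
  have r: "r \<ge> 1" using K by (simp add: r_def Suc_leI card_gt_0_iff)
  define y where "y = (\<lambda>(z :: 'b \<Rightarrow> int) k. real_of_int (z k) / (2 * sqrt r))"
  define P where "P = (\<lambda>z (R :: 'a \<Rightarrow> 'b \<Rightarrow> real). 384 * m \<le> (\<Sum>i\<in>I. (\<Sum>k\<in>K. R i k * y z k)\<^sup>2))"
  define Z where "Z = {z \<in> grid K (16 * r). L2_set (y z) K \<le> 2}"
  have finZ: "finite Z" using K by (simp add: Z_def)
  have "avg (sign_mats I K) (\<lambda>R. of_bool (\<not> (\<forall>x. L2_set (\<lambda>i. \<Sum>k\<in>K. R i k * x k) I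
      \<le> 2 * sqrt (384 * m) * L2_set x K))) \<le> avg (sign_mats I K) (\<lambda>R. of_bool (\<exists>z\<in>Z. P z R))"
  proof (rule avg_mono)
    fix R :: "'a \<Rightarrow> 'b \<Rightarrow> real"
    have "\<forall>x. L2_set (\<lambda>i. \<Sum>k\<in>K. R i k * x k) I \<le> 2 * sqrt (384 * m) * L2_set x K"
      if nb: "\<not> (\<exists>z\<in>Z. P z R)"
    proof (intro allI op_bound_from_grid[OF I K])
      fix z assume "z \<in> grid K (16 * card K)"
        "L2_set (\<lambda>k. real_of_int (z k) / (2 * sqrt (card K))) K \<le> 2"
      then have "z \<in> Z" by (simp add: Z_def y_def r_def)
      then have "\<not> P z R" using nb by blast
      then show "L2_set (\<lambda>i. \<Sum>k\<in>K. R i k * (real_of_int (z k) / (2 * sqrt (card K)))) I \<le> sqrt (384 * m)"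
        unfolding L2_set_def by (intro real_sqrt_le_mono) (simp add: P_def y_def r_def)
    qed
    then show "of_bool (\<not> (\<forall>x. L2_set (\<lambda>i. \<Sum>k\<in>K. R i k * x k) I
        \<le> 2 * sqrt (384 * m) * L2_set x K)) \<le> (of_bool (\<exists>z\<in>Z. P z R) :: real)"
      by (auto simp: of_bool_def)
  qed
  also have "\<dots> \<le> (\<Sum>z\<in>Z. avg (sign_mats I K) (\<lambda>R. of_bool (P z R)))"
    by (rule avg_of_bool_union[OF finZ])
  also have "\<dots> \<le> (\<Sum>z\<in>Z. exp (- real (384 * m) / 16) * sqrt 2 ^ m)"
  proof (rule sum_mono)
    fix z assume "z \<in> Z"
    then have "L2_set (y z) K \<le> 2" by (simp add: Z_def)
    then have "(L2_set (y z) K)\<^sup>2 \<le> 2\<^sup>2" by (intro power_mono) auto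
    then have "(\<Sum>k\<in>K. (y z k)\<^sup>2) \<le> 4" by (simp add: L2_set_sq)
    then show "avg (sign_mats I K) (\<lambda>R. of_bool (P z R)) \<le> exp (- real (384 * m) / 16) * sqrt 2 ^ m"
      unfolding P_def m_def by (rule sign_mats_upper_tail[OF I K(1)])
  qed
  also have "\<dots> = real (card Z) * (exp (- 24 * real m) * sqrt 2 ^ m)" by simp
  also have "\<dots> \<le> (2 ^ (16 * r) * 3 ^ r) * exp (- (real 16 + 7) * real r)"
  proof (intro mult_mono)
    have "real (card Z) \<le> real (card (grid K (16 * r)))"
      using K by (simp add: card_mono Z_def)
    also have "\<dots> \<le> 2 ^ (16 * r) * 3 ^ r" unfolding r_def by (rule card_grid_le[OF K(1)])
    finally show "real (card Z) \<le> 2 ^ (16 * r) * 3 ^ r" .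
    have "sqrt 2 \<le> 2" by (rule real_le_lsqrt) auto
    also have "(2::real) \<le> exp 1" using exp_ge_add_one_self[of "1::real"] by simp
    finally have "sqrt 2 ^ m \<le> exp 1 ^ m" by (intro power_mono) auto
    then have "exp (- 24 * real m) * sqrt 2 ^ m \<le> exp (- 24 * real m) * exp 1 ^ m" by simp
    also have "\<dots> = exp (- 23 * real m)" by (simp add: exp_of_nat_mult[symmetric] exp_add[symmetric])
    also have "\<dots> \<le> exp (- (real 16 + 7) * real r)" using le by (simp add: r_def m_def)
    finally show "exp (- 24 * real m) * sqrt 2 ^ m \<le> exp (- (real 16 + 7) * real r)" .
  qed auto
  also have "\<dots> \<le> 1/32" by (rule grid_union_bound[OF r])
  finally show ?thesis by (simp add: m_def)
qed

text \<open>The grid of mesh \<open>1/400\<close> has at most \<open>2 ^ (D r) 3 ^ r\<close> points with \<open>D = 640000\<close>, and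
  \<open>15360168 = 24 (D + 7)\<close> lets the small-ball estimate \<open>exp (- m / 24)\<close> beat this number.\<close>

lemma sign_mats_lower:
  fixes I :: "'a set" and K :: "'b set"
  assumes I: "finite I" and K: "finite K" "K \<noteq> {}"
    and le: "card K = 1 \<or> 15360168 * card K \<le> card I"
  shows "avg (sign_mats I K) (\<lambda>R. of_bool (\<not> (\<forall>x. sqrt (card I) / 2 * L2_set x K
      \<le> L2_set (\<lambda>i. \<Sum>k\<in>K. R i k * x k) I))) \<le> 1/16"
proof (cases "card K = 1")
  \<comment> \<open>A single column of signs has norm exactly sqrt |I|. This case serves the small
    ranks.\<close>
  case True
  then obtain k where k: "K = {k}" by (auto simp: card_1_singleton_iff)
  have "sqrt (card I) / 2 * L2_set x K \<le> L2_set (\<lambda>i. \<Sum>k\<in>K. R i k * x k) I"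
    if "R \<in> sign_mats I K" for R and x :: "'b \<Rightarrow> real"
  proof -
    have "(R i k * x k)\<^sup>2 = (x k)\<^sup>2" if "i \<in> I" for i
      using signs_sq[of "R i" K k] \<open>R \<in> sign_mats I K\<close> that k
      by (simp add: sign_mats_def PiE_iff power_mult_distrib power2_eq_square)
    then have "L2_set (\<lambda>i. \<Sum>k\<in>K. R i k * x k) I = sqrt (card I) * \<bar>x k\<bar>"
      by (simp add: L2_set_def k real_sqrt_mult)
    then show ?thesis by (simp add: k L2_set_def field_simps)
  qed
  then have "avg (sign_mats I K) (\<lambda>R. of_bool (\<not> (\<forall>x. sqrt (card I) / 2 * L2_set x K
      \<le> L2_set (\<lambda>i. \<Sum>k\<in>K. R i k * x k) I))) = avg (sign_mats I K) (\<lambda>R. 0)"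
    by (intro avg_cong) simp
  also have "\<dots> = 0" by (simp add: avg_def)
  finally show ?thesis by simp
next
  case False
  define D :: nat where "D = 640000"
  define r m where "r = card K" and "m = card I"
  have r: "r \<ge> 1" using K by (simp add: r_def Suc_leI card_gt_0_iff)
  have m: "15360168 * r \<le> m" using le False by (simp add: r_def m_def)
  define y where "y = (\<lambda>(z :: 'b \<Rightarrow> int) k. real_of_int (z k) / (real 400 * sqrt r))"
  define P where "P = (\<lambda>z (R :: 'a \<Rightarrow> 'b \<Rightarrow> real).
    (\<Sum>i\<in>I. (\<Sum>k\<in>K. R i k * y z k)\<^sup>2) \<le> m * (\<Sum>k\<in>K. (y z k)\<^sup>2) / 2)"
  define Q where "Q = (\<lambda>(R :: 'a \<Rightarrow> 'b \<Rightarrow> real). \<forall>x. L2_set (\<lambda>i. \<Sum>k\<in>K. R i k * x k) I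
      \<le> 2 * sqrt (384 * m) * L2_set x K)"
  define Z where "Z = {z \<in> grid K (D * r). 0 < (\<Sum>k\<in>K. (y z k)\<^sup>2)}"
  have finZ: "finite Z" using K by (simp add: Z_def)
  have det: "sqrt m / 2 * L2_set x K \<le> L2_set (\<lambda>i. \<Sum>k\<in>K. R i k * x k) I"
    if Q: "Q R" and nb: "\<not> (\<exists>z\<in>Z. P z R)" for R and x :: "'b \<Rightarrow> real"
  proof -
    define f where "f = (\<lambda>x. L2_set (\<lambda>i. \<Sum>k\<in>K. R i k * x k) I)"
    have f_add: "f (\<lambda>k. x k + y k) \<le> f x + f y" for x y
      unfolding f_def distrib_left sum.distrib by (rule L2_set_triangle_ineq)
    have f_scale: "f (\<lambda>k. c * x k) = \<bar>c\<bar> * f x" for c x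
      unfolding f_def L2_set_scale[symmetric] by (simp add: sum_distrib_left mult_ac)
    have unit: "sqrt m / 2 \<le> f u" if u: "L2_set u K = 1" for u
    proof -
      obtain z where z: "z \<in> grid K (4 * 400\<^sup>2 * card K)"
        "L2_set (\<lambda>k. u k - real_of_int (z k) / (real 400 * sqrt (card K))) K \<le> 1 / real 400"
        by (rule grid_approx[OF K _ eq_refl[OF u], of 400]) auto
      have d: "L2_set (\<lambda>k. u k - y z k) K \<le> 1/400" using z by (simp add: y_def r_def)
      have d': "L2_set (\<lambda>k. y z k - u k) K = L2_set (\<lambda>k. u k - y z k) K"
        by (simp add: L2_set_def power2_commute)
      have "L2_set u K = L2_set (\<lambda>k. y z k + (u k - y z k)) K" by simp
      also have "\<dots> \<le> L2_set (y z) K + L2_set (\<lambda>k. u k - y z k) K" by (rule L2_set_triangle_ineq)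
      finally have yl: "L2_set (y z) K \<ge> 399/400" using u d by simp
      then have "(L2_set (y z) K)\<^sup>2 > 0" by (simp add: zero_less_power)
      then have "z \<in> Z" using z by (simp add: Z_def D_def r_def L2_set_sq)
      then have "\<not> P z R" using nb by blast
      then have "m * (L2_set (y z) K)\<^sup>2 / 2 < (f (y z))\<^sup>2" by (simp add: P_def f_def L2_set_sq)
      moreover have "m * (399/400)\<^sup>2 / 2 \<le> m * (L2_set (y z) K)\<^sup>2 / 2"
        using yl by (intro divide_right_mono mult_left_mono power_mono) auto
      \<comment> \<open>0.69^2 is below (399/400)^2 / 2. The operator bound 2 sqrt (384 m) <= 40
        sqrt m turns the rounding error 1/400 into a loss of sqrt m / 10, and 0.69 - 0.1 still
        exceeds 1/2.\<close>
      moreover have "(69/100 * sqrt m)\<^sup>2 \<le> m * (399/400)\<^sup>2 / 2"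
        by (simp add: power_mult_distrib power2_eq_square)
      ultimately have "(69/100 * sqrt m)\<^sup>2 \<le> (f (y z))\<^sup>2" by linarith
      then have fy: "69/100 * sqrt m \<le> f (y z)"
        by (rule power2_le_imp_le) (simp add: f_def)
      have "sqrt 384 \<le> 20" by (rule real_le_lsqrt) auto
      then have s384: "sqrt (384 * m) \<le> 20 * sqrt m" by (simp add: real_sqrt_mult mult_right_mono)
      have "f (\<lambda>k. y z k - u k) \<le> 2 * sqrt (384 * m) * L2_set (\<lambda>k. y z k - u k) K"
        using spec[OF Q[unfolded Q_def], of "\<lambda>k. y z k - u k"] by (simp only: f_def)
      also have "\<dots> \<le> 2 * (20 * sqrt m) * (1/400)"
        using d d' s384 by (intro mult_mono) auto
      finally have "f (\<lambda>k. y z k - u k) \<le> sqrt m / 10" by simp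
      moreover have "f (y z) \<le> f u + f (\<lambda>k. y z k - u k)"
        using f_add[of u "\<lambda>k. y z k - u k"] by simp
      ultimately have "69/100 * sqrt m - sqrt m / 10 \<le> f u" using fy by linarith
      moreover have "sqrt (real m) \<ge> 0" by simp
      ultimately show ?thesis by linarith
    qed
    show ?thesis
    proof (cases "L2_set x K = 0")
      case False
      then have p: "L2_set x K > 0" using L2_set_nonneg[of x K] by linarith
      have "sqrt m / 2 \<le> f (\<lambda>k. (1 / L2_set x K) * x k)"
        using p by (intro unit) (simp only: L2_set_scale, simp)
      also have "\<dots> = f x / L2_set x K" unfolding f_scale using p by simp
      finally show ?thesis using p by (simp add: f_def le_divide_eq)
    qed simp
  qed
  have "avg (sign_mats I K) (\<lambda>R. of_bool (\<not> (\<forall>x. sqrt m / 2 * L2_set x K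
      \<le> L2_set (\<lambda>i. \<Sum>k\<in>K. R i k * x k) I))) \<le>
     avg (sign_mats I K) (\<lambda>R. of_bool (\<not> Q R) + of_bool (\<exists>z\<in>Z. P z R))"
    using det by (intro avg_mono) (auto simp: of_bool_def)
  also have "\<dots> = avg (sign_mats I K) (\<lambda>R. of_bool (\<not> Q R)) + avg (sign_mats I K) (\<lambda>R. of_bool (\<exists>z\<in>Z. P z R))"
    by (rule avg_add)
  also have "\<dots> \<le> 1/32 + 1/32"
  proof (rule add_mono)
    show "avg (sign_mats I K) (\<lambda>R. of_bool (\<not> Q R)) \<le> 1/32"
      unfolding Q_def m_def using m by (intro sign_mats_upper I K) (simp add: m_def r_def)
    have "avg (sign_mats I K) (\<lambda>R. of_bool (\<exists>z\<in>Z. P z R)) \<le> (\<Sum>z\<in>Z. avg (sign_mats I K) (\<lambda>R. of_bool (P z R)))"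
      by (rule avg_of_bool_union[OF finZ])
    also have "\<dots> \<le> (\<Sum>z\<in>Z. exp (- real m / 24))"
      unfolding P_def m_def
      by (intro sum_mono sign_mats_lower_tail[OF I K(1) refl]) (simp add: Z_def)
    also have "\<dots> = real (card Z) * exp (- real m / 24)" by simp
    also have "\<dots> \<le> (2 ^ (D * r) * 3 ^ r) * exp (- (real D + 7) * real r)"
    proof (intro mult_mono)
      have "real (card Z) \<le> real (card (grid K (D * r)))"
        using K by (intro of_nat_mono card_mono) (auto simp: Z_def)
      also have "\<dots> \<le> 2 ^ (D * r) * 3 ^ r" unfolding r_def by (rule card_grid_le[OF K(1)])
      finally show "real (card Z) \<le> 2 ^ (D * r) * 3 ^ r" .
      have "real (15360168 * r) \<le> real m" using m by (rule of_nat_mono)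
      then show "exp (- real m / 24) \<le> exp (- (real D + 7) * real r)" by (simp add: D_def)
    qed auto
    also have "\<dots> \<le> 1/32" by (rule grid_union_bound[OF r])
    finally show "avg (sign_mats I K) (\<lambda>R. of_bool (\<exists>z\<in>Z. P z R)) \<le> 1/32" .
  qed
  finally show ?thesis by (simp add: m_def)
qed

section \<open>Gaussian densities and affinities of sign mixtures\<close>

definition std_gauss :: "real measure" where
  "std_gauss = density lborel std_normal_density"

abbreviation gauss :: "'i set \<Rightarrow> ('i \<Rightarrow> real) measure" where
  "gauss I \<equiv> PiM I (\<lambda>_. std_gauss)"

lemma prob_space_std_gauss: "prob_space std_gauss"
  unfolding std_gauss_def by (rule prob_space_normal_density) simp

lemma sets_std_gauss [simp, measurable_cong]: "sets std_gauss = sets borel"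
  by (simp add: std_gauss_def)

lemma space_std_gauss [simp]: "space std_gauss = UNIV"
  by (simp add: std_gauss_def)

interpretation std_gauss: prob_space std_gauss by (rule prob_space_std_gauss)

interpretation std_gauss_prod: product_sigma_finite "\<lambda>_. std_gauss"
  by (rule product_sigma_finite.intro) (rule std_gauss.sigma_finite_measure)

lemma prob_space_gauss: "prob_space (gauss I)"
  by (rule prob_space_PiM) (rule prob_space_std_gauss)

text \<open>One-dimensional Cameron-Martin formula: exp (c y - c^2 / 2) times the standard density
  is the density centred at c.\<close>

lemma emeasure_std_gauss_shift:
  assumes "B \<in> sets borel"
  shows "(\<integral>\<^sup>+ y. ennreal (exp (c * y - c\<^sup>2 / 2)) * indicator B y \<partial>std_gauss) =
    emeasure std_gauss ((\<lambda>z. c + z) -` B)"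
proof -
  have [measurable]: "B \<in> sets borel" by fact
  have d: "exp (c * y - c\<^sup>2 / 2) * std_normal_density y = std_normal_density (y - c)" for y
    unfolding std_normal_density_def
    by (simp add: exp_add[symmetric] exp_diff[symmetric] power2_diff field_simps)
  have "(\<integral>\<^sup>+ y. ennreal (exp (c * y - c\<^sup>2 / 2)) * indicator B y \<partial>std_gauss) =
      (\<integral>\<^sup>+ y. ennreal (std_normal_density (y - c)) * indicator B y \<partial>lborel)"
    unfolding std_gauss_def
    by (subst nn_integral_density) (auto simp: mult.assoc[symmetric] ennreal_mult[symmetric] d mult.commute[of "std_normal_density _"])
  also have "\<dots> = (\<integral>\<^sup>+ z. ennreal (std_normal_density (c + 1 * z - c)) * indicator B (c + 1 * z) \<partial>lborel)"
    by (subst nn_integral_real_affine[where c = 1 and t = c]) (auto simp: one_ennreal_def[symmetric])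
  also have "\<dots> = (\<integral>\<^sup>+ z. ennreal (std_normal_density z) * indicator ((\<lambda>z. c + z) -` B) z \<partial>lborel)"
    by (intro nn_integral_cong) (auto split: split_indicator)
  also have "\<dots> = emeasure std_gauss ((\<lambda>z. c + z) -` B)"
    unfolding std_gauss_def by (subst emeasure_density) (auto intro!: measurable_sets_borel[of _ borel])
  finally show ?thesis .
qed

text \<open>Likelihood ratio of the Gaussian law with identity covariance centred at
  \<open>u\<close> to the one centred at 0. All data laws are handled as densities against the
  single measure \<open>gauss I\<close>.\<close>

definition tilt :: "'i set \<Rightarrow> ('i \<Rightarrow> real) \<Rightarrow> ('i \<Rightarrow> real) \<Rightarrow> real" where
  "tilt I u y = exp ((\<Sum>i\<in>I. u i * y i) - (\<Sum>i\<in>I. (u i)\<^sup>2) / 2)"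

lemma tilt_pos [simp]: "0 < tilt I u y" "0 \<le> tilt I u y"
  by (simp_all add: tilt_def)

lemma measurable_tilt [measurable]: "finite I \<Longrightarrow> tilt I u \<in> borel_measurable (gauss I)"
  unfolding tilt_def by measurable

lemma tilt_prod: "finite I \<Longrightarrow> tilt I u y = (\<Prod>i\<in>I. exp (u i * y i - (u i)\<^sup>2 / 2))"
  unfolding tilt_def by (simp add: exp_sum[symmetric] sum_subtractf sum_divide_distrib)

text \<open>The image of the noise under the shift and the tilted measure agree on boxes with the
  product of the shifted one-dimensional laws, so all three coincide. The restriction to
  \<open>I\<close> keeps the shifted point inside the space of the product measure.\<close>

lemma nn_integral_gauss_shift:
  assumes I: "finite I" and F: "F \<in> borel_measurable (PiM I (\<lambda>_. borel))"
  shows "(\<integral>\<^sup>+ z. F (\<lambda>i\<in>I. x i + z i) \<partial>gauss I) = (\<integral>\<^sup>+ y. ennreal (tilt I x y) * F y \<partial>gauss I)"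
proof -
  have sets_eq: "sets (PiM I (\<lambda>_. borel :: real measure)) = sets (gauss I)"
    by (rule sets_PiM_cong) auto
  have F'[measurable]: "F \<in> borel_measurable (gauss I)"
    using F measurable_cong_sets[OF sets_eq refl] by blast
  define \<mu> where "\<mu> = (\<lambda>i. distr std_gauss borel (\<lambda>z. x i + z))"
  interpret mu: product_sigma_finite \<mu>
  proof (rule product_sigma_finite.intro)
    fix i
    interpret p: prob_space "\<mu> i" unfolding \<mu>_def by (rule std_gauss.prob_space_distr) simp
    show "sigma_finite_measure (\<mu> i)" ..
  qed
  have [simp]: "sets (\<mu> i) = sets borel" for i by (simp add: \<mu>_def)
  have sets_mu: "sets (gauss I) = sets (PiM I \<mu>)" by (rule sets_PiM_cong) auto
  have T[measurable]: "(\<lambda>z. \<lambda>i\<in>I. x i + z i) \<in> measurable (gauss I) (gauss I)"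
    by (rule measurable_restrict) measurable
  have em: "emeasure (\<mu> i) B = emeasure std_gauss ((\<lambda>z. x i + z) -` B)" if "B \<in> sets borel" for i B
    using that by (simp add: \<mu>_def emeasure_distr)
  have 1: "distr (gauss I) (gauss I) (\<lambda>z. \<lambda>i\<in>I. x i + z i) = PiM I \<mu>"
  proof (rule mu.PiM_eqI[OF I])
    show "sets (distr (gauss I) (gauss I) (\<lambda>z. \<lambda>i\<in>I. x i + z i)) = sets (PiM I \<mu>)"
      using sets_mu by simp
    fix A assume A: "\<And>i. i \<in> I \<Longrightarrow> A i \<in> sets (\<mu> i)"
    have box: "PiE I A \<in> sets (gauss I)" using A I by (intro sets_PiM_I_finite) auto
    have "(\<lambda>z. \<lambda>i\<in>I. x i + z i) -` PiE I A \<inter> space (gauss I) = PiE I (\<lambda>i. (\<lambda>z. x i + z) -` A i)"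
      by (auto simp: space_PiM PiE_iff)
    then have "emeasure (distr (gauss I) (gauss I) (\<lambda>z. \<lambda>i\<in>I. x i + z i)) (PiE I A) =
        emeasure (gauss I) (PiE I (\<lambda>i. (\<lambda>z. x i + z) -` A i))"
      by (simp add: emeasure_distr[OF T box])
    also have "\<dots> = (\<Prod>i\<in>I. emeasure std_gauss ((\<lambda>z. x i + z) -` A i))"
      using A by (intro std_gauss_prod.emeasure_PiM I) (auto intro!: measurable_sets_borel[of _ borel])
    also have "\<dots> = (\<Prod>i\<in>I. emeasure (\<mu> i) (A i))" using A by (intro prod.cong) (auto simp: em)
    finally show "emeasure (distr (gauss I) (gauss I) (\<lambda>z. \<lambda>i\<in>I. x i + z i)) (PiE I A) = \<dots>" .
  qed
  have 2: "density (gauss I) (\<lambda>y. ennreal (tilt I x y)) = PiM I \<mu>"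
  proof (rule mu.PiM_eqI[OF I])
    show "sets (density (gauss I) (\<lambda>y. ennreal (tilt I x y))) = sets (PiM I \<mu>)"
      using sets_mu by simp
    fix A assume A: "\<And>i. i \<in> I \<Longrightarrow> A i \<in> sets (\<mu> i)"
    have box: "PiE I A \<in> sets (gauss I)" using A I by (intro sets_PiM_I_finite) auto
    have ind: "indicator (PiE I A) y = (\<Prod>i\<in>I. indicator (A i) (y i) :: ennreal)" if "y \<in> space (gauss I)" for y
      using that I by (auto simp: indicator_def space_PiM PiE_iff prod_zero_iff intro!: prod.neutral)
    have "emeasure (density (gauss I) (\<lambda>y. ennreal (tilt I x y))) (PiE I A) =
        (\<integral>\<^sup>+ y. ennreal (tilt I x y) * indicator (PiE I A) y \<partial>gauss I)"
      using I by (subst emeasure_density) (auto intro: box)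
    also have "\<dots> = (\<integral>\<^sup>+ y. (\<Prod>i\<in>I. ennreal (exp (x i * y i - (x i)\<^sup>2 / 2)) * indicator (A i) (y i)) \<partial>gauss I)"
      by (intro nn_integral_cong) (simp add: ind tilt_prod[OF I] prod.distrib prod_ennreal)
    also have "\<dots> = (\<Prod>i\<in>I. \<integral>\<^sup>+ y. ennreal (exp (x i * y - (x i)\<^sup>2 / 2)) * indicator (A i) y \<partial>std_gauss)"
      using A by (intro std_gauss_prod.product_nn_integral_prod I) auto
    also have "\<dots> = (\<Prod>i\<in>I. emeasure (\<mu> i) (A i))"
      using A by (intro prod.cong) (auto simp: em emeasure_std_gauss_shift)
    finally show "emeasure (density (gauss I) (\<lambda>y. ennreal (tilt I x y))) (PiE I A) = \<dots>" .
  qed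
  have "(\<integral>\<^sup>+ z. F (\<lambda>i\<in>I. x i + z i) \<partial>gauss I) =
      (\<integral>\<^sup>+ y. F y \<partial>distr (gauss I) (gauss I) (\<lambda>z. \<lambda>i\<in>I. x i + z i))"
    by (simp add: nn_integral_distr)
  also have "\<dots> = (\<integral>\<^sup>+ y. F y \<partial>density (gauss I) (\<lambda>y. ennreal (tilt I x y)))" by (simp only: 1 2)
  also have "\<dots> = (\<integral>\<^sup>+ y. ennreal (tilt I x y) * F y \<partial>gauss I)"
    using I by (subst nn_integral_density) auto
  finally show ?thesis .
qed

lemma tilt_integral:
  assumes I: "finite I"
  shows "integrable (gauss I) (tilt I u)" "(\<integral>y. tilt I u y \<partial>gauss I) = 1"
proof -
  have nn: "(\<integral>\<^sup>+ y. ennreal (tilt I u y) \<partial>gauss I) = 1"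
    using nn_integral_gauss_shift[OF I, of "\<lambda>_. 1" u] prob_space.emeasure_space_1[OF prob_space_gauss[of I]]
    by simp
  show i: "integrable (gauss I) (tilt I u)"
    using I nn by (intro integrableI_nonneg) auto
  show "(\<integral>y. tilt I u y \<partial>gauss I) = 1"
    using nn_integral_eq_integral[OF i] nn by simp
qed

text \<open>The algebra behind Gaussian chi-square integrals: relative to the common centre
  \<open>m\<close>, the product of two likelihood ratios is again a tilt, up to the exponential of
  the inner product of the two displacements.\<close>

lemma tilt_tilt: "tilt I (\<lambda>i. m i + p i) y * tilt I (\<lambda>i. m i + q i) y / tilt I m y =
    exp (\<Sum>i\<in>I. p i * q i) * tilt I (\<lambda>i. m i + p i + q i) y"
proof -
  have "(\<Sum>i\<in>I. (m i + p i) * y i) - (\<Sum>i\<in>I. (m i + p i)\<^sup>2) / 2 +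
      ((\<Sum>i\<in>I. (m i + q i) * y i) - (\<Sum>i\<in>I. (m i + q i)\<^sup>2) / 2) -
      ((\<Sum>i\<in>I. m i * y i) - (\<Sum>i\<in>I. (m i)\<^sup>2) / 2) =
    (\<Sum>i\<in>I. p i * q i) + ((\<Sum>i\<in>I. (m i + p i + q i) * y i) - (\<Sum>i\<in>I. (m i + p i + q i)\<^sup>2) / 2)"
    unfolding sum_divide_distrib sum.distrib[symmetric] sum_subtractf[symmetric]
    by (rule sum.cong) (simp_all add: power2_eq_square field_simps)
  then show ?thesis unfolding tilt_def exp_add[symmetric] exp_diff[symmetric] by simp
qed

text \<open>The geometric mean of two Gaussian densities is centred at the midpoint; the scalar
  factor is their Hellinger affinity.\<close>

lemma sqrt_tilt: "sqrt (tilt I u y * tilt I v y) =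
    exp (- (\<Sum>i\<in>I. (u i - v i)\<^sup>2) / 8) * tilt I (\<lambda>i. (u i + v i) / 2) y"
proof -
  have "((\<Sum>i\<in>I. u i * y i) - (\<Sum>i\<in>I. (u i)\<^sup>2) / 2 + ((\<Sum>i\<in>I. v i * y i) - (\<Sum>i\<in>I. (v i)\<^sup>2) / 2)) / 2 =
    - (\<Sum>i\<in>I. (u i - v i)\<^sup>2) / 8 + ((\<Sum>i\<in>I. (u i + v i) / 2 * y i) - (\<Sum>i\<in>I. ((u i + v i) / 2)\<^sup>2) / 2)"
    unfolding sum_divide_distrib sum_negf[symmetric] sum.distrib[symmetric] sum_subtractf[symmetric]
    by (rule sum.cong) (simp_all add: power2_eq_square field_simps)
  moreover have "sqrt (exp a) = exp (a / 2)" for a :: real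
    by (rule real_sqrt_unique) (simp_all add: exp_double[symmetric])
  ultimately show ?thesis unfolding tilt_def exp_add[symmetric] by simp
qed

text \<open>Fubini by rows: \<open>U\<close> assembles independent rows into one family indexed by
  pairs and carries the product of the row laws to the Gaussian law of the matrix, as is checked on
  boxes.\<close>

lemma gauss_rows_integral:
  fixes h :: "'a \<Rightarrow> ('b \<Rightarrow> real) \<Rightarrow> real"
  assumes A: "finite A" and J: "finite J" and h: "\<And>i. i \<in> A \<Longrightarrow> integrable (gauss J) (h i)"
  shows "(\<integral>y. (\<Prod>i\<in>A. h i (\<lambda>j\<in>J. y (i, j))) \<partial>gauss (A \<times> J)) = (\<Prod>i\<in>A. \<integral>w. h i w \<partial>gauss J)"
proof -
  interpret gJ: product_sigma_finite "\<lambda>_::'a. gauss J"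
  proof (rule product_sigma_finite.intro)
    fix i :: 'a
    interpret prob_space "gauss J" by (rule prob_space_gauss)
    show "sigma_finite_measure (gauss J)" ..
  qed
  define U where "U = (\<lambda>(w :: 'a \<Rightarrow> 'b \<Rightarrow> real). \<lambda>p\<in>A \<times> J. w (fst p) (snd p))"
  have U[measurable]: "U \<in> measurable (PiM A (\<lambda>_. gauss J)) (gauss (A \<times> J))"
    unfolding U_def
  proof (rule measurable_restrict)
    fix p assume p: "p \<in> A \<times> J"
    have "(\<lambda>w. w (fst p)) \<in> measurable (PiM A (\<lambda>_. gauss J)) (gauss J)"
      using p by (intro measurable_component_singleton) auto
    moreover have "(\<lambda>w. w (snd p)) \<in> measurable (gauss J) std_gauss"
      using p by (intro measurable_component_singleton) auto
    ultimately show "(\<lambda>w. w (fst p) (snd p)) \<in> measurable (PiM A (\<lambda>_. gauss J)) std_gauss"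
      by (rule measurable_compose)
  qed
  have eq: "distr (PiM A (\<lambda>_. gauss J)) (gauss (A \<times> J)) U = gauss (A \<times> J)"
  proof (rule std_gauss_prod.PiM_eqI)
    show "finite (A \<times> J)" using A J by simp
    fix B :: "'a \<times> 'b \<Rightarrow> real set" assume B: "\<And>p. p \<in> A \<times> J \<Longrightarrow> B p \<in> sets std_gauss"
    have box: "PiE (A \<times> J) B \<in> sets (gauss (A \<times> J))" using A J B by (intro sets_PiM_I_finite) auto
    have row: "PiE J (\<lambda>j. B (i, j)) \<in> sets (gauss J)" if "i \<in> A" for i
      using J B that by (intro sets_PiM_I_finite) auto
    have "U -` PiE (A \<times> J) B \<inter> space (PiM A (\<lambda>_. gauss J)) = PiE A (\<lambda>i. PiE J (\<lambda>j. B (i, j)))"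
      by (auto simp: U_def space_PiM PiE_iff extensional_def)
    then have "emeasure (distr (PiM A (\<lambda>_. gauss J)) (gauss (A \<times> J)) U) (PiE (A \<times> J) B) =
        emeasure (PiM A (\<lambda>_. gauss J)) (PiE A (\<lambda>i. PiE J (\<lambda>j. B (i, j))))"
      by (simp add: emeasure_distr[OF U box])
    also have "\<dots> = (\<Prod>i\<in>A. emeasure (gauss J) (PiE J (\<lambda>j. B (i, j))))"
      using row by (intro gJ.emeasure_PiM A) auto
    also have "\<dots> = (\<Prod>i\<in>A. \<Prod>j\<in>J. emeasure std_gauss (B (i, j)))"
      using B by (intro prod.cong std_gauss_prod.emeasure_PiM J) auto
    also have "\<dots> = (\<Prod>p\<in>A \<times> J. emeasure std_gauss (B p))"
      by (simp add: prod.cartesian_product)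
    finally show "emeasure (distr (PiM A (\<lambda>_. gauss J)) (gauss (A \<times> J)) U) (PiE (A \<times> J) B) = \<dots>" .
  qed simp
  have rowm: "(\<lambda>y. \<lambda>j\<in>J. y (i, j)) \<in> measurable (gauss (A \<times> J)) (gauss J)" if "i \<in> A" for i
    using that by (intro measurable_restrict measurable_component_singleton) auto
  have meas: "(\<lambda>y. \<Prod>i\<in>A. h i (\<lambda>j\<in>J. y (i, j))) \<in> borel_measurable (gauss (A \<times> J))"
    using rowm h by (intro borel_measurable_prod measurable_compose[OF rowm]) (auto dest: borel_measurable_integrable)
  have "(\<integral>y. (\<Prod>i\<in>A. h i (\<lambda>j\<in>J. y (i, j))) \<partial>gauss (A \<times> J)) =
      (\<integral>y. (\<Prod>i\<in>A. h i (\<lambda>j\<in>J. y (i, j))) \<partial>distr (PiM A (\<lambda>_. gauss J)) (gauss (A \<times> J)) U)"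
    by (simp only: eq)
  also have "\<dots> = (\<integral>w. (\<Prod>i\<in>A. h i (\<lambda>j\<in>J. U w (i, j))) \<partial>PiM A (\<lambda>_. gauss J))"
    by (rule integral_distr[OF U meas])
  also have "\<dots> = (\<integral>w. (\<Prod>i\<in>A. h i (w i)) \<partial>PiM A (\<lambda>_. gauss J))"
  proof (intro Bochner_Integration.integral_cong refl prod.cong)
    fix w i assume w: "w \<in> space (PiM A (\<lambda>_. gauss J))" and i: "i \<in> A"
    then have "w i \<in> extensional J" by (auto simp: space_PiM PiE_iff)
    then have "(\<lambda>j\<in>J. U w (i, j)) = w i" using i by (auto simp: U_def extensional_def)
    then show "h i (\<lambda>j\<in>J. U w (i, j)) = h i (w i)" by simp
  qed
  also have "\<dots> = (\<Prod>i\<in>A. \<integral>w. h i w \<partial>gauss J)"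
    by (rule gJ.product_integral_prod[OF A h])
  finally show ?thesis .
qed

text \<open>Joint concavity of the geometric mean, by Cauchy-Schwarz. It shows that the affinity of
  two mixtures is at least the average affinity of matched components.\<close>

lemma avg_sqrt_mult_le:
  assumes A: "finite A" and a: "\<And>x. x \<in> A \<Longrightarrow> 0 \<le> a x" and b: "\<And>x. x \<in> A \<Longrightarrow> 0 \<le> b x"
  shows "avg A (\<lambda>x. sqrt (a x * b x)) \<le> sqrt (avg A a * avg A b)"
proof -
  have "(\<Sum>x\<in>A. sqrt (a x * b x)) = (\<Sum>x\<in>A. \<bar>sqrt (a x)\<bar> * \<bar>sqrt (b x)\<bar>)"
    using a b by (intro sum.cong) (auto simp: real_sqrt_mult)
  also have "\<dots> \<le> L2_set (\<lambda>x. sqrt (a x)) A * L2_set (\<lambda>x. sqrt (b x)) A"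
    by (rule L2_set_mult_ineq)
  also have "\<dots> = sqrt (\<Sum>x\<in>A. a x) * sqrt (\<Sum>x\<in>A. b x)"
    using a b by (simp add: L2_set_def)
  finally have "avg A (\<lambda>x. sqrt (a x * b x)) \<le> sqrt (\<Sum>x\<in>A. a x) * sqrt (\<Sum>x\<in>A. b x) / real (card A)"
    unfolding avg_def by (rule divide_right_mono) simp
  also have "\<dots> = sqrt (avg A a * avg A b)"
    by (simp add: avg_def real_sqrt_mult real_sqrt_divide)
  finally show ?thesis .
qed

lemma integrable_sqrt_mult:
  fixes f g :: "'a \<Rightarrow> real"
  assumes f: "integrable M f" and g: "integrable M g" and "\<And>x. 0 \<le> f x" "\<And>x. 0 \<le> g x"
  shows "integrable M (\<lambda>x. sqrt (f x * g x))"
proof (rule Bochner_Integration.integrable_bound[OF Bochner_Integration.integrable_add[OF f g]])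
  show "(\<lambda>x. sqrt (f x * g x)) \<in> borel_measurable M"
    using borel_measurable_integrable[OF f] borel_measurable_integrable[OF g] by measurable
  show "AE x in M. norm (sqrt (f x * g x)) \<le> norm (f x + g x)"
  proof (rule AE_I2)
    fix x
    have "sqrt (f x * g x) \<le> (f x + g x) / 2" using assms by (intro arith_geo_mean_sqrt) auto
    then show "norm (sqrt (f x * g x)) \<le> norm (f x + g x)" using assms(3,4)[of x] by simp
  qed
qed

lemma integrable_avg:
  assumes "\<And>x. x \<in> A \<Longrightarrow> integrable M (f x)"
  shows "integrable M (\<lambda>y. avg A (\<lambda>x. f x y))"
    "(\<integral>y. avg A (\<lambda>x. f x y) \<partial>M) = avg A (\<lambda>x. \<integral>y. f x y \<partial>M)"
  unfolding avg_def using assms by (auto simp: Bochner_Integration.integral_sum)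

text \<open>The gap between arithmetic and geometric mean is (sqrt x - sqrt y)^2 / 2, that is (x -
  y)^2 divided by 2 (sqrt x + sqrt y)^2, and the squared sum is at least 4 L. An affinity is thereby
  reduced to a chi-square integral.\<close>

lemma sqrt_mult_ge:
  assumes L: "0 < L" "L \<le> x" "L \<le> (y::real)"
  shows "(x + y) / 2 - (x - y)\<^sup>2 / (8 * L) \<le> sqrt (x * y)"
proof -
  define s t where "s = sqrt x" and "t = sqrt y"
  have x: "x = s\<^sup>2" and y: "y = t\<^sup>2" using L by (simp_all add: s_def t_def)
  have s: "sqrt L \<le> s" "sqrt L \<le> t" using L by (simp_all add: s_def t_def)
  then have "(2 * sqrt L)\<^sup>2 \<le> (s + t)\<^sup>2" using L by (intro power_mono) auto
  then have "4 * L \<le> (s + t)\<^sup>2" using L by (simp add: power_mult_distrib)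
  then have "(s - t)\<^sup>2 * (4 * L) \<le> (s - t)\<^sup>2 * (s + t)\<^sup>2" by (intro mult_left_mono) auto
  also have "\<dots> = (x - y)\<^sup>2" by (simp add: x y power_mult_distrib[symmetric] algebra_simps power2_eq_square)
  finally have "(s - t)\<^sup>2 / 2 \<le> (x - y)\<^sup>2 / (8 * L)" using L by (simp add: field_simps)
  moreover have "sqrt (x * y) = s * t" by (simp add: s_def t_def real_sqrt_mult)
  moreover have "(x + y) / 2 - s * t = (s - t)\<^sup>2 / 2"
    by (simp add: x y power2_diff diff_divide_distrib add_divide_distrib)
  ultimately show ?thesis by linarith
qed

lemma sinh_le: "0 \<le> x \<Longrightarrow> x \<le> 2 \<Longrightarrow> sinh x \<le> 5 * (x::real)"
proof (cases "x = 0")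
  case False
  assume x: "0 \<le> x" "x \<le> 2"
  then have "\<exists>z>0. z < x \<and> sinh x - sinh 0 = (x - 0) * cosh z"
    using False by (intro MVT2) (auto intro!: derivative_eq_intros)
  then obtain z where z: "0 < z" "z < x" "sinh x = x * cosh z" by auto
  have "cosh z \<le> cosh 2" using z x by (simp add: cosh_real_nonneg_le_iff)
  also have "\<dots> \<le> 5"
  proof -
    have "exp (2::real) = exp 1 * exp 1" by (simp add: exp_add[symmetric])
    also have "\<dots> \<le> 3 * 3" using exp_le by (intro mult_mono) auto
    finally have "exp (2::real) \<le> 9" by simp
    moreover have "exp (- 2 :: real) \<le> 1" by simp
    ultimately have "exp 2 + exp (- 2) \<le> (10 :: real)" by linarith
    then show ?thesis by (simp add: cosh_def)
  qed
  finally have "x * cosh z \<le> x * 5" using x by (intro mult_left_mono) auto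
  then show ?thesis using z(3) by simp
qed simp

text \<open>The difference is 2 sinh ((A + B) / 2) sinh ((A - B) / 2), and both arguments lie in
  [0, 2], where sinh x <= 5 x.\<close>

lemma cosh_diff_le:
  assumes "0 \<le> B" "B \<le> A" "A \<le> (2::real)"
  shows "cosh A - cosh B \<le> 25/2 * (A\<^sup>2 - B\<^sup>2)"
proof -
  have "cosh A = cosh ((A + B) / 2 + (A - B) / 2)" "cosh B = cosh ((A + B) / 2 - (A - B) / 2)"
    by (simp_all add: field_simps)
  then have "cosh A - cosh B = 2 * (sinh ((A + B) / 2) * sinh ((A - B) / 2))"
    unfolding cosh_add cosh_diff by simp
  also have "\<dots> \<le> 2 * ((5 * ((A + B) / 2)) * (5 * ((A - B) / 2)))"
    using assms by (intro mult_left_mono mult_mono sinh_le) (auto simp: sinh_real_nonneg_iff)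
  also have "\<dots> = 25/2 * (A\<^sup>2 - B\<^sup>2)" by (simp add: field_simps power2_eq_square)
  finally show ?thesis .
qed

text \<open>Equal mixture of the Gaussian laws centred at m + p and m - p. Averaging over the sign
  of \<open>p\<close> cancels the odd orders, so the chi-square comparison of two such mixtures
  about the same \<open>m\<close> starts at fourth order in the displacements.\<close>

definition mirror_tilt :: "'j set \<Rightarrow> ('j \<Rightarrow> real) \<Rightarrow> ('j \<Rightarrow> real) \<Rightarrow> ('j \<Rightarrow> real) \<Rightarrow> real" where
  "mirror_tilt J m p w = (tilt J (\<lambda>j. m j + p j) w + tilt J (\<lambda>j. m j - p j) w) / 2"

lemma mirror_tilt_integral:
  assumes "finite J"
  shows "integrable (gauss J) (mirror_tilt J m p)" "(\<integral>w. mirror_tilt J m p w \<partial>gauss J) = 1"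
  unfolding mirror_tilt_def using assms by (simp_all add: tilt_integral)

text \<open>By \<open>tilt_tilt\<close> the four sign combinations integrate to exp (<p, q>) and exp
  (- <p, q>), twice each.\<close>

lemma mirror_tilt_mult:
  assumes J: "finite J"
  shows "integrable (gauss J) (\<lambda>w. mirror_tilt J m p w * mirror_tilt J m q w / tilt J m w)"
    "(\<integral>w. mirror_tilt J m p w * mirror_tilt J m q w / tilt J m w \<partial>gauss J) = cosh (\<Sum>j\<in>J. p j * q j)"
proof -
  define c where "c = (\<Sum>j\<in>J. p j * q j)"
  have eq: "mirror_tilt J m p w * mirror_tilt J m q w / tilt J m w =
     (exp c * tilt J (\<lambda>j. m j + p j + q j) w + exp (- c) * tilt J (\<lambda>j. m j + p j + - q j) w +
      (exp (- c) * tilt J (\<lambda>j. m j + - p j + q j) w + exp c * tilt J (\<lambda>j. m j + - p j + - q j) w)) / 4" for w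
  proof -
    have expand: "(x + x') / 2 * ((y + y') / 2) / z = (x * y / z + x * y' / z + (x' * y / z + x' * y' / z)) / 4"
      for x x' y y' z :: real
      by (simp add: algebra_simps add_divide_distrib)
    show ?thesis
      unfolding mirror_tilt_def diff_conv_add_uminus expand tilt_tilt by (simp add: c_def sum_negf)
  qed
  show "integrable (gauss J) (\<lambda>w. mirror_tilt J m p w * mirror_tilt J m q w / tilt J m w)"
    unfolding eq by (intro integrable_divide Bochner_Integration.integrable_add integrable_mult_right tilt_integral J)
  show "(\<integral>w. mirror_tilt J m p w * mirror_tilt J m q w / tilt J m w \<partial>gauss J) = cosh (\<Sum>j\<in>J. p j * q j)"
    unfolding eq using J by (simp add: tilt_integral cosh_def c_def[symmetric])
qed

text \<open>The mean of the two tilts is at least their geometric mean, which is exp (- |p|^2 / 2)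
  times the tilt at the centre.\<close>

lemma mirror_tilt_ge:
  assumes "(\<Sum>j\<in>J. (p j)\<^sup>2) \<le> 2"
  shows "exp (- 1) * tilt J m w \<le> mirror_tilt J m p w"
proof -
  define E where "E = tilt J m w"
  have E: "E > 0" by (simp add: E_def)
  have "tilt J (\<lambda>j. m j + p j) w * tilt J (\<lambda>j. m j - p j) w / E = exp (- (\<Sum>j\<in>J. (p j)\<^sup>2)) * E"
    using tilt_tilt[of J m p w "\<lambda>j. - p j"] by (simp add: E_def sum_negf power2_eq_square)
  then have "tilt J (\<lambda>j. m j + p j) w * tilt J (\<lambda>j. m j - p j) w = exp (- (\<Sum>j\<in>J. (p j)\<^sup>2)) * E\<^sup>2"
    using E by (simp add: field_simps power2_eq_square)
  also have "\<dots> \<ge> exp (- 2) * E\<^sup>2" using assms by (intro mult_right_mono) auto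
  also have "exp (- 2 :: real) = (exp (- 1))\<^sup>2" by (simp add: exp_double[symmetric])
  finally have "(exp (- 1) * E)\<^sup>2 \<le> tilt J (\<lambda>j. m j + p j) w * tilt J (\<lambda>j. m j - p j) w"
    by (simp add: power_mult_distrib)
  then have "exp (- 1) * E \<le> sqrt (tilt J (\<lambda>j. m j + p j) w * tilt J (\<lambda>j. m j - p j) w)"
    by (rule real_le_rsqrt)
  also have "\<dots> \<le> mirror_tilt J m p w"
    unfolding mirror_tilt_def by (intro arith_geo_mean_sqrt) auto
  finally show ?thesis by (simp add: E_def)
qed

text \<open>The two mixtures are compared through a chi-square distance relative to the tilt at their
  common centre \<open>m\<close>, where all integrals are explicit.\<close>

lemma mirror_tilt_affinity:
  assumes J: "finite J" and p: "(\<Sum>j\<in>J. (p j)\<^sup>2) = A" and q: "(\<Sum>j\<in>J. (q j)\<^sup>2) = A"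
    and B: "(\<Sum>j\<in>J. p j * q j) = B" "0 \<le> B" "B \<le> A" and A: "A \<le> 2"
  shows "1 - 75/8 * (A\<^sup>2 - B\<^sup>2) \<le> (\<integral>w. sqrt (mirror_tilt J m p w * mirror_tilt J m q w) \<partial>gauss J)"
proof -
  let ?h = "mirror_tilt J m p" and ?g = "mirror_tilt J m q" and ?E = "tilt J m"
  note i = mirror_tilt_integral[OF J]
  define X where "X = (\<lambda>p q w. mirror_tilt J m p w * mirror_tilt J m q w / tilt J m w)"
  define I where "I = (\<integral>w. sqrt (?h w * ?g w) \<partial>gauss J)"
  have X: "integrable (gauss J) (X p q)" "(\<integral>w. X p q w \<partial>gauss J) = cosh (\<Sum>j\<in>J. p j * q j)" for p q
    using mirror_tilt_mult[OF J] by (simp_all add: X_def)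
  have pt: "(?h w + ?g w) / 2 - 3/8 * (X p p w + X q q w - 2 * X p q w) \<le> sqrt (?h w * ?g w)" for w
  proof -
    define E where "E = ?E w"
    have E: "E > 0" by (simp add: E_def)
    have 1: "(?h w + ?g w) / 2 - (?h w - ?g w)\<^sup>2 / (8 * (exp (- 1) * E)) \<le> sqrt (?h w * ?g w)"
      using p q A unfolding E_def by (intro sqrt_mult_ge mirror_tilt_ge) auto
    have "(?h w - ?g w)\<^sup>2 / (8 * (exp (- 1) * E)) = exp 1 * ((?h w - ?g w)\<^sup>2 / (8 * E))"
      by (simp add: exp_minus field_simps)
    also have "\<dots> \<le> 3 * ((?h w - ?g w)\<^sup>2 / (8 * E))"
      using exp_le E by (intro mult_right_mono divide_nonneg_pos) auto
    also have "\<dots> = 3/8 * ((?h w - ?g w)\<^sup>2 / E)" by simp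
    also have "(?h w - ?g w)\<^sup>2 / E = X p p w + X q q w - 2 * X p q w"
      by (simp add: X_def E_def power2_eq_square algebra_simps add_divide_distrib diff_divide_distrib)
    finally show ?thesis using 1 by linarith
  qed
  have nn: "0 \<le> mirror_tilt J m p w" for m p w by (simp add: mirror_tilt_def add_nonneg_nonneg)
  \<comment> \<open>The 3/8 is exp 1 <= 3 over the 8 of \<open>sqrt_mult_ge\<close>; with
    \<open>cosh_diff_le\<close> the total constant is 3/8 * 2 * 25/2 = 75/8.\<close>
  have "1 - 3/8 * (cosh A + cosh A - 2 * cosh B) =
     (\<integral>w. (?h w + ?g w) / 2 - 3/8 * (X p p w + X q q w - 2 * X p q w) \<partial>gauss J)"
    using i X p q B by (simp add: power2_eq_square)
  also have "\<dots> \<le> I" unfolding I_def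
    using i X by (intro integral_mono pt integrable_sqrt_mult nn Bochner_Integration.integrable_diff
        Bochner_Integration.integrable_add integrable_divide integrable_mult_right) auto
  finally show ?thesis using cosh_diff_le[OF B(2,3) A] unfolding I_def[symmetric] by argo
qed

text \<open>Density of one data row whose signs in \<open>R\<close> are averaged out;
  \<open>W k\<close> stands for the k-th column of the right factor, scaled.\<close>

definition sign_mixture :: "'k set \<Rightarrow> 'j set \<Rightarrow> ('k \<Rightarrow> 'j \<Rightarrow> real) \<Rightarrow> ('j \<Rightarrow> real) \<Rightarrow> real" where
  "sign_mixture K J W w = avg (signs K) (\<lambda>\<omega>. tilt J (\<lambda>j. \<Sum>k\<in>K. \<omega> k * W k j) w)"

lemma sign_mixture_nonneg: "0 \<le> sign_mixture K J W w"
  unfolding sign_mixture_def by (intro avg_nonneg) simp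

lemma sign_mixture_integral:
  assumes "finite K" "finite J"
  shows "integrable (gauss J) (sign_mixture K J W)" "(\<integral>w. sign_mixture K J W w \<partial>gauss J) = 1"
  unfolding sign_mixture_def using assms by (simp_all add: integrable_avg tilt_integral avg_const)

text \<open>Each sign vector is paired with the one whose sign at \<open>k0\<close> is reversed.
  Given the other signs, both mixtures are mirror tilts about the same centre, because
  \<open>W\<close> and \<open>W'\<close> agree off \<open>k0\<close>; concavity of the affinity
  passes from these components to the average.\<close>

lemma sign_mixture_affinity_small:
  fixes W W' :: "'k \<Rightarrow> 'j \<Rightarrow> real"
  assumes K: "finite K" and J: "finite J" and k0: "k0 \<in> K"
    and same: "\<And>k j. k \<in> K \<Longrightarrow> k \<noteq> k0 \<Longrightarrow> W' k j = W k j"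
    and p: "(\<Sum>j\<in>J. (W k0 j)\<^sup>2) = A" and q: "(\<Sum>j\<in>J. (W' k0 j)\<^sup>2) = A"
    and B: "(\<Sum>j\<in>J. W k0 j * W' k0 j) = B" "0 \<le> B" "B \<le> A" and A: "A \<le> 2"
  shows "1 - 75/8 * (A\<^sup>2 - B\<^sup>2) \<le> (\<integral>w. sqrt (sign_mixture K J W w * sign_mixture K J W' w) \<partial>gauss J)"
proof -
  define flip where "flip = (\<lambda>\<omega> :: 'k \<Rightarrow> real. fun_upd \<omega> k0 (- \<omega> k0))"
  have flip: "flip \<omega> \<in> signs K" "flip (flip \<omega>) = \<omega>" if "\<omega> \<in> signs K" for \<omega>
    using that k0 by (auto simp: flip_def signs_def PiE_iff extensional_def)
  define m where "m = (\<lambda>(\<omega> :: 'k \<Rightarrow> real) j. \<Sum>k\<in>K - {k0}. \<omega> k * W k j)"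
  have mix: "sign_mixture K J X w = avg (signs K) (\<lambda>\<omega>. mirror_tilt J (m \<omega>) (\<lambda>j. \<omega> k0 * X k0 j) w)"
    if X: "\<And>k j. k \<in> K \<Longrightarrow> k \<noteq> k0 \<Longrightarrow> X k j = W k j" for X w
  proof -
    have 1: "(\<Sum>k\<in>K. \<omega> k * X k j) = m \<omega> j + \<omega> k0 * X k0 j" for \<omega> j
      unfolding m_def sum.remove[OF K k0] using X by (auto intro!: sum.cong simp: add.commute)
    have 2: "(\<Sum>k\<in>K. flip \<omega> k * X k j) = m \<omega> j - \<omega> k0 * X k0 j" for \<omega> j
    proof -
      have "m (flip \<omega>) j = m \<omega> j" unfolding m_def flip_def by (intro sum.cong) auto
      moreover have "flip \<omega> k0 = - \<omega> k0" by (simp add: flip_def)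
      ultimately show ?thesis by (simp add: 1)
    qed
    have "sign_mixture K J X w = avg (signs K) (\<lambda>\<omega>. tilt J (\<lambda>j. m \<omega> j + \<omega> k0 * X k0 j) w)"
      unfolding sign_mixture_def 1 ..
    moreover have "sign_mixture K J X w = avg (signs K) (\<lambda>\<omega>. tilt J (\<lambda>j. m \<omega> j - \<omega> k0 * X k0 j) w)"
      unfolding sign_mixture_def
      using avg_involution[of "signs K" flip "\<lambda>\<omega>. tilt J (\<lambda>j. \<Sum>k\<in>K. \<omega> k * X k j) w"] flip
      by (simp add: 2)
    moreover have "avg (signs K) (\<lambda>\<omega>. mirror_tilt J (m \<omega>) (\<lambda>j. \<omega> k0 * X k0 j) w) =
        (avg (signs K) (\<lambda>\<omega>. tilt J (\<lambda>j. m \<omega> j + \<omega> k0 * X k0 j) w) +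
         avg (signs K) (\<lambda>\<omega>. tilt J (\<lambda>j. m \<omega> j - \<omega> k0 * X k0 j) w)) / 2"
      unfolding avg_add[symmetric] mirror_tilt_def by (simp add: avg_def sum_divide_distrib[symmetric])
    ultimately show ?thesis by simp
  qed
  have nn: "0 \<le> mirror_tilt J m p w" for m p w by (simp add: mirror_tilt_def add_nonneg_nonneg)
  let ?h = "\<lambda>X \<omega>. mirror_tilt J (m \<omega>) (\<lambda>j. \<omega> k0 * X k0 j)"
  have int: "integrable (gauss J) (\<lambda>w. sqrt (?h W \<omega> w * ?h W' \<omega> w))" for \<omega>
    by (intro integrable_sqrt_mult mirror_tilt_integral J nn)
  have "1 - 75/8 * (A\<^sup>2 - B\<^sup>2) = avg (signs K) (\<lambda>\<omega>. 1 - 75/8 * (A\<^sup>2 - B\<^sup>2))"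
    using K by (simp add: avg_const)
  also have "\<dots> \<le> avg (signs K) (\<lambda>\<omega>. \<integral>w. sqrt (?h W \<omega> w * ?h W' \<omega> w) \<partial>gauss J)"
  proof (rule avg_mono)
    fix \<omega> assume w: "\<omega> \<in> signs K"
    have s: "\<omega> k0 * x * (\<omega> k0 * y) = x * y" for x y
      using signs_sq[OF w k0] by (metis mult.assoc mult.left_commute mult_1)
    show "1 - 75/8 * (A\<^sup>2 - B\<^sup>2) \<le> (\<integral>w. sqrt (?h W \<omega> w * ?h W' \<omega> w) \<partial>gauss J)"
      using p q B A by (intro mirror_tilt_affinity J) (simp_all add: power2_eq_square s)
  qed
  also have "\<dots> = (\<integral>w. avg (signs K) (\<lambda>\<omega>. sqrt (?h W \<omega> w * ?h W' \<omega> w)) \<partial>gauss J)"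
    by (simp add: integrable_avg int)
  also have "\<dots> \<le> (\<integral>w. sqrt (sign_mixture K J W w * sign_mixture K J W' w) \<partial>gauss J)"
  proof (rule integral_mono)
    show "integrable (gauss J) (\<lambda>w. sqrt (sign_mixture K J W w * sign_mixture K J W' w))"
      using K J by (intro integrable_sqrt_mult sign_mixture_integral sign_mixture_nonneg)
    show "avg (signs K) (\<lambda>\<omega>. sqrt (?h W \<omega> w * ?h W' \<omega> w)) \<le> sqrt (sign_mixture K J W w * sign_mixture K J W' w)" for w
      unfolding mix[of W, OF refl] mix[of W', OF same, simplified] using K by (intro avg_sqrt_mult_le nn) auto
  qed (intro integrable_avg int)
  finally show ?thesis .
qed

text \<open>Components with equal signs are matched directly. Their centres differ only in the
  \<open>k0\<close> term, at squared distance D for every sign vector. This is the bound for a large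
  signal scale.\<close>

lemma sign_mixture_affinity_large:
  fixes W W' :: "'k \<Rightarrow> 'j \<Rightarrow> real"
  assumes K: "finite K" and J: "finite J" and k0: "k0 \<in> K"
    and same: "\<And>k j. k \<in> K \<Longrightarrow> k \<noteq> k0 \<Longrightarrow> W' k j = W k j"
  shows "1 - (\<Sum>j\<in>J. (W k0 j - W' k0 j)\<^sup>2) / 8 \<le> (\<integral>w. sqrt (sign_mixture K J W w * sign_mixture K J W' w) \<partial>gauss J)"
proof -
  define D where "D = (\<Sum>j\<in>J. (W k0 j - W' k0 j)\<^sup>2)"
  let ?u = "\<lambda>X (\<omega> :: 'k \<Rightarrow> real) j. \<Sum>k\<in>K. \<omega> k * X k j"
  have d: "(\<Sum>j\<in>J. (?u W \<omega> j - ?u W' \<omega> j)\<^sup>2) = D" if w: "\<omega> \<in> signs K" for \<omega>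
    unfolding D_def
  proof (rule sum.cong[OF refl])
    fix j
    have "?u W \<omega> j - ?u W' \<omega> j = (\<Sum>k\<in>K. \<omega> k * (W k j - W' k j))"
      by (simp add: sum_subtractf right_diff_distrib)
    also have "\<dots> = \<omega> k0 * (W k0 j - W' k0 j)"
      unfolding sum.remove[OF K k0] using same by (simp add: sum.neutral)
    finally show "(?u W \<omega> j - ?u W' \<omega> j)\<^sup>2 = (W k0 j - W' k0 j)\<^sup>2"
      using signs_sq[OF w k0] by (simp add: power_mult_distrib power2_eq_square)
  qed
  have int: "integrable (gauss J) (\<lambda>w. sqrt (tilt J (?u W \<omega>) w * tilt J (?u W' \<omega>) w))" for \<omega>
    by (intro integrable_sqrt_mult tilt_integral J tilt_pos)
  have "1 - D / 8 \<le> exp (- D / 8)" using exp_ge_add_one_self[of "- D / 8"] by simp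
  also have "\<dots> = avg (signs K) (\<lambda>\<omega>. exp (- D / 8))" using K by (simp add: avg_const)
  also have "\<dots> = avg (signs K) (\<lambda>\<omega>. \<integral>w. sqrt (tilt J (?u W \<omega>) w * tilt J (?u W' \<omega>) w) \<partial>gauss J)"
  proof (rule avg_cong)
    fix \<omega> assume w: "\<omega> \<in> signs K"
    show "exp (- D / 8) = (\<integral>w. sqrt (tilt J (?u W \<omega>) w * tilt J (?u W' \<omega>) w) \<partial>gauss J)"
      unfolding sqrt_tilt d[OF w] using tilt_integral[OF J] by simp
  qed
  also have "\<dots> = (\<integral>w. avg (signs K) (\<lambda>\<omega>. sqrt (tilt J (?u W \<omega>) w * tilt J (?u W' \<omega>) w)) \<partial>gauss J)"
    by (simp add: integrable_avg int)
  also have "\<dots> \<le> (\<integral>w. sqrt (sign_mixture K J W w * sign_mixture K J W' w) \<partial>gauss J)"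
  proof (rule integral_mono)
    show "integrable (gauss J) (\<lambda>w. sqrt (sign_mixture K J W w * sign_mixture K J W' w))"
      using K J by (intro integrable_sqrt_mult sign_mixture_integral sign_mixture_nonneg)
    show "avg (signs K) (\<lambda>\<omega>. sqrt (tilt J (?u W \<omega>) w * tilt J (?u W' \<omega>) w)) \<le> sqrt (sign_mixture K J W w * sign_mixture K J W' w)" for w
      unfolding sign_mixture_def using K by (intro avg_sqrt_mult_le tilt_pos) auto
  qed (intro integrable_avg int)
  finally show ?thesis by (simp add: D_def)
qed

section \<open>The prior on signals\<close>

text \<open>An orthogonal projection of rank q - r, as a function of indices. It will be the
  projection onto the complement of the estimated subspace.\<close>

locale projection =
  fixes q r :: nat and M :: "nat \<Rightarrow> nat \<Rightarrow> real"
  assumes M_sym: "\<And>j l. M j l = M l j"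
    and M_idem: "\<And>j l. j < q \<Longrightarrow> l < q \<Longrightarrow> (\<Sum>i<q. M j i * M i l) = M j l"
    and M_trace: "(\<Sum>j<q. M j j) = real q - real r"
    and M_contr: "\<And>v. (\<Sum>j<q. (\<Sum>l<q. M j l * v l)\<^sup>2) \<le> (\<Sum>l<q. (v l)\<^sup>2)"
begin

lemma M_diag:
  assumes "k < q"
  shows "M k k = (\<Sum>j<q. (M j k)\<^sup>2)"
proof -
  have "M k j * M j k = (M j k)\<^sup>2" for j
    using M_sym[of k j] by (simp only: power2_eq_square)
  then show ?thesis using M_idem[OF assms assms] by simp
qed

lemma M_diag_le_1:
  assumes k: "k < q"
  shows "M k k \<le> 1"
proof -
  define v where "v = (\<lambda>l. if l = k then 1 else 0 :: real)"
  have Mv: "(\<Sum>l<q. h l * v l) = h k" for h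
  proof -
    have "(\<Sum>l<q. h l * v l) = (\<Sum>l<q. if l = k then h l else 0)"
      unfolding v_def by (intro sum.cong) auto
    then show ?thesis using k by simp
  qed
  have "M k k = (\<Sum>j<q. (\<Sum>l<q. M j l * v l)\<^sup>2)"
    unfolding Mv by (rule M_diag[OF k])
  also have "\<dots> \<le> (\<Sum>l<q. (v l)\<^sup>2)" by (rule M_contr)
  also have "\<dots> = 1" using Mv[of v] k by (simp add: power2_eq_square) (simp add: v_def)
  finally show ?thesis .
qed

end

text \<open>\<open>a\<close> scales the signal and \<open>e\<close> scales the random block of
  \<open>W\<close>. Since 1536 = 4 * 384, the last assumption turns \<open>e\<close> times a sign
  matrix obeying the bound of \<open>sign_mats_upper\<close> into a contraction.\<close>

locale sign_prior =
  fixes p q r s :: nat and a e :: real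
  assumes s: "1 \<le> s" "s \<le> r" and rp: "2 * r \<le> p" and rq: "2 * r \<le> q" and a: "0 < a" and e: "0 < e"
    and e_small: "1536 * e\<^sup>2 * real (q - r) \<le> 1"
begin

abbreviation "P \<equiv> {..<p}"
abbreviation "Q \<equiv> {..<q}"
abbreviation "I \<equiv> {r..<p}"
abbreviation "J \<equiv> {r..<q}"
abbreviation "K \<equiv> {..<s}"
abbreviation "n \<equiv> p - r"
abbreviation "m \<equiv> q - r"

text \<open>Only the first \<open>s\<close> of the \<open>r\<close> columns carry random signs. The remaining ones are known and
  pad the rank, so that the random part of \<open>G\<close> is a very tall matrix even when \<open>p = 2 r\<close>.\<close>

definition W :: "(nat \<Rightarrow> nat \<Rightarrow> real) \<Rightarrow> nat \<Rightarrow> nat \<Rightarrow> real" where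
  "W T j k = (if j = k then 1 else if r \<le> j \<and> k < s then e * T j k else 0)"

text \<open>The entries sqrt n of the padding match the norm of a column of \<open>n\<close> signs,
  so that the random and the known part both have singular values of order sqrt n.\<close>

definition G :: "(nat \<Rightarrow> nat \<Rightarrow> real) \<Rightarrow> nat \<Rightarrow> nat \<Rightarrow> real" where
  "G R i k = (if i < r then (if i = k \<and> s \<le> k then sqrt n else 0) else if k < s then R i k else 0)"

definition X :: "(nat \<Rightarrow> nat \<Rightarrow> real) \<Rightarrow> (nat \<Rightarrow> nat \<Rightarrow> real) \<Rightarrow> nat \<times> nat \<Rightarrow> real" where
  "X T R = (\<lambda>(i, j). a * (\<Sum>k<r. G R i k * W T j k))"

definition flip :: "nat \<Rightarrow> nat \<Rightarrow> (nat \<Rightarrow> nat \<Rightarrow> real) \<Rightarrow> nat \<Rightarrow> nat \<Rightarrow> real" where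
  "flip j k T = fun_upd T j (fun_upd (T j) k (- T j k))"

lemma flip_in: "T \<in> sign_mats J K \<Longrightarrow> j \<in> J \<Longrightarrow> k \<in> K \<Longrightarrow> flip j k T \<in> sign_mats J K"
  by (auto simp: sign_mats_def signs_def flip_def PiE_iff extensional_def)

lemma flip_flip [simp]: "flip j k (flip j k T) = T"
  by (auto simp: flip_def)

lemma flip_apply: "flip j k T j' k' = (if j' = j \<and> k' = k then - T j k else T j' k')"
  by (simp add: flip_def)

lemma sign_mats_sq: "T \<in> sign_mats A B \<Longrightarrow> j \<in> A \<Longrightarrow> k \<in> B \<Longrightarrow> (T j k)\<^sup>2 = 1"
  using signs_sq[of "T j" B k] by (simp add: sign_mats_def PiE_iff power2_eq_square)

lemma Q_split: "(\<Sum>j<q. h j) = (\<Sum>j<r. h j) + (\<Sum>j\<in>J. h (j::nat)) " for h :: "nat \<Rightarrow> real"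
  using rq by (subst sum.union_disjoint[symmetric]) (auto intro!: sum.cong)

lemma P_split: "(\<Sum>j<p. h j) = (\<Sum>j<r. h j) + (\<Sum>j\<in>I. h (j::nat)) " for h :: "nat \<Rightarrow> real"
  using rp by (subst sum.union_disjoint[symmetric]) (auto intro!: sum.cong)

lemma W_apply: "k < r \<Longrightarrow> (\<Sum>l<q. M l * W T l k) = M k + (if k < s then e * (\<Sum>l\<in>J. M l * T l k) else 0)"
proof -
  assume k: "k < r"
  have "(\<Sum>l<r. M l * W T l k) = (\<Sum>l<r. if l = k then M l else 0)"
    by (intro sum.cong) (auto simp: W_def)
  then have 1: "(\<Sum>l<r. M l * W T l k) = M k" using k by simp
  have "(\<Sum>l\<in>J. M l * W T l k) = (\<Sum>l\<in>J. if k < s then e * (M l * T l k) else 0)"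
    using k by (intro sum.cong) (auto simp: W_def)
  then have 2: "(\<Sum>l\<in>J. M l * W T l k) = (if k < s then e * (\<Sum>l\<in>J. M l * T l k) else 0)"
    by (simp add: sum_distrib_left)
  show ?thesis unfolding Q_split 1 2 ..
qed

text \<open>With \<open>M\<close> the projection onto the complement of an estimated subspace, this
  is the part of the columns of \<open>W\<close> that the estimate misses.\<close>

definition resid :: "(nat \<Rightarrow> nat \<Rightarrow> real) \<Rightarrow> (nat \<Rightarrow> nat \<Rightarrow> real) \<Rightarrow> real" where
  "resid M T = (\<Sum>j<q. \<Sum>k<r. (\<Sum>l<q. M j l * W T l k)\<^sup>2)"

lemma resid_nonneg: "0 \<le> resid M T" by (simp add: resid_def sum_nonneg)

text \<open>By idempotence the left side is the squared norm of the first \<open>r\<close> columns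
  of \<open>M\<close>. These are the columns of \<open>M W\<close>, which make up the residual,
  minus \<open>e M T\<close>, which consists of \<open>s\<close> columns of squared norm at most e^2
  m because \<open>M\<close> contracts.\<close>

lemma diag_le_resid:
  assumes "projection q r M" and T: "T \<in> sign_mats J K"
  shows "(\<Sum>k<r. M k k) \<le> 2 * resid M T + 2 * e\<^sup>2 * m * s"
proof -
  interpret projection q r M by fact
  define x where "x = (\<lambda>j k. \<Sum>l<q. M j l * W T l k)"
  define y where "y = (\<lambda>j k. if k < s then e * (\<Sum>l\<in>J. M j l * T l k) else 0)"
  have xy: "M j k = x j k - y j k" if "k < r" for j k
    unfolding x_def y_def W_apply[OF that] by simp
  have sq: "(u - v)\<^sup>2 \<le> 2 * u\<^sup>2 + 2 * v\<^sup>2" for u v :: real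
    using zero_le_power2[of "u + v"] by (simp add: power2_sum power2_diff)
  have ycol: "(\<Sum>j<q. (y j k)\<^sup>2) \<le> (if k < s then e\<^sup>2 * m else 0)" for k
  proof (cases "k < s")
    case True
    have "(\<Sum>l\<in>J. M j l * T l k) = (\<Sum>l<q. M j l * (if r \<le> l then T l k else 0))" for j
      unfolding Q_split by simp
    then have "(\<Sum>j<q. (y j k)\<^sup>2) = e\<^sup>2 * (\<Sum>j<q. (\<Sum>l<q. M j l * (if r \<le> l then T l k else 0))\<^sup>2)"
      using True by (simp add: y_def power_mult_distrib sum_distrib_left[symmetric])
    also have "\<dots> \<le> e\<^sup>2 * (\<Sum>l<q. (if r \<le> l then T l k else 0)\<^sup>2)"
      by (intro mult_left_mono M_contr) simp
    also have "(\<Sum>l<q. (if r \<le> l then T l k else 0)\<^sup>2) = (\<Sum>l\<in>J. (T l k)\<^sup>2)"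
      unfolding Q_split by simp
    also have "\<dots> = (\<Sum>l\<in>J. 1)" using sign_mats_sq[OF T] True by (intro sum.cong) auto
    finally show ?thesis using True by simp
  qed (simp add: y_def)
  have "(\<Sum>k<r. M k k) = (\<Sum>k<r. \<Sum>j<q. (x j k - y j k)\<^sup>2)"
    using rq by (intro sum.cong refl) (simp add: M_diag xy[symmetric])
  also have "\<dots> \<le> (\<Sum>k<r. \<Sum>j<q. 2 * (x j k)\<^sup>2 + 2 * (y j k)\<^sup>2)"
    by (intro sum_mono sq)
  also have "\<dots> = 2 * (\<Sum>k<r. \<Sum>j<q. (x j k)\<^sup>2) + 2 * (\<Sum>k<r. \<Sum>j<q. (y j k)\<^sup>2)"
    by (simp add: sum.distrib sum_distrib_left)
  also have "(\<Sum>k<r. \<Sum>j<q. (x j k)\<^sup>2) = resid M T"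
    unfolding resid_def x_def by (rule sum.swap)
  also have "(\<Sum>k<r. \<Sum>j<q. (y j k)\<^sup>2) \<le> (\<Sum>k<r. if k < s then e\<^sup>2 * m else 0)"
    by (intro sum_mono ycol)
  also have "(\<Sum>k<r. if k < s then e\<^sup>2 * m else 0) = (\<Sum>k<s. e\<^sup>2 * m)"
  proof -
    have "{..<r} \<inter> {k. k < s} = {..<s}" using s by auto
    then show ?thesis by (simp add: sum.If_cases)
  qed
  finally show ?thesis by (simp add: mult_ac)
qed

text \<open>Flipping the sign \<open>(j, k)\<close> moves entry \<open>(j, k)\<close> of \<open>M W\<close> by \<open>2 e M\<^sub>j\<^sub>j\<close>, so the two
  signs cost on average at least \<open>e\<^sup>2 M\<^sub>j\<^sub>j\<^sup>2\<close>. Few \<open>M\<^sub>j\<^sub>j\<close> are far from \<open>1\<close> unless the residual is already large.\<close>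

lemma resid_lower:
  assumes pr: "projection q r M" and f0: "\<And>T. 0 \<le> f T"
  defines "\<mu> \<equiv> \<lambda>j k T. min (f T) (f (flip j k T))"
  shows "e\<^sup>2 * (\<Sum>j\<in>J. \<Sum>k\<in>K. avg (sign_mats J K) (\<mu> j k)) - 4 * e ^ 4 * real s ^ 2 * m * avg (sign_mats J K) f
    \<le> 2 * avg (sign_mats J K) (\<lambda>T. f T * resid M T)"
proof -
  interpret projection q r M by fact
  let ?A = "avg (sign_mats J K)"
  define x where "x = (\<lambda>T j k. \<Sum>l<q. M j l * W T l k)"
  have \<mu>0: "0 \<le> \<mu> j k T" "\<mu> j k T \<le> f T" for j k T using f0 by (simp_all add: \<mu>_def)
  \<comment> \<open>The minimum is symmetric under the flip and hence a common weight for
    \<open>T\<close> and its partner.\<close>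
  have \<mu>_flip: "\<mu> j k (flip j k T) = \<mu> j k T" for j k T by (simp add: \<mu>_def min.commute)
  have pair: "e\<^sup>2 * (M j j)\<^sup>2 * ?A (\<mu> j k) \<le> ?A (\<lambda>T. \<mu> j k T * (x T j k)\<^sup>2)" if j: "j \<in> J" and k: "k \<in> K" for j k
  proof -
    have kr: "k < r" "k < s" using k s by auto
    have diff: "x T j k - x (flip j k T) j k = 2 * e * T j k * M j j" for T
    proof -
      have "(\<Sum>l\<in>J. M j l * T l k) - (\<Sum>l\<in>J. M j l * flip j k T l k) = (\<Sum>l\<in>J. if l = j then 2 * M j j * T j k else 0)"
        unfolding sum_subtractf[symmetric] by (intro sum.cong) (auto simp: flip_apply)
      also have "\<dots> = 2 * M j j * T j k" using j by simp
      finally show ?thesis unfolding x_def W_apply[OF kr(1)] using kr by (simp add: right_diff_distrib[symmetric])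
    qed
    have "?A (\<lambda>T. \<mu> j k T * (x T j k)\<^sup>2) = ?A (\<lambda>T. \<mu> j k (flip j k T) * (x (flip j k T) j k)\<^sup>2)"
      using avg_involution[of "sign_mats J K" "flip j k" "\<lambda>T. \<mu> j k T * (x T j k)\<^sup>2"] flip_in j k by simp
    then have "?A (\<lambda>T. \<mu> j k T * (x T j k)\<^sup>2) = ?A (\<lambda>T. 1/2 * (\<mu> j k T * (x T j k)\<^sup>2 + \<mu> j k T * (x (flip j k T) j k)\<^sup>2))"
      unfolding avg_cmult avg_add \<mu>_flip by simp
    also have "\<dots> \<ge> ?A (\<lambda>T. e\<^sup>2 * (M j j)\<^sup>2 * \<mu> j k T)"
    proof (rule avg_mono)
      fix T assume T: "T \<in> sign_mats J K"
      define u v where "u = x T j k" and "v = x (flip j k T) j k"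
      have "(u - v)\<^sup>2 = 4 * (e\<^sup>2 * (M j j)\<^sup>2)"
        unfolding u_def v_def diff using sign_mats_sq[OF T j k] by (simp add: power_mult_distrib)
      moreover have "(u - v)\<^sup>2 \<le> 2 * (u\<^sup>2 + v\<^sup>2)"
        using zero_le_power2[of "u + v"] by (simp add: power2_sum power2_diff)
      ultimately have "e\<^sup>2 * (M j j)\<^sup>2 \<le> 1/2 * (u\<^sup>2 + v\<^sup>2)" by linarith
      then have "\<mu> j k T * (e\<^sup>2 * (M j j)\<^sup>2) \<le> \<mu> j k T * (1/2 * (u\<^sup>2 + v\<^sup>2))"
        by (rule mult_left_mono[OF _ \<mu>0(1)])
      then show "e\<^sup>2 * (M j j)\<^sup>2 * \<mu> j k T \<le> 1/2 * (\<mu> j k T * (x T j k)\<^sup>2 + \<mu> j k T * (x (flip j k T) j k)\<^sup>2)"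
        by (simp add: u_def v_def algebra_simps)
    qed
    finally show ?thesis by (simp add: avg_cmult)
  qed
  define d where "d = (\<lambda>j. 1 - M j j)"
  have d0: "0 \<le> d j" if "j \<in> J" for j using M_diag_le_1 that by (simp add: d_def)
  \<comment> \<open>The trace of \<open>M\<close> is q - r, the size of \<open>J\<close>. So the
    deficit of the diagonal on \<open>J\<close> equals its mass on the first \<open>r\<close>
    positions, which \<open>diag_le_resid\<close> bounds.\<close>
  have dsum: "(\<Sum>j\<in>J. d j) = (\<Sum>k<r. M k k)"
    using M_trace rq unfolding Q_split d_def by (simp add: sum_subtractf of_nat_diff)
  have "e\<^sup>2 * (\<Sum>j\<in>J. \<Sum>k\<in>K. ?A (\<mu> j k)) - 2 * e\<^sup>2 * (\<Sum>j\<in>J. \<Sum>k\<in>K. d j * ?A (\<mu> j k)) =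
      (\<Sum>j\<in>J. \<Sum>k\<in>K. e\<^sup>2 * (1 - 2 * d j) * ?A (\<mu> j k))"
    by (simp add: sum_distrib_left sum_subtractf algebra_simps)
  also have "\<dots> \<le> (\<Sum>j\<in>J. \<Sum>k\<in>K. e\<^sup>2 * (M j j)\<^sup>2 * ?A (\<mu> j k))"
  proof (intro sum_mono mult_right_mono mult_left_mono)
    fix j
    show "1 - 2 * d j \<le> (M j j)\<^sup>2"
      using zero_le_power2[of "M j j - 1"] by (simp add: d_def power2_diff)
  qed (auto intro: avg_nonneg \<mu>0)
  also have "\<dots> \<le> (\<Sum>j\<in>J. \<Sum>k\<in>K. ?A (\<lambda>T. \<mu> j k T * (x T j k)\<^sup>2))"
    by (intro sum_mono pair)
  also have "\<dots> = ?A (\<lambda>T. \<Sum>j\<in>J. \<Sum>k\<in>K. \<mu> j k T * (x T j k)\<^sup>2)"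
    by (simp add: avg_sum)
  also have "\<dots> \<le> ?A (\<lambda>T. f T * resid M T)"
  proof (rule avg_mono)
    fix T
    have "(\<Sum>j\<in>J. \<Sum>k\<in>K. \<mu> j k T * (x T j k)\<^sup>2) \<le> (\<Sum>j\<in>J. \<Sum>k\<in>K. f T * (x T j k)\<^sup>2)"
      by (intro sum_mono mult_right_mono \<mu>0) simp
    also have "\<dots> = f T * (\<Sum>j\<in>J. \<Sum>k\<in>K. (x T j k)\<^sup>2)" by (simp add: sum_distrib_left)
    also have "\<dots> \<le> f T * resid M T"
    proof (intro mult_left_mono f0)
      have "(\<Sum>j\<in>J. \<Sum>k\<in>K. (x T j k)\<^sup>2) \<le> (\<Sum>j\<in>J. \<Sum>k<r. (x T j k)\<^sup>2)"
        using s by (intro sum_mono sum_mono2) auto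
      also have "\<dots> \<le> (\<Sum>j<q. \<Sum>k<r. (x T j k)\<^sup>2)" by (intro sum_mono2) (auto intro: sum_nonneg)
      finally show "(\<Sum>j\<in>J. \<Sum>k\<in>K. (x T j k)\<^sup>2) \<le> resid M T" by (simp add: resid_def x_def)
    qed
    finally show "(\<Sum>j\<in>J. \<Sum>k\<in>K. \<mu> j k T * (x T j k)\<^sup>2) \<le> f T * resid M T" .
  qed
  finally have main: "e\<^sup>2 * (\<Sum>j\<in>J. \<Sum>k\<in>K. ?A (\<mu> j k)) \<le>
      ?A (\<lambda>T. f T * resid M T) + 2 * e\<^sup>2 * (\<Sum>j\<in>J. \<Sum>k\<in>K. d j * ?A (\<mu> j k))" by linarith
  have "(\<Sum>j\<in>J. \<Sum>k\<in>K. d j * ?A (\<mu> j k)) = ?A (\<lambda>T. \<Sum>j\<in>J. \<Sum>k\<in>K. d j * \<mu> j k T)"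
    by (simp add: avg_sum avg_cmult)
  also have "\<dots> \<le> ?A (\<lambda>T. real s * (2 * (f T * resid M T) + 2 * e\<^sup>2 * m * s * f T))"
  proof (rule avg_mono)
    fix T assume T: "T \<in> sign_mats J K"
    have "(\<Sum>j\<in>J. \<Sum>k\<in>K. d j * \<mu> j k T) \<le> (\<Sum>j\<in>J. \<Sum>k\<in>K. d j * f T)"
      by (intro sum_mono mult_left_mono \<mu>0 d0)
    also have "\<dots> = real s * (f T * (\<Sum>j\<in>J. d j))" by (simp add: sum_distrib_left sum_distrib_right mult_ac)
    also have "\<dots> \<le> real s * (f T * (2 * resid M T + 2 * e\<^sup>2 * m * s))"
      unfolding dsum by (intro mult_left_mono f0 diag_le_resid[OF pr T]) simp
    finally show "(\<Sum>j\<in>J. \<Sum>k\<in>K. d j * \<mu> j k T) \<le> real s * (2 * (f T * resid M T) + 2 * e\<^sup>2 * m * s * f T)"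
      by (simp add: algebra_simps)
  qed
  also have "\<dots> = 2 * real s * ?A (\<lambda>T. f T * resid M T) + 2 * e\<^sup>2 * m * real s ^ 2 * ?A f"
    unfolding avg_cmult avg_add by (simp add: algebra_simps power2_eq_square)
  finally have "2 * e\<^sup>2 * (\<Sum>j\<in>J. \<Sum>k\<in>K. d j * ?A (\<mu> j k)) \<le>
      2 * e\<^sup>2 * (2 * real s * ?A (\<lambda>T. f T * resid M T) + 2 * e\<^sup>2 * m * real s ^ 2 * ?A f)"
    by (rule mult_left_mono) simp
  also have "\<dots> = (4 * e\<^sup>2 * real s) * ?A (\<lambda>T. f T * resid M T) + 4 * e ^ 4 * real s ^ 2 * m * ?A f"
    by (simp add: algebra_simps power2_eq_square power4_eq_xxxx)
  \<comment> \<open>Smallness of \<open>e\<close> reduces this term to one further copy of the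
    weighted residual, whence the factor 2 in the conclusion.\<close>
  also have "(4 * e\<^sup>2 * real s) * ?A (\<lambda>T. f T * resid M T) \<le> 1 * ?A (\<lambda>T. f T * resid M T)"
  proof (intro mult_right_mono avg_nonneg mult_nonneg_nonneg f0 resid_nonneg)
    have "e\<^sup>2 * real s \<le> e\<^sup>2 * real m" using s rq by (intro mult_left_mono) auto
    then show "4 * e\<^sup>2 * real s \<le> 1" using e_small by linarith
  qed
  finally show ?thesis using main by linarith
qed

end

section \<open>Overlap of the data laws of neighbouring sign matrices\<close>

lemma avg_ge_imp_ex:
  assumes "finite A" "A \<noteq> {}" "c \<le> avg A f"
  shows "\<exists>x\<in>A. c \<le> f x"
proof (rule ccontr)
  assume "\<not> (\<exists>x\<in>A. c \<le> f x)"
  then have "(\<Sum>x\<in>A. f x) < (\<Sum>x\<in>A. c)" using assms by (intro sum_strict_mono) (auto simp: not_le)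
  then have "avg A f < c" using assms by (simp add: avg_def divide_less_eq card_gt_0_iff mult.commute)
  then show False using assms by simp
qed

lemma sqrt_prod: "finite A \<Longrightarrow> sqrt (\<Prod>i\<in>A. f i) = (\<Prod>i\<in>A. sqrt (f i))"
  by (induction A rule: finite_induct) (simp_all add: real_sqrt_mult)

text \<open>From affinity to overlap: for probability densities the last term integrates to 1/4, so
  an affinity of 3/4 leaves an overlap of 1/4. The bound is the arithmetic-geometric mean inequality
  for 4 u and v / 4.\<close>

lemma sqrt_mult_le_min:
  assumes "0 \<le> x" "0 \<le> (y::real)"
  shows "sqrt (x * y) \<le> 2 * min x y + (x + y) / 8"
proof -
  have *: "sqrt (u * v) \<le> 2 * u + v / 8" if "0 \<le> u" "0 \<le> v" for u v :: real
  proof -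
    have "sqrt (u * v) = sqrt ((4 * u) * (v / 4))" by simp
    also have "\<dots> \<le> (4 * u + v / 4) / 2" using that by (intro arith_geo_mean_sqrt) auto
    finally show ?thesis by simp
  qed
  show ?thesis using *[of x y] *[of y x] assms by (auto simp: min_def mult.commute add_divide_distrib)
qed

lemma tilt_rows:
  assumes "finite A" "finite B"
  shows "tilt (A \<times> B) x y = (\<Prod>i\<in>A. tilt B (\<lambda>j. x (i, j)) (\<lambda>j\<in>B. y (i, j)))"
  using assms by (simp add: tilt_prod prod.cartesian_product split_def)

context sign_prior
begin

definition goodR :: "(nat \<Rightarrow> nat \<Rightarrow> real) \<Rightarrow> bool" where
  "goodR R \<longleftrightarrow> (\<forall>x. sqrt n / 2 * L2_set x K \<le> L2_set (\<lambda>i. \<Sum>k\<in>K. R i k * x k) I)"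

definition goodT :: "(nat \<Rightarrow> nat \<Rightarrow> real) \<Rightarrow> bool" where
  "goodT T \<longleftrightarrow> (\<forall>x. L2_set (\<lambda>j. \<Sum>k\<in>K. T j k * x k) J \<le> 2 * sqrt (384 * m) * L2_set x K)"

definition dens0 :: "(nat \<Rightarrow> nat \<Rightarrow> real) \<Rightarrow> (nat \<times> nat \<Rightarrow> real) \<Rightarrow> real" where
  "dens0 T y = avg (sign_mats I K) (\<lambda>R. tilt (P \<times> Q) (X T R) y)"

text \<open>A sub-density of \<open>dens0\<close>, whose mass falls short of 1 by the proportion of
  discarded matrices. A bad \<open>T\<close> gets density 0, so only well conditioned pairs
  contribute to the averaged risk.\<close>

definition dens :: "(nat \<Rightarrow> nat \<Rightarrow> real) \<Rightarrow> (nat \<times> nat \<Rightarrow> real) \<Rightarrow> real" where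
  "dens T y = of_bool (goodT T) * avg (sign_mats I K) (\<lambda>R. of_bool (goodR R) * tilt (P \<times> Q) (X T R) y)"

lemma X_passive: "i < r \<Longrightarrow> X T R (i, j) = (if s \<le> i \<and> j = i then a * sqrt n else 0)"
proof -
  assume i: "i < r"
  have "(\<Sum>k<r. G R i k * W T j k) = (\<Sum>k<r. if k = i then (if s \<le> i \<and> j = i then sqrt n else 0) else 0)"
    using i by (intro sum.cong) (auto simp: G_def W_def)
  then show ?thesis using i by (simp add: X_def)
qed

lemma X_active: "i \<in> I \<Longrightarrow> X T R (i, j) = (\<Sum>k<s. R i k * (a * W T j k))"
proof -
  assume i: "i \<in> I"
  have "(\<Sum>k<r. G R i k * W T j k) = (\<Sum>k<s. R i k * W T j k)"
    using i s by (intro sum.mono_neutral_cong_right) (auto simp: G_def)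
  then show ?thesis unfolding X_def by (simp add: sum_distrib_left[symmetric] mult.left_commute[of _ a])
qed

definition rowdens :: "(nat \<Rightarrow> nat \<Rightarrow> real) \<Rightarrow> nat \<Rightarrow> (nat \<Rightarrow> real) \<Rightarrow> real" where
  "rowdens T i = (if i < r then tilt Q (\<lambda>j. if s \<le> i \<and> j = i then a * sqrt n else 0)
     else sign_mixture K Q (\<lambda>k j. a * W T j k))"

lemma rowdens_nonneg: "0 \<le> rowdens T i w"
  by (simp add: rowdens_def sign_mixture_nonneg)

lemma rowdens_integral: "integrable (gauss Q) (rowdens T i)" "(\<integral>w. rowdens T i w \<partial>gauss Q) = 1"
  by (simp_all add: rowdens_def tilt_integral sign_mixture_integral)

lemma P_split_prod: "(\<Prod>j<p. h j) = (\<Prod>j<r. h j) * (\<Prod>j\<in>I. h (j::nat)) " for h :: "nat \<Rightarrow> real"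
  using rp by (subst prod.union_disjoint[symmetric]) (auto intro!: prod.cong)

text \<open>The rows of a uniform sign matrix are independent, so averaging over \<open>R\<close>
  yields a product over data rows. The first \<open>r\<close> factors do not depend on
  \<open>T\<close>.\<close>

lemma dens0_rows: "dens0 T y = (\<Prod>i<p. rowdens T i (\<lambda>j\<in>Q. y (i, j)))"
proof -
  let ?c = "\<Prod>i<r. tilt Q (\<lambda>j. if s \<le> i \<and> j = i then a * sqrt n else 0) (\<lambda>j\<in>Q. y (i, j))"
  have "tilt (P \<times> Q) (X T R) y = ?c * (\<Prod>i\<in>I. tilt Q (\<lambda>j. \<Sum>k<s. R i k * (a * W T j k)) (\<lambda>j\<in>Q. y (i, j)))" for R
    unfolding tilt_rows[OF finite_lessThan finite_lessThan] P_split_prod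
    by (intro arg_cong2[of _ _ _ _ "(*)"] prod.cong refl) (simp_all only: X_passive X_active lessThan_iff)
  then have "dens0 T y = ?c * avg (PiE I (\<lambda>_. signs K)) (\<lambda>R. \<Prod>i\<in>I. tilt Q (\<lambda>j. \<Sum>k<s. R i k * (a * W T j k)) (\<lambda>j\<in>Q. y (i, j)))"
    unfolding dens0_def by (simp add: avg_cmult sign_mats_def)
  also have "avg (PiE I (\<lambda>_. signs K)) (\<lambda>R. \<Prod>i\<in>I. tilt Q (\<lambda>j. \<Sum>k<s. R i k * (a * W T j k)) (\<lambda>j\<in>Q. y (i, j))) =
      (\<Prod>i\<in>I. sign_mixture K Q (\<lambda>k j. a * W T j k) (\<lambda>j\<in>Q. y (i, j)))"
    using avg_PiE_prod[of I "\<lambda>_. signs K" "\<lambda>i \<omega>. tilt Q (\<lambda>j. \<Sum>k<s. \<omega> k * (a * W T j k)) (\<lambda>j\<in>Q. y (i, j))"]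
    by (simp add: sign_mixture_def)
  also have "?c * \<dots> = (\<Prod>i<p. rowdens T i (\<lambda>j\<in>Q. y (i, j)))"
    unfolding P_split_prod by (intro arg_cong2[of _ _ _ _ "(*)"] prod.cong refl) (simp_all add: rowdens_def)
  finally show ?thesis .
qed

lemma dens0_nonneg: "0 \<le> dens0 T y" and dens_nonneg: "0 \<le> dens T y"
  unfolding dens0_def dens_def by (auto intro!: avg_nonneg mult_nonneg_nonneg)

lemma dens_le: "dens T y \<le> dens0 T y"
proof -
  have "dens T y \<le> 1 * avg (sign_mats I K) (\<lambda>R. of_bool (goodR R) * tilt (P \<times> Q) (X T R) y)"
    unfolding dens_def by (intro mult_right_mono avg_nonneg) auto
  also have "\<dots> \<le> 1 * dens0 T y" unfolding dens0_def by (intro mult_left_mono avg_mono) auto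
  finally show ?thesis by simp
qed

lemma dens0_integral: "integrable (gauss (P \<times> Q)) (dens0 T)" "(\<integral>y. dens0 T y \<partial>gauss (P \<times> Q)) = 1"
  unfolding dens0_def by (simp_all add: integrable_avg tilt_integral avg_const)

lemma dens_integral: "integrable (gauss (P \<times> Q)) (dens T)"
  "(\<integral>y. dens T y \<partial>gauss (P \<times> Q)) = of_bool (goodT T) * avg (sign_mats I K) (\<lambda>R. of_bool (goodR R))"
  unfolding dens_def by (simp_all add: integrable_avg tilt_integral)

lemma W_flip_other: "k' \<noteq> k \<Longrightarrow> W (flip j k T) l k' = W T l k'"
  by (simp add: W_def flip_apply)

text \<open>Norms, inner product and distance of the scaled column \<open>k\<close> before and after
  its sign at \<open>j\<close> is flipped: the input of both affinity bounds.\<close>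

lemma W_col_sum:
  assumes T: "T \<in> sign_mats J K" and j: "j \<in> J" and k: "k \<in> K"
  shows "(\<Sum>l<q. (a * W T l k)\<^sup>2) = a\<^sup>2 * (1 + e\<^sup>2 * m)"
    and "(\<Sum>l<q. (a * W (flip j k T) l k)\<^sup>2) = a\<^sup>2 * (1 + e\<^sup>2 * m)"
    and "(\<Sum>l<q. a * W T l k * (a * W (flip j k T) l k)) = a\<^sup>2 * (1 + e\<^sup>2 * m - 2 * e\<^sup>2)"
    and "(\<Sum>l<q. (a * W T l k - a * W (flip j k T) l k)\<^sup>2) = 4 * a\<^sup>2 * e\<^sup>2"
proof -
  have kr: "k < s" "k < r" using k s by auto
  \<comment> \<open>One identity serves all four sums. The condition on F reflects that the top
    block vanishes off the diagonal.\<close>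
  have top: "(\<Sum>l<r. F (W T l k) (W (flip j k T) l k)) = F 1 1" if "F 0 0 = 0" for F :: "real \<Rightarrow> real \<Rightarrow> real"
  proof -
    have "(\<Sum>l<r. F (W T l k) (W (flip j k T) l k)) = (\<Sum>l<r. if l = k then F 1 1 else 0)"
      using that by (intro sum.cong) (auto simp: W_def)
    then show ?thesis using kr by simp
  qed
  have bot: "(\<Sum>l\<in>J. F (W T l k) (W (flip j k T) l k)) = (\<Sum>l\<in>J. F (e * T l k) (e * (if l = j then - T l k else T l k)))"
    for F :: "real \<Rightarrow> real \<Rightarrow> real"
    using kr by (intro sum.cong) (auto simp: W_def flip_apply)
  have sq: "(T l k)\<^sup>2 = 1" if "l \<in> J" for l using sign_mats_sq[OF T that k] .
  have c: "(\<Sum>l\<in>J. c) = c * real m" for c :: real by simp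
  have "(\<Sum>l\<in>J. (a * (e * T l k))\<^sup>2) = (\<Sum>l\<in>J. a\<^sup>2 * e\<^sup>2)"
    by (intro sum.cong) (auto simp: power_mult_distrib sq)
  then show "(\<Sum>l<q. (a * W T l k)\<^sup>2) = a\<^sup>2 * (1 + e\<^sup>2 * m)"
    unfolding Q_split using top[of "\<lambda>u v. (a * u)\<^sup>2"] bot[of "\<lambda>u v. (a * u)\<^sup>2"] c
    by (simp add: algebra_simps)
  have "(\<Sum>l\<in>J. (a * (e * (if l = j then - T l k else T l k)))\<^sup>2) = (\<Sum>l\<in>J. a\<^sup>2 * e\<^sup>2)"
    by (intro sum.cong) (auto simp: power_mult_distrib sq)
  then show "(\<Sum>l<q. (a * W (flip j k T) l k)\<^sup>2) = a\<^sup>2 * (1 + e\<^sup>2 * m)"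
    unfolding Q_split using top[of "\<lambda>u v. (a * v)\<^sup>2"] bot[of "\<lambda>u v. (a * v)\<^sup>2"] c
    by (simp add: algebra_simps)
  have "(\<Sum>l\<in>J. a * (e * T l k) * (a * (e * (if l = j then - T l k else T l k)))) =
      (\<Sum>l\<in>J. a\<^sup>2 * e\<^sup>2 - (if l = j then 2 * a\<^sup>2 * e\<^sup>2 else 0))"
  proof (rule sum.cong[OF refl])
    fix l assume "l \<in> J"
    then have f: "a * (e * T l k) * (a * (e * T l k)) = a\<^sup>2 * e\<^sup>2"
      using sq[of l] by (simp add: power2_eq_square)
    have "a * (e * T l k) * (a * (e * (if l = j then - T l k else T l k))) =
        (if l = j then - 1 else 1) * (a * (e * T l k) * (a * (e * T l k)))" by simp
    then show "a * (e * T l k) * (a * (e * (if l = j then - T l k else T l k))) =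
        a\<^sup>2 * e\<^sup>2 - (if l = j then 2 * a\<^sup>2 * e\<^sup>2 else 0)" unfolding f by simp
  qed
  also have "\<dots> = a\<^sup>2 * e\<^sup>2 * m - 2 * a\<^sup>2 * e\<^sup>2" using j by (simp add: sum_subtractf)
  finally show "(\<Sum>l<q. a * W T l k * (a * W (flip j k T) l k)) = a\<^sup>2 * (1 + e\<^sup>2 * m - 2 * e\<^sup>2)"
    unfolding Q_split using top[of "\<lambda>u v. a * u * (a * v)"] bot[of "\<lambda>u v. a * u * (a * v)"]
    by (simp add: algebra_simps power2_eq_square)
  have "(\<Sum>l\<in>J. (a * (e * T l k) - a * (e * (if l = j then - T l k else T l k)))\<^sup>2) =
      (\<Sum>l\<in>J. if l = j then 4 * a\<^sup>2 * e\<^sup>2 else 0)"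
    by (intro sum.cong) (auto simp: power_mult_distrib sq)
  also have "\<dots> = 4 * a\<^sup>2 * e\<^sup>2" using j by simp
  finally show "(\<Sum>l<q. (a * W T l k - a * W (flip j k T) l k)\<^sup>2) = 4 * a\<^sup>2 * e\<^sup>2"
    unfolding Q_split using top[of "\<lambda>u v. (a * u - a * v)\<^sup>2"] bot[of "\<lambda>u v. (a * u - a * v)\<^sup>2"]
    by simp
qed

text \<open>For a <= 1 the mirrored bound applies with A - B = 2 a^2 e^2 and A + B <= 4 a^2, so 75/8
  * 8 = 75. For a > 1 the direct bound costs only a^2 e^2 / 2.\<close>

lemma row_affinity:
  assumes T: "T \<in> sign_mats J K" and j: "j \<in> J" and k: "k \<in> K"
  shows "1 - 75 * (e\<^sup>2 * min (a\<^sup>2) (a ^ 4)) \<le>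
    (\<integral>w. sqrt (sign_mixture K Q (\<lambda>k j. a * W T j k) w * sign_mixture K Q (\<lambda>k' l. a * W (flip j k T) l k') w) \<partial>gauss Q)"
    (is "_ \<le> ?I")
proof (cases "a \<le> 1")
  case True
  define A B where "A = a\<^sup>2 * (1 + e\<^sup>2 * m)" and "B = a\<^sup>2 * (1 + e\<^sup>2 * m - 2 * e\<^sup>2)"
  have m1: "1 \<le> real m" using j by auto
  have em: "e\<^sup>2 * m \<le> 1" using e_small by simp
  have "e\<^sup>2 * 1 \<le> e\<^sup>2 * m" using m1 by (intro mult_left_mono) auto
  then have e1: "e\<^sup>2 \<le> e\<^sup>2 * m" by (simp only: mult_1_right)
  have a1: "a\<^sup>2 \<le> 1" using True a by (simp add: power_le_one)
  have A2: "A \<le> 2 * a\<^sup>2" unfolding A_def using em mult_left_mono[of "1 + e\<^sup>2 * m" 2 "a\<^sup>2"] by simp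
  have BA: "B \<le> A" unfolding A_def B_def by (intro mult_left_mono) auto
  have B0: "0 \<le> B" unfolding B_def using e1 em by (intro mult_nonneg_nonneg) auto
  have "1 - 75/8 * (A\<^sup>2 - B\<^sup>2) \<le> ?I"
    using W_col_sum[OF T j k] B0 BA A2 a1 k
    by (intro sign_mixture_affinity_small[where ?k0.0 = k]) (auto simp: W_flip_other A_def B_def)
  moreover have "A\<^sup>2 - B\<^sup>2 \<le> 8 * (e\<^sup>2 * a ^ 4)"
  proof -
    have "A\<^sup>2 - B\<^sup>2 = (A - B) * (A + B)" by (simp add: algebra_simps power2_eq_square)
    also have "\<dots> \<le> (A - B) * (2 * (2 * a\<^sup>2))" using BA A2 by (intro mult_left_mono) auto
    also have "A - B = 2 * (a\<^sup>2 * e\<^sup>2)" unfolding A_def B_def by (simp add: algebra_simps)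
    finally show ?thesis by (simp add: power2_eq_square power4_eq_xxxx mult_ac)
  qed
  moreover have min4: "min (a\<^sup>2) (a ^ 4) = a ^ 4"
  proof -
    have "a ^ 4 \<le> a ^ 2" using True a by (intro power_decreasing) auto
    then show ?thesis by simp
  qed
  ultimately have "1 - 75/8 * (8 * (e\<^sup>2 * a ^ 4)) \<le> ?I" by argo
  then show ?thesis using min4 by simp
next
  case False
  have "1 - (\<Sum>l<q. (a * W T l k - a * W (flip j k T) l k)\<^sup>2) / 8 \<le> ?I"
    using k by (intro sign_mixture_affinity_large[where ?k0.0 = k]) (auto simp: W_flip_other)
  then have "1 - a\<^sup>2 * e\<^sup>2 / 2 \<le> ?I" unfolding W_col_sum(4)[OF T j k] by simp
  moreover have min2: "min (a\<^sup>2) (a ^ 4) = a\<^sup>2"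
  proof -
    have "a ^ 2 \<le> a ^ 4" using False by (intro power_increasing) auto
    then show ?thesis by simp
  qed
  moreover have "1 - 75 * (e\<^sup>2 * a\<^sup>2) \<le> 1 - a\<^sup>2 * e\<^sup>2 / 2" by (simp add: mult.commute)
  ultimately have "1 - 75 * (e\<^sup>2 * a\<^sup>2) \<le> ?I" by argo
  then show ?thesis unfolding min2 .
qed

text \<open>Only the \<open>n\<close> rows carrying signs differ. Bernoulli's inequality bounds the
  product of their affinities below by 1 - n L.\<close>

lemma affinity:
  assumes T: "T \<in> sign_mats J K" and j: "j \<in> J" and k: "k \<in> K"
    and c: "75 * n * (e\<^sup>2 * min (a\<^sup>2) (a ^ 4)) \<le> 1/4"
  shows "3/4 \<le> (\<integral>y. sqrt (dens0 T y * dens0 (flip j k T) y) \<partial>gauss (P \<times> Q))"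
proof -
  define L where "L = 75 * (e\<^sup>2 * min (a\<^sup>2) (a ^ 4))"
  have L0: "0 \<le> L" unfolding L_def by simp
  have n1: "1 \<le> n" using s rp by simp
  have Ln: "n * L \<le> 1/4" using c by (simp add: L_def)
  have "1 * L \<le> n * L" using n1 L0 by (intro mult_right_mono) auto
  then have L1: "L \<le> 1" using Ln by linarith
  let ?h = "\<lambda>i w. sqrt (rowdens T i w * rowdens (flip j k T) i w)"
  have "(\<integral>y. sqrt (dens0 T y * dens0 (flip j k T) y) \<partial>gauss (P \<times> Q)) =
      (\<integral>y. (\<Prod>i<p. ?h i (\<lambda>l\<in>Q. y (i, l))) \<partial>gauss (P \<times> Q))"
    unfolding dens0_rows prod.distrib[symmetric] by (simp only: sqrt_prod finite_lessThan)
  also have "\<dots> = (\<Prod>i<p. \<integral>w. ?h i w \<partial>gauss Q)"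
    by (intro gauss_rows_integral integrable_sqrt_mult rowdens_integral rowdens_nonneg) auto
  also have "\<dots> \<ge> (\<Prod>i<r. 1) * (\<Prod>i\<in>I. 1 - L)"
    unfolding P_split_prod
  proof (intro mult_mono prod_mono conjI prod_nonneg ballI)
    fix i assume "i \<in> {..<r}"
    then have "?h i = rowdens T i" by (intro ext) (simp add: rowdens_def)
    then have "(\<integral>w. ?h i w \<partial>gauss Q) = 1" using rowdens_integral by simp
    then show "1 \<le> (\<integral>w. ?h i w \<partial>gauss Q)" "0 \<le> (\<integral>w. ?h i w \<partial>gauss Q)" by simp_all
  next
    fix i assume "i \<in> I"
    then have "rowdens T i = sign_mixture K Q (\<lambda>k j. a * W T j k)" for T by (simp add: rowdens_def)
    then show "1 - L \<le> (\<integral>w. ?h i w \<partial>gauss Q)" unfolding L_def using row_affinity[OF T j k] by simp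
  qed (use L1 in auto)
  finally have "(1 - L) ^ n \<le> (\<integral>y. sqrt (dens0 T y * dens0 (flip j k T) y) \<partial>gauss (P \<times> Q))"
    by simp
  moreover have "1 + n * (- L) \<le> (1 + - L) ^ n" using L1 by (intro Bernoulli_inequality) simp
  ultimately show ?thesis using Ln by simp
qed

text \<open>The full mixtures overlap by at least 1/4 through \<open>sqrt_mult_le_min\<close>;
  passing to the sub-densities removes at most the mass that each of them has lost.\<close>

lemma integral_min:
  assumes T: "T \<in> sign_mats J K" and j: "j \<in> J" and k: "k \<in> K"
    and c: "75 * n * (e\<^sup>2 * min (a\<^sup>2) (a ^ 4)) \<le> 1/4"
  shows "1/4 - (1 - (\<integral>y. dens T y \<partial>gauss (P \<times> Q))) - (1 - (\<integral>y. dens (flip j k T) y \<partial>gauss (P \<times> Q)))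
    \<le> (\<integral>y. min (dens T y) (dens (flip j k T) y) \<partial>gauss (P \<times> Q))"
proof -
  let ?T' = "flip j k T"
  have pt: "1/2 * (sqrt (dens0 T y * dens0 ?T' y) - (dens0 T y + dens0 ?T' y) / 8)
      - (dens0 T y - dens T y) - (dens0 ?T' y - dens ?T' y) \<le> min (dens T y) (dens ?T' y)" for y
  proof -
    have "sqrt (dens0 T y * dens0 ?T' y) \<le> 2 * min (dens0 T y) (dens0 ?T' y) + (dens0 T y + dens0 ?T' y) / 8"
      by (intro sqrt_mult_le_min dens0_nonneg)
    moreover have "min (dens0 T y) (dens0 ?T' y) - (dens0 T y - dens T y) - (dens0 ?T' y - dens ?T' y)
        \<le> min (dens T y) (dens ?T' y)"
      using dens_le[of T y] dens_le[of ?T' y] by linarith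
    ultimately show ?thesis by argo
  qed
  have i: "integrable (gauss (P \<times> Q)) (\<lambda>y. sqrt (dens0 T y * dens0 ?T' y))"
    by (intro integrable_sqrt_mult dens0_integral dens0_nonneg)
  note ii = i dens0_integral dens_integral(1)
  have "1/2 * ((\<integral>y. sqrt (dens0 T y * dens0 ?T' y) \<partial>gauss (P \<times> Q)) - (1 + 1) / 8)
      - (1 - (\<integral>y. dens T y \<partial>gauss (P \<times> Q))) - (1 - (\<integral>y. dens ?T' y \<partial>gauss (P \<times> Q))) =
    (\<integral>y. 1/2 * (sqrt (dens0 T y * dens0 ?T' y) - (dens0 T y + dens0 ?T' y) / 8)
      - (dens0 T y - dens T y) - (dens0 ?T' y - dens ?T' y) \<partial>gauss (P \<times> Q))"
    using ii by simp
  also have "\<dots> \<le> (\<integral>y. min (dens T y) (dens ?T' y) \<partial>gauss (P \<times> Q))"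
    using ii by (intro integral_mono pt) auto
  finally show ?thesis using affinity[OF assms] by argo
qed

end

section \<open>From overlap to Bayes risk\<close>

context sign_prior
begin

lemma X_eq: "X T R (i, j) = a * (\<Sum>k<r. G R i k * W T j k)"
  by (simp add: X_def)

text \<open>The top block is the identity, so |W x|^2 = |x|^2 + e^2 |T x'|^2 with x' the first
  \<open>s\<close> coordinates, and \<open>e_small\<close> bounds the last term by |x'|^2.\<close>

lemma goodT_W:
  assumes "goodT T"
  shows "L2_set x {..<r} \<le> L2_set (\<lambda>j. \<Sum>k<r. W T j k * x k) Q"
    and "L2_set (\<lambda>j. \<Sum>k<r. W T j k * x k) Q \<le> sqrt 2 * L2_set x {..<r}"
proof -
  define y where "y = (\<lambda>j. \<Sum>k<s. T j k * x k)"
  have top: "(\<Sum>k<r. W T j k * x k) = x j" if "j < r" for j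
  proof -
    have "(\<Sum>k<r. W T j k * x k) = (\<Sum>k<r. if k = j then x k else 0)"
      using that by (intro sum.cong) (auto simp: W_def)
    then show ?thesis using that by simp
  qed
  have bot: "(\<Sum>k<r. W T j k * x k) = e * y j" if "j \<in> J" for j
  proof -
    have "(\<Sum>k<r. W T j k * x k) = (\<Sum>k<s. e * (T j k * x k))"
      using that s by (intro sum.mono_neutral_cong_right) (auto simp: W_def)
    then show ?thesis by (simp add: y_def sum_distrib_left)
  qed
  have sq: "(L2_set (\<lambda>j. \<Sum>k<r. W T j k * x k) Q)\<^sup>2 = (L2_set x {..<r})\<^sup>2 + e\<^sup>2 * (L2_set y J)\<^sup>2"
    unfolding L2_set_sq Q_split by (simp add: top bot power_mult_distrib sum_distrib_left)
  have "(L2_set x {..<r})\<^sup>2 \<le> (L2_set (\<lambda>j. \<Sum>k<r. W T j k * x k) Q)\<^sup>2" unfolding sq by simp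
  then show "L2_set x {..<r} \<le> L2_set (\<lambda>j. \<Sum>k<r. W T j k * x k) Q"
    by (rule power2_le_imp_le) simp
  have "L2_set y J \<le> 2 * sqrt (384 * m) * L2_set x K"
    using assms unfolding goodT_def y_def by blast
  then have "(L2_set y J)\<^sup>2 \<le> (2 * sqrt (384 * m) * L2_set x K)\<^sup>2" by (intro power_mono) auto
  then have "(L2_set y J)\<^sup>2 \<le> 1536 * m * (L2_set x K)\<^sup>2" by (simp add: power_mult_distrib)
  then have "e\<^sup>2 * (L2_set y J)\<^sup>2 \<le> e\<^sup>2 * (1536 * m * (L2_set x K)\<^sup>2)" by (intro mult_left_mono) auto
  also have "\<dots> = (1536 * e\<^sup>2 * m) * (L2_set x K)\<^sup>2" by simp
  also have "\<dots> \<le> 1 * (L2_set x K)\<^sup>2" using e_small by (intro mult_right_mono) auto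
  also have "(L2_set x K)\<^sup>2 \<le> (L2_set x {..<r})\<^sup>2"
    unfolding L2_set_sq using s by (intro sum_mono2) auto
  finally have "(L2_set (\<lambda>j. \<Sum>k<r. W T j k * x k) Q)\<^sup>2 \<le> (sqrt 2 * L2_set x {..<r})\<^sup>2"
    unfolding sq by (simp add: power_mult_distrib)
  then show "L2_set (\<lambda>j. \<Sum>k<r. W T j k * x k) Q \<le> sqrt 2 * L2_set x {..<r}"
    by (rule power2_le_imp_le) simp
qed

text \<open>|G x|^2 is n times the squared norm of the padded coordinates plus |R x'|^2 for the
  first \<open>s\<close> ones, so the factor 1/2 of \<open>goodR\<close> survives.\<close>

lemma goodR_G:
  assumes "goodR R"
  shows "sqrt n / 2 * L2_set x {..<r} \<le> L2_set (\<lambda>i. \<Sum>k<r. G R i k * x k) P"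
proof -
  define y where "y = (\<lambda>i. \<Sum>k<s. R i k * x k)"
  have top: "(\<Sum>k<r. G R i k * x k) = (if s \<le> i then sqrt n * x i else 0)" if "i < r" for i
  proof -
    have "(\<Sum>k<r. G R i k * x k) = (\<Sum>k<r. if k = i then (if s \<le> i then sqrt n * x i else 0) else 0)"
      using that by (intro sum.cong) (auto simp: G_def)
    then show ?thesis using that by simp
  qed
  have bot: "(\<Sum>k<r. G R i k * x k) = y i" if "i \<in> I" for i
    unfolding y_def using that s by (intro sum.mono_neutral_cong_right) (auto simp: G_def)
  have "(\<Sum>k<r. (if s \<le> k then sqrt n * x k else 0)\<^sup>2) = (\<Sum>k\<in>{s..<r}. n * (x k)\<^sup>2)"
    by (intro sum.mono_neutral_cong_right) (auto simp: power_mult_distrib)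
  also have "\<dots> = n * (\<Sum>k\<in>{s..<r}. (x k)\<^sup>2)" by (simp add: sum_distrib_left)
  finally have sq: "(L2_set (\<lambda>i. \<Sum>k<r. G R i k * x k) P)\<^sup>2 = n * (\<Sum>k\<in>{s..<r}. (x k)\<^sup>2) + (L2_set y I)\<^sup>2"
    unfolding L2_set_sq P_split by (simp add: top bot)
  have xs: "(L2_set x {..<r})\<^sup>2 = (\<Sum>k\<in>{s..<r}. (x k)\<^sup>2) + (L2_set x K)\<^sup>2"
    unfolding L2_set_sq using s by (subst sum.union_disjoint[symmetric]) (auto intro!: sum.cong)
  have "sqrt n / 2 * L2_set x K \<le> L2_set y I" using assms unfolding goodR_def y_def by blast
  then have "(sqrt n / 2 * L2_set x K)\<^sup>2 \<le> (L2_set y I)\<^sup>2" by (intro power_mono) auto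
  then have "n / 4 * (L2_set x K)\<^sup>2 \<le> (L2_set y I)\<^sup>2" by (simp add: power_mult_distrib power_divide)
  moreover have "n / 4 * (\<Sum>k\<in>{s..<r}. (x k)\<^sup>2) \<le> n * (\<Sum>k\<in>{s..<r}. (x k)\<^sup>2)"
    by (intro mult_right_mono) (auto intro: sum_nonneg)
  ultimately have "n / 4 * (L2_set x {..<r})\<^sup>2 \<le> (L2_set (\<lambda>i. \<Sum>k<r. G R i k * x k) P)\<^sup>2"
    unfolding sq xs distrib_left by linarith
  moreover have "(sqrt n / 2 * L2_set x {..<r})\<^sup>2 = n / 4 * (L2_set x {..<r})\<^sup>2"
    by (simp add: power_mult_distrib power_divide)
  ultimately have "(sqrt n / 2 * L2_set x {..<r})\<^sup>2 \<le> (L2_set (\<lambda>i. \<Sum>k<r. G R i k * x k) P)\<^sup>2"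
    by (simp only:)
  then show ?thesis by (rule power2_le_imp_le) simp
qed

lemma resid_le:
  assumes "projection q r M"
  shows "resid M T \<le> (\<Sum>k<r. \<Sum>l<q. (W T l k)\<^sup>2)"
proof -
  interpret projection q r M by fact
  have "resid M T = (\<Sum>k<r. \<Sum>j<q. (\<Sum>l<q. M j l * W T l k)\<^sup>2)"
    unfolding resid_def by (rule sum.swap)
  also have "\<dots> \<le> (\<Sum>k<r. \<Sum>l<q. (W T l k)\<^sup>2)" by (intro sum_mono M_contr)
  finally show ?thesis .
qed

text \<open>\<open>resid_lower\<close> is used for each fixed \<open>y\<close> with f T =
  \<open>dens T y\<close>, because the estimate may depend on \<open>y\<close> but not on
  \<open>T\<close>; integration over \<open>y\<close> follows. The averages over \<open>T\<close>
  and \<open>R\<close> are then replaced by a single pair.\<close>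

theorem bayes_risk_lower:
  assumes c: "75 * n * (e\<^sup>2 * min (a\<^sup>2) (a ^ 4)) \<le> 1/4"
    and sn: "s = 1 \<or> 15360168 * s \<le> n"
    and pr: "\<And>y. projection q r (M y)"
    and meas: "\<And>j l. j < q \<Longrightarrow> l < q \<Longrightarrow> (\<lambda>y. M y j l) \<in> borel_measurable (gauss (P \<times> Q))"
  shows "\<exists>T R. goodT T \<and> goodR R \<and> e\<^sup>2 * m * s / 64 \<le>
    (\<integral>y. tilt (P \<times> Q) (X T R) y * resid (M y) T \<partial>gauss (P \<times> Q))"
proof -
  let ?A = "avg (sign_mats J K)" and ?N = "gauss (P \<times> Q)"
  have finT: "finite (sign_mats J K)" and finR: "finite (sign_mats I K)" by simp_all
  have m1: "1 \<le> m" using s rq by simp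
  define \<beta> where "\<beta> = avg (sign_mats I K) (\<lambda>R. of_bool (\<not> goodR R))"
  have \<beta>: "\<beta> \<le> 1/16"
    unfolding \<beta>_def goodR_def using sign_mats_lower[of I K] s sn by (simp add: lessThan_empty_iff)
  define \<gamma> where "\<gamma> = ?A (\<lambda>T. of_bool (\<not> goodT T))"
  have \<gamma>: "\<gamma> \<le> 1/32"
    unfolding \<gamma>_def goodT_def using sign_mats_upper[of J K] s rq by (simp add: lessThan_empty_iff)
  have lost: "1 - (\<integral>y. dens T y \<partial>?N) \<le> of_bool (\<not> goodT T) + \<beta>" for T
  proof -
    have "avg (sign_mats I K) (\<lambda>R. of_bool (goodR R)) = avg (sign_mats I K) (\<lambda>R. 1 - of_bool (\<not> goodR R))"
      by (intro avg_cong) simp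
    also have "\<dots> = 1 - \<beta>" unfolding avg_diff \<beta>_def using finR by (simp add: avg_const)
    finally have g: "avg (sign_mats I K) (\<lambda>R. of_bool (goodR R)) = 1 - \<beta>" .
    have "0 \<le> \<beta>" unfolding \<beta>_def by (rule avg_nonneg) simp
    then show ?thesis unfolding dens_integral(2) g by (cases "goodT T") simp_all
  qed
  define \<mu> where "\<mu> = (\<lambda>y j k T. min (dens T y) (dens (flip j k T) y))"
  have \<mu>_int: "integrable ?N (\<lambda>y. \<mu> y j k T)" for j k T
    unfolding \<mu>_def by (intro integrable_min dens_integral)
  have \<mu>_avg: "1/16 \<le> ?A (\<lambda>T. \<integral>y. \<mu> y j k T \<partial>?N)" if jk: "j \<in> J" "k \<in> K" for j k
  proof -
    \<comment> \<open>Each of the two sub-densities loses at most 1/32 + 1/16 on average; flipping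
      preserves the proportion of bad \<open>T\<close>.\<close>
    have "1/16 \<le> 1/4 - 2 * (\<gamma> + \<beta>)" using \<beta> \<gamma> by simp
    also have "\<dots> = ?A (\<lambda>T. 1/4 - ((of_bool (\<not> goodT T) + \<beta>) + (of_bool (\<not> goodT (flip j k T)) + \<beta>)))"
    proof -
      have "?A (\<lambda>T. of_bool (\<not> goodT (flip j k T))) = \<gamma>"
        unfolding \<gamma>_def using avg_involution[of "sign_mats J K" "flip j k" "\<lambda>T. of_bool (\<not> goodT T)"] flip_in jk by simp
      then show ?thesis unfolding avg_diff avg_add using finT by (simp add: avg_const \<gamma>_def[symmetric])
    qed
    also have "\<dots> \<le> ?A (\<lambda>T. \<integral>y. \<mu> y j k T \<partial>?N)"
    proof (rule avg_mono)
      fix T assume T: "T \<in> sign_mats J K"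
      show "1/4 - ((of_bool (\<not> goodT T) + \<beta>) + (of_bool (\<not> goodT (flip j k T)) + \<beta>)) \<le> (\<integral>y. \<mu> y j k T \<partial>?N)"
        using integral_min[OF T jk c] lost[of T] lost[of "flip j k T"] unfolding \<mu>_def by argo
    qed
    finally show ?thesis .
  qed
  have tr_int: "integrable ?N (\<lambda>y. tilt (P \<times> Q) (X T R) y * resid (M y) T)" for T R
  proof (rule Bochner_Integration.integrable_bound)
    define C where "C = (\<Sum>k<r. \<Sum>l<q. (W T l k)\<^sup>2)"
    show "integrable ?N (\<lambda>y. C * tilt (P \<times> Q) (X T R) y)" by (simp add: tilt_integral)
    have "(\<lambda>y. resid (M y) T) \<in> borel_measurable ?N"
      unfolding resid_def using meas by (intro borel_measurable_sum borel_measurable_power borel_measurable_times) auto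
    then show "(\<lambda>y. tilt (P \<times> Q) (X T R) y * resid (M y) T) \<in> borel_measurable ?N"
      by (intro borel_measurable_times measurable_tilt) auto
    show "AE y in ?N. norm (tilt (P \<times> Q) (X T R) y * resid (M y) T) \<le> norm (C * tilt (P \<times> Q) (X T R) y)"
    proof (rule AE_I2)
      fix y
      have "resid (M y) T \<le> C" "0 \<le> resid (M y) T" using resid_le[OF pr] resid_nonneg by (simp_all add: C_def)
      then show "norm (tilt (P \<times> Q) (X T R) y * resid (M y) T) \<le> norm (C * tilt (P \<times> Q) (X T R) y)"
        by (simp add: abs_mult mult.commute mult_right_mono)
    qed
  qed
  define h where "h = (\<lambda>T R. of_bool (goodT T) * (of_bool (goodR R) * (\<integral>y. tilt (P \<times> Q) (X T R) y * resid (M y) T \<partial>?N)))"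
  have dr: "dens T y * resid (M y) T =
      avg (sign_mats I K) (\<lambda>R. of_bool (goodT T) * (of_bool (goodR R) * (tilt (P \<times> Q) (X T R) y * resid (M y) T)))" for T y
    unfolding dens_def avg_cmult by (simp add: avg_def sum_distrib_left sum_distrib_right mult_ac)
  have dr_int: "integrable ?N (\<lambda>y. dens T y * resid (M y) T)"
    "(\<integral>y. dens T y * resid (M y) T \<partial>?N) = avg (sign_mats I K) (h T)" for T
    unfolding dr h_def using tr_int by (simp_all add: integrable_avg)
  \<comment> \<open>\<open>e_small\<close> and s <= m give e^2 s <= 1/128, so the subtracted term is
    at most half of e^2 m s / 16.\<close>
  have "2 * (e\<^sup>2 * m * s / 64) \<le> e\<^sup>2 * (\<Sum>j\<in>J. \<Sum>k\<in>K. 1/16) - 4 * e ^ 4 * real s ^ 2 * m * 1"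
  proof -
    have "e\<^sup>2 * s \<le> e\<^sup>2 * m" using s rq by (intro mult_left_mono) auto
    then have "e\<^sup>2 * s \<le> 1/128" using e_small by linarith
    then have "e\<^sup>2 * m * s * (e\<^sup>2 * s) \<le> e\<^sup>2 * m * s * (1/128)" by (intro mult_left_mono) auto
    moreover have "4 * e ^ 4 * real s ^ 2 * m * 1 = 4 * (e\<^sup>2 * m * s * (e\<^sup>2 * s))"
      by (simp add: power2_eq_square power4_eq_xxxx)
    moreover have "e\<^sup>2 * (\<Sum>j\<in>J. \<Sum>k\<in>K. 1/16) = e\<^sup>2 * m * s / 16" by simp
    ultimately show ?thesis by argo
  qed
  also have "\<dots> \<le> e\<^sup>2 * (\<Sum>j\<in>J. \<Sum>k\<in>K. ?A (\<lambda>T. \<integral>y. \<mu> y j k T \<partial>?N)) -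
      4 * e ^ 4 * real s ^ 2 * m * ?A (\<lambda>T. \<integral>y. dens T y \<partial>?N)"
  proof (intro diff_mono mult_left_mono sum_mono \<mu>_avg)
    have "?A (\<lambda>T. \<integral>y. dens T y \<partial>?N) \<le> ?A (\<lambda>T. \<integral>y. dens0 T y \<partial>?N)"
      by (intro avg_mono integral_mono dens_integral dens0_integral dens_le)
    then show "?A (\<lambda>T. \<integral>y. dens T y \<partial>?N) \<le> 1" using finT by (simp add: dens0_integral avg_const)
  qed auto
  also have "\<dots> = (\<integral>y. e\<^sup>2 * (\<Sum>j\<in>J. \<Sum>k\<in>K. ?A (\<mu> y j k)) - 4 * e ^ 4 * real s ^ 2 * m * ?A (\<lambda>T. dens T y) \<partial>?N)"
    using \<mu>_int dens_integral(1) by (simp add: integrable_avg)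
  also have "\<dots> \<le> (\<integral>y. 2 * ?A (\<lambda>T. dens T y * resid (M y) T) \<partial>?N)"
  proof (rule integral_mono)
    fix y
    show "e\<^sup>2 * (\<Sum>j\<in>J. \<Sum>k\<in>K. ?A (\<mu> y j k)) - 4 * e ^ 4 * real s ^ 2 * m * ?A (\<lambda>T. dens T y)
        \<le> 2 * ?A (\<lambda>T. dens T y * resid (M y) T)"
      unfolding \<mu>_def using resid_lower[OF pr, of "\<lambda>T. dens T y" y] dens_nonneg by simp
  qed (use \<mu>_int dens_integral(1) dr_int(1) in \<open>simp_all add: integrable_avg\<close>)
  also have "\<dots> = 2 * ?A (\<lambda>T. avg (sign_mats I K) (h T))"
    using dr_int by (simp add: integrable_avg)
  finally have "e\<^sup>2 * m * s / 64 \<le> ?A (\<lambda>T. avg (sign_mats I K) (h T))" by argo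
  from avg_ge_imp_ex[OF finT sign_mats_nonempty this] obtain T where
    T: "e\<^sup>2 * m * s / 64 \<le> avg (sign_mats I K) (h T)" by blast
  from avg_ge_imp_ex[OF finR sign_mats_nonempty this] obtain R where
    R: "e\<^sup>2 * m * s / 64 \<le> h T R" by blast
  \<comment> \<open>\<open>h\<close> vanishes on bad pairs, so a positive lower bound certifies that
    the chosen pair is good.\<close>
  have "0 < e\<^sup>2 * m * s / 64" using e m1 s by simp
  then have "h T R \<noteq> 0" using R by linarith
  then have "goodT T" "goodR R" by (auto simp: h_def)
  then show ?thesis using R by (auto simp: h_def)
qed

end

section \<open>Spectral theorem and singular values\<close>

text \<open>Over the complex numbers an eigenvalue z exists. By symmetry the Hermitian form of the
  eigenvector equals both z |v|^2 and its conjugate, so z is real, and a real root of the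
  characteristic polynomial is a real eigenvalue.\<close>

lemma symmetric_eigenvalue_real:
  fixes A :: "real mat"
  assumes A: "A \<in> carrier_mat n n" and sym: "transpose_mat A = A" and n: "n > 0"
  shows "\<exists>x. eigenvalue A x"
proof -
  define B where "B = map_mat complex_of_real A"
  have B: "B \<in> carrier_mat n n" using A by (simp add: B_def)
  have sy: "A $$ (i, j) = A $$ (j, i)" if "i < n" "j < n" for i j
    using sym A that by (metis carrier_matD index_transpose_mat(1))
  obtain z where z: "poly (char_poly B) z = 0"
  proof -
    have "degree (char_poly B) > 0" using degree_monic_char_poly[OF B] n by auto
    then have "\<not> constant (poly (char_poly B))" by (simp add: constant_degree)
    then show thesis using fundamental_theorem_of_algebra that by blast
  qed
  then have "eigenvalue B z" using eigenvalue_root_char_poly[OF B] by simp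
  then obtain v where v: "v \<in> carrier_vec n" "v \<noteq> 0\<^sub>v n" "B *\<^sub>v v = z \<cdot>\<^sub>v v"
    using B by (auto simp: eigenvalue_def eigenvector_def)
  have Av: "(\<Sum>j<n. of_real (A $$ (i, j)) * v $ j) = z * v $ i" if i: "i < n" for i
  proof -
    have "(B *\<^sub>v v) $ i = (\<Sum>j<n. of_real (A $$ (i, j)) * v $ j)"
      using i v(1) A by (simp add: B_def scalar_prod_def atLeast0LessThan)
    then show ?thesis unfolding v(3) using i v(1) by simp
  qed
  define L where "L = (\<Sum>i<n. \<Sum>j<n. cnj (v $ i) * (of_real (A $$ (i, j)) * v $ j))"
  define N where "N = (\<Sum>i<n. (cmod (v $ i))\<^sup>2)"
  have L: "L = z * of_real N"
  proof -
    have "L = (\<Sum>i<n. cnj (v $ i) * (z * v $ i))"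
      unfolding L_def sum_distrib_left[symmetric] using Av by simp
    also have "\<dots> = z * of_real N"
      unfolding N_def of_real_sum sum_distrib_left
      by (intro sum.cong refl) (simp only: complex_norm_square mult_ac)
    finally show ?thesis .
  qed
  have "cnj L = (\<Sum>i<n. \<Sum>j<n. v $ i * (of_real (A $$ (i, j)) * cnj (v $ j)))"
    by (simp add: L_def)
  also have "\<dots> = (\<Sum>j<n. \<Sum>i<n. v $ i * (of_real (A $$ (i, j)) * cnj (v $ j)))" by (rule sum.swap)
  also have "\<dots> = L" unfolding L_def by (intro sum.cong refl) (simp add: sy mult_ac)
  finally have "cnj z * of_real N = z * of_real N" unfolding L by simp
  moreover have "N \<noteq> 0"
  proof
    assume "N = 0"
    then have "\<forall>i<n. v $ i = 0" unfolding N_def by (simp add: sum_nonneg_eq_0_iff)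
    then have "v = 0\<^sub>v n" using v(1) by (intro eq_vecI) auto
    then show False using v(2) by simp
  qed
  ultimately have "cnj z = z" by simp
  then have "z \<in> \<real>" by (simp add: Reals_cnj_iff)
  then obtain x where x: "z = of_real x" by (auto elim: Reals_cases)
  have "char_poly B = map_poly of_real (char_poly A)"
    unfolding B_def by (rule of_real_hom.char_poly_hom[OF A])
  then have "poly (char_poly A) x = 0" using z unfolding x by simp
  then show ?thesis using eigenvalue_root_char_poly[OF A] by blast
qed

lemma symmetric_unit_eigenvector:
  fixes A :: "real mat"
  assumes A: "A \<in> carrier_mat n n" and sym: "transpose_mat A = A" and n: "n > 0"
  obtains v x where "v \<in> carrier_vec n" "scalar_prod v v = 1" "A *\<^sub>v v = x \<cdot>\<^sub>v v"
proof -
  obtain x u where u: "u \<in> carrier_vec n" "u \<noteq> 0\<^sub>v n" "A *\<^sub>v u = x \<cdot>\<^sub>v u"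
    using symmetric_eigenvalue_real[OF assms] A by (auto simp: eigenvalue_def eigenvector_def)
  have "scalar_prod u u > 0"
  proof -
    have "scalar_prod u u = (\<Sum>i<n. (u $ i)\<^sup>2)"
      using u(1) by (simp add: scalar_prod_def atLeast0LessThan power2_eq_square)
    moreover have "(\<Sum>i<n. (u $ i)\<^sup>2) \<noteq> 0"
    proof
      assume "(\<Sum>i<n. (u $ i)\<^sup>2) = 0"
      then have "\<forall>i<n. u $ i = 0" by (simp add: sum_nonneg_eq_0_iff)
      then have "u = 0\<^sub>v n" using u(1) by (intro eq_vecI) auto
      then show False using u(2) by simp
    qed
    ultimately show ?thesis by (simp add: less_le sum_nonneg)
  qed
  define c where "c = 1 / sqrt (scalar_prod u u)"
  show thesis
  proof (rule that[of "c \<cdot>\<^sub>v u" x])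
    show "c \<cdot>\<^sub>v u \<in> carrier_vec n" using u(1) by simp
    have "scalar_prod (c \<cdot>\<^sub>v u) (c \<cdot>\<^sub>v u) = c * c * scalar_prod u u" using u(1) by simp
    also have "\<dots> = 1" using \<open>scalar_prod u u > 0\<close> by (simp add: c_def)
    finally show "scalar_prod (c \<cdot>\<^sub>v u) (c \<cdot>\<^sub>v u) = 1" .
    show "A *\<^sub>v (c \<cdot>\<^sub>v u) = x \<cdot>\<^sub>v (c \<cdot>\<^sub>v u)"
      using A u by (simp add: mult_mat_vec smult_smult_assoc mult.commute)
  qed
qed

text \<open>The reflection in the hyperplane orthogonal to v - e_0 exchanges v and e_0; for v = e_0
  the identity takes its place.\<close>

lemma householder:
  fixes v :: "real vec"
  assumes v: "v \<in> carrier_vec (Suc n)" "scalar_prod v v = 1"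
  obtains H where "H \<in> carrier_mat (Suc n) (Suc n)" "transpose_mat H = H" "H * H = 1\<^sub>m (Suc n)" "col H 0 = v"
proof (cases "v $ 0 = 1")
  case True
  have s: "(\<Sum>i<Suc n. (v $ i)\<^sup>2) = 1"
    using v by (simp add: scalar_prod_def atLeast0LessThan power2_eq_square del: sum.lessThan_Suc)
  then have "(\<Sum>i<n. (v $ Suc i)\<^sup>2) = 0" using True unfolding sum.lessThan_Suc_shift by simp
  then have "\<forall>i<n. v $ Suc i = 0" by (simp add: sum_nonneg_eq_0_iff)
  then have "v = col (1\<^sub>m (Suc n)) 0"
    using v(1) True by (intro eq_vecI) (auto simp: less_Suc_eq_0_disj)
  then show thesis using that[of "1\<^sub>m (Suc n)"] by simp
next
  case False
  define N where "N = Suc n"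
  define u where "u = (\<lambda>i. v $ i - (if i = 0 then 1 else 0))"
  \<comment> \<open>The usual 2 / |u|^2, as |u|^2 = 2 (1 - v_0) for a unit vector v.\<close>
  define c where "c = 1 / (1 - v $ 0)"
  have s: "(\<Sum>i<N. (v $ i)\<^sup>2) = 1"
    using v by (simp add: N_def scalar_prod_def atLeast0LessThan power2_eq_square del: sum.lessThan_Suc)
  have "(\<Sum>i<N. (u i)\<^sup>2) = (v $ 0 - 1)\<^sup>2 + (\<Sum>i<n. (v $ Suc i)\<^sup>2)"
    unfolding N_def sum.lessThan_Suc_shift by (simp add: u_def)
  also have "(\<Sum>i<n. (v $ Suc i)\<^sup>2) = 1 - (v $ 0)\<^sup>2"
    using s unfolding N_def sum.lessThan_Suc_shift by simp
  finally have uu: "(\<Sum>i<N. (u i)\<^sup>2) = 2 * (1 - v $ 0)" by (simp add: power2_diff)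
  have cancel: "1 / w * (2 * w) = 2" if "w \<noteq> 0" for w :: real using that by simp
  have cu: "c * (\<Sum>i<N. (u i)\<^sup>2) = 2" unfolding uu c_def by (rule cancel) (use False in simp)
  have cu0: "c * u 0 = - 1" using False by (simp add: c_def u_def field_simps)
  define H where "H = mat N N (\<lambda>(i, j). (if i = j then 1 else 0) - c * u i * u j)"
  have H: "H \<in> carrier_mat N N" by (simp add: H_def)
  have HH: "H * H = 1\<^sub>m N"
  proof (rule eq_matI)
    fix i j assume ij: "i < dim_row (1\<^sub>m N)" "j < dim_col (1\<^sub>m N)"
    then have ij: "i < N" "j < N" by simp_all
    have "(H * H) $$ (i, j) = (\<Sum>l<N. ((if i = l then 1 else 0) - c * u i * u l) * ((if l = j then 1 else 0) - c * u l * u j))"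
      using ij by (simp add: H_def scalar_prod_def atLeast0LessThan)
    also have "\<dots> = (\<Sum>l<N. (if i = l then (if l = j then 1 else 0) - c * u l * u j else 0) -
        (if l = j then c * u i * u l else 0) + c * u i * u j * (c * (u l)\<^sup>2))"
      by (intro sum.cong) (auto simp: algebra_simps power2_eq_square)
    also have "\<dots> = ((if i = j then 1 else 0) - c * u i * u j) - c * u i * u j + c * u i * u j * (c * (\<Sum>l<N. (u l)\<^sup>2))"
      using ij by (simp add: sum.distrib sum_subtractf sum_distrib_left)
    also have "\<dots> = (if i = j then 1 else 0)" unfolding cu by simp
    finally show "(H * H) $$ (i, j) = 1\<^sub>m N $$ (i, j)" using ij by simp
  qed (simp_all add: H_def)
  have "transpose_mat H = H" by (intro eq_matI) (auto simp: H_def)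
  moreover have "col H 0 = v"
  proof (rule eq_vecI)
    fix i assume "i < dim_vec v"
    then have i: "i < N" using v by (simp add: N_def)
    have "col H 0 $ i = (if i = 0 then 1 else 0) - u i * (c * u 0)"
      using i by (simp add: H_def N_def mult_ac)
    also have "\<dots> = v $ i" unfolding cu0 by (simp add: u_def)
    finally show "col H 0 $ i = v $ i" .
  qed (use v in \<open>simp add: H_def N_def\<close>)
  ultimately show thesis using that[of H] H HH by (simp add: N_def)
qed

text \<open>Deflation: a reflection moves a unit eigenvector to the first coordinate, symmetry
  clears the first row as well as the first column, and induction treats the remaining
  block.\<close>

lemma symmetric_diagonalizable:
  fixes A :: "real mat"
  assumes "A \<in> carrier_mat n n" "transpose_mat A = A"
  shows "\<exists>Q d. Q \<in> carrier_mat n n \<and> transpose_mat Q * Q = 1\<^sub>m n \<and> transpose_mat Q * A * Q = mat_diag n d"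
  using assms
proof (induction n arbitrary: A)
  case 0
  then show ?case by (intro exI[of _ "1\<^sub>m 0"] exI[of _ "\<lambda>_. 0"]) (auto simp: mat_diag_def intro!: eq_matI)
next
  case (Suc n)
  note A = Suc.prems(1)
  obtain v x where v: "v \<in> carrier_vec (Suc n)" "scalar_prod v v = 1" "A *\<^sub>v v = x \<cdot>\<^sub>v v"
    by (rule symmetric_unit_eigenvector[OF Suc.prems]) auto
  obtain H where H: "H \<in> carrier_mat (Suc n) (Suc n)" "transpose_mat H = H" "H * H = 1\<^sub>m (Suc n)" "col H 0 = v"
    by (rule householder[OF v(1,2)])
  define B where "B = H * A * H"
  have B: "B \<in> carrier_mat (Suc n) (Suc n)" using A H by (simp add: B_def)
  have symB: "transpose_mat B = B"
  proof -
    have "transpose_mat B = transpose_mat H * (transpose_mat A * transpose_mat H)"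
      unfolding B_def using A H(1) by (simp add: transpose_mult[of _ "Suc n" "Suc n" _ "Suc n"])
    then show ?thesis unfolding H(2) Suc.prems(2) B_def using A H(1) by (simp add: assoc_mult_mat[of _ "Suc n" "Suc n" _ "Suc n" _ "Suc n"])
  qed
  have colB: "col B 0 = x \<cdot>\<^sub>v col (1\<^sub>m (Suc n)) 0"
  proof -
    have "col B 0 = (H * A) *\<^sub>v col H 0" unfolding B_def using A H(1) by (intro col_mult2[of _ "Suc n" "Suc n" _ "Suc n"]) auto
    also have "\<dots> = H *\<^sub>v (A *\<^sub>v v)" unfolding H(4) using A H(1) v(1) by (simp add: assoc_mult_mat_vec[of _ "Suc n" "Suc n" _ "Suc n"])
    also have "\<dots> = x \<cdot>\<^sub>v (H *\<^sub>v col H 0)" unfolding v(3) H(4) using H(1) v(1) by (simp add: mult_mat_vec)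
    also have "H *\<^sub>v col H 0 = col (H * H) 0" using H(1) by (intro col_mult2[symmetric, of _ "Suc n" "Suc n" _ "Suc n"]) auto
    finally show ?thesis unfolding H(3) .
  qed
  have B0: "B $$ (i, 0) = (if i = 0 then x else 0)" if "i < Suc n" for i
  proof -
    have "B $$ (i, 0) = col B 0 $ i" using B that by simp
    then show ?thesis unfolding colB using that by simp
  qed
  have B0': "B $$ (0, i) = (if i = 0 then x else 0)" if "i < Suc n" for i
  proof -
    have "B $$ (0, i) = transpose_mat B $$ (i, 0)" using B that by simp
    then show ?thesis unfolding symB using B0[OF that] by simp
  qed
  define C where "C = mat n n (\<lambda>(i, j). B $$ (Suc i, Suc j))"
  have C: "C \<in> carrier_mat n n" by (simp add: C_def)
  have symC: "transpose_mat C = C"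
  proof (rule eq_matI)
    fix i j assume "i < dim_row C" "j < dim_col C"
    then have ij: "i < n" "j < n" by (simp_all add: C_def)
    have "B $$ (Suc j, Suc i) = transpose_mat B $$ (Suc i, Suc j)" using B ij by simp
    then show "transpose_mat C $$ (i, j) = C $$ (i, j)" unfolding symB using ij by (simp add: C_def)
  qed (simp_all add: C_def)
  let ?X = "mat 1 1 (\<lambda>_. x)"
  have Bblock: "B = four_block_mat ?X (0\<^sub>m 1 n) (0\<^sub>m n 1) C"
    by (rule eq_matI) (use B in \<open>auto simp: B0 B0' C_def\<close>)
  from Suc.IH[OF C symC] obtain P d where P: "P \<in> carrier_mat n n" "transpose_mat P * P = 1\<^sub>m n"
    "transpose_mat P * C * P = mat_diag n d" by blast
  define F where "F = four_block_mat (1\<^sub>m 1) (0\<^sub>m 1 n) (0\<^sub>m n 1) P"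
  have F: "F \<in> carrier_mat (Suc n) (Suc n)"
    unfolding F_def using four_block_carrier_mat[OF one_carrier_mat[of 1] P(1)] by simp
  have FT: "transpose_mat F = four_block_mat (1\<^sub>m 1) (0\<^sub>m 1 n) (0\<^sub>m n 1) (transpose_mat P)"
    unfolding F_def using P by (subst transpose_four_block_mat[of _ 1 1 _ n _ n]) auto
  have FTF: "transpose_mat F * F = 1\<^sub>m (Suc n)"
  proof -
    have "transpose_mat F * F = four_block_mat (1\<^sub>m 1) (0\<^sub>m 1 n) (0\<^sub>m n 1) (1\<^sub>m n)"
      unfolding FT unfolding F_def using P by (subst mult_four_block_mat[of _ 1 1 _ n _ n _ _ 1 _ n]) auto
    also have "\<dots> = 1\<^sub>m (Suc n)" by (intro eq_matI) auto
    finally show ?thesis .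
  qed
  have FBF: "transpose_mat F * B * F = mat_diag (Suc n) (\<lambda>i. case i of 0 \<Rightarrow> x | Suc i \<Rightarrow> d i)"
  proof -
    have "transpose_mat F * B = four_block_mat ?X (0\<^sub>m 1 n) (0\<^sub>m n 1) (transpose_mat P * C)"
      unfolding FT Bblock using P C by (subst mult_four_block_mat[of _ 1 1 _ n _ n _ _ 1 _ n]) auto
    also have "\<dots> * F = four_block_mat ?X (0\<^sub>m 1 n) (0\<^sub>m n 1) (mat_diag n d)"
      unfolding F_def using P C by (subst mult_four_block_mat[of _ 1 1 _ n _ n _ _ 1 _ n]) auto
    also have "\<dots> = mat_diag (Suc n) (\<lambda>i. case i of 0 \<Rightarrow> x | Suc i \<Rightarrow> d i)"
      by (intro eq_matI) (auto simp: mat_diag_def split: nat.split)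
    finally show ?thesis .
  qed
  define Q where "Q = H * F"
  have Q: "Q \<in> carrier_mat (Suc n) (Suc n)" using H F by (simp add: Q_def)
  have QT: "transpose_mat Q = transpose_mat F * H"
    unfolding Q_def using H F by (simp add: transpose_mult[of _ "Suc n" "Suc n" _ "Suc n"])
  note assoc = assoc_mult_mat[of _ "Suc n" "Suc n" _ "Suc n" _ "Suc n"]
  have "transpose_mat Q * Q = transpose_mat F * ((H * H) * F)"
    unfolding QT unfolding Q_def using H(1) F by (simp add: assoc)
  then have 1: "transpose_mat Q * Q = 1\<^sub>m (Suc n)" unfolding H(3) using F FTF by simp
  have "transpose_mat Q * A * Q = transpose_mat F * B * F"
    unfolding QT B_def unfolding Q_def using H(1) F A by (simp add: assoc)
  then show ?case using 1 Q FBF by (intro exI[of _ Q]) auto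
qed

text \<open>The decreasing list that \<open>sing_vals\<close> forms for the Gram matrix before
  taking square roots.\<close>

definition eigvals :: "real mat \<Rightarrow> real list" where
  "eigvals A = rev (sorted_list_of_multiset (proots (char_poly A)))"

definition delta :: "nat \<Rightarrow> nat \<Rightarrow> real" where
  "delta i j = (if i = j then 1 else 0)"

lemma sum_delta [simp]: "k < (n::nat) \<Longrightarrow> (\<Sum>i<n. delta i k * f i) = f k"
  "k < n \<Longrightarrow> (\<Sum>i<n. delta k i * f i) = f k"
  "k < n \<Longrightarrow> (\<Sum>i<n. f i * delta i k) = f k"
  "k < n \<Longrightarrow> (\<Sum>i<n. f i * delta k i) = f k"
proof -
  assume k: "k < n"
  have "(\<Sum>i<n. if i = k then f i else 0) = f k" using k by simp
  moreover have "delta i k * f i = (if i = k then f i else 0)" "delta k i * f i = (if i = k then f i else 0)"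
    "f i * delta i k = (if i = k then f i else 0)" "f i * delta k i = (if i = k then f i else 0)" for i
    by (auto simp: delta_def)
  ultimately show "(\<Sum>i<n. delta i k * f i) = f k" "(\<Sum>i<n. delta k i * f i) = f k"
    "(\<Sum>i<n. f i * delta i k) = f k" "(\<Sum>i<n. f i * delta k i) = f k"
    by simp_all
qed

text \<open>Diagonalisation gives the eigenvalues in arbitrary order, whereas \<open>eigvals\<close>
  is sorted. Equality of multisets yields a permutation \<open>f\<close>, which reorders the columns
  of \<open>Q\<close> accordingly.\<close>

lemma symmetric_spectral:
  fixes A :: "real mat"
  assumes A: "A \<in> carrier_mat n n" and sym: "transpose_mat A = A"
  shows "length (eigvals A) = n"
    and "\<And>i j. i \<le> j \<Longrightarrow> j < n \<Longrightarrow> eigvals A ! j \<le> eigvals A ! i"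
    and "\<exists>w. (\<forall>i<n. \<forall>j<n. (\<Sum>l<n. w i l * w j l) = delta i j) \<and>
      (\<forall>k<n. \<forall>l<n. (\<Sum>i<n. w i k * w i l) = delta k l) \<and>
      (\<forall>i<n. \<forall>k<n. (\<Sum>l<n. A $$ (k, l) * w i l) = eigvals A ! i * w i k)"
proof -
  obtain Q d where Q: "Q \<in> carrier_mat n n" "transpose_mat Q * Q = 1\<^sub>m n" "transpose_mat Q * A * Q = mat_diag n d"
    using symmetric_diagonalizable[OF assms] by blast
  have QQ: "Q * transpose_mat Q = 1\<^sub>m n"
    using mat_mult_left_right_inverse[of "transpose_mat Q" n Q] Q by simp
  note assoc = assoc_mult_mat[of _ n n _ n _ n]
  have AQ: "A * Q = Q * mat_diag n d"
  proof -
    have "Q * mat_diag n d = (Q * transpose_mat Q) * (A * Q)"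
      unfolding Q(3)[symmetric] using Q(1) A by (simp add: assoc)
    then show ?thesis unfolding QQ using A Q(1) by simp
  qed
  have "A = Q * mat_diag n d * transpose_mat Q"
  proof -
    have "Q * mat_diag n d * transpose_mat Q = A * (Q * transpose_mat Q)"
      unfolding AQ[symmetric] using Q(1) A by (simp add: assoc)
    then show ?thesis unfolding QQ using A by simp
  qed
  then have "similar_mat A (mat_diag n d)"
    using A Q QQ by (intro similar_matI[of _ _ Q "transpose_mat Q" n]) auto
  then have "char_poly A = char_poly (mat_diag n d)" by (rule char_poly_similar)
  also have "\<dots> = (\<Prod>x\<leftarrow>diag_mat (mat_diag n d). [:- x, 1:])"
    by (rule char_poly_upper_triangular[of _ n]) (auto simp: mat_diag_def)
  also have "diag_mat (mat_diag n d) = map d [0..<n]"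
    by (auto simp: diag_mat_def mat_diag_def)
  finally have "proots (char_poly A) = mset (map d [0..<n])"
  proof -
    assume c: "char_poly A = (\<Prod>x\<leftarrow>map d [0..<n]. [:- x, 1:])"
    have "proots (\<Prod>x\<leftarrow>xs. [:- x, 1:]) = mset xs" for xs :: "real list"
    proof (induction xs)
      case (Cons x xs)
      have "(\<Prod>x\<leftarrow>xs. [:- x, 1:]) \<noteq> 0" by (auto simp: prod_list_zero_iff)
      then have "proots ([:- x, 1:] * (\<Prod>x\<leftarrow>xs. [:- x, 1:])) = proots [:- x, 1:] + proots (\<Prod>x\<leftarrow>xs. [:- x, 1:])"
        by (intro proots_mult) auto
      then show ?case using Cons by (simp del: mult_pCons_left)
    qed simp
    then show ?thesis unfolding c .
  qed
  then have eq: "eigvals A = rev (sort (map d [0..<n]))"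
    unfolding eigvals_def by (simp only: sorted_list_of_multiset_mset)
  show len: "length (eigvals A) = n" by (simp add: eq)
  have sd: "sorted (rev (eigvals A))" by (simp add: eq)
  show "eigvals A ! j \<le> eigvals A ! i" if "i \<le> j" "j < n" for i j
    using sorted_rev_nth_mono[OF sd that(1)] that(2) len by simp
  have "mset (eigvals A) = mset (map d [0..<n])" by (simp add: eq)
  from permutation_Ex_bij[OF this] obtain f where f: "bij_betw f {..<n} {..<n}"
    "\<forall>i<n. eigvals A ! i = map d [0..<n] ! f i" using len by auto
  have fn: "f i < n" if "i < n" for i using f(1) that by (auto simp: bij_betw_def)
  have finj: "f i = f j \<longleftrightarrow> i = j" if "i < n" "j < n" for i j
    using f(1) that by (auto simp: bij_betw_def inj_on_def)
  define w where "w = (\<lambda>i l. Q $$ (l, f i))"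
  have "(\<Sum>l<n. w i l * w j l) = delta i j" if "i < n" "j < n" for i j
  proof -
    have "(transpose_mat Q * Q) $$ (f i, f j) = (\<Sum>l<n. w i l * w j l)"
      using Q(1) fn that by (simp add: w_def scalar_prod_def atLeast0LessThan)
    then show ?thesis unfolding Q(2) using fn finj that by (simp add: delta_def)
  qed
  moreover have "(\<Sum>i<n. w i k * w i l) = delta k l" if "k < n" "l < n" for k l
  proof -
    have "(Q * transpose_mat Q) $$ (k, l) = (\<Sum>i<n. Q $$ (k, i) * Q $$ (l, i))"
      using Q(1) that by (simp add: scalar_prod_def atLeast0LessThan)
    also have "\<dots> = (\<Sum>i<n. w i k * w i l)"
      unfolding w_def by (rule sum.reindex_bij_betw[OF f(1), symmetric])
    finally show ?thesis unfolding QQ using that by (simp add: delta_def)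
  qed
  moreover have "(\<Sum>l<n. A $$ (k, l) * w i l) = eigvals A ! i * w i k" if "i < n" "k < n" for i k
  proof -
    have "(A * Q) $$ (k, f i) = (\<Sum>l<n. A $$ (k, l) * w i l)"
      using A Q(1) fn that by (simp add: w_def scalar_prod_def atLeast0LessThan)
    moreover have "(Q * mat_diag n d) $$ (k, f i) = Q $$ (k, f i) * d (f i)"
      using Q(1) fn that by (subst mat_diag_mult_right[of _ n n]) auto
    ultimately show ?thesis unfolding AQ using f(2) fn that by (simp add: w_def mult.commute)
  qed
  ultimately show "\<exists>w. (\<forall>i<n. \<forall>j<n. (\<Sum>l<n. w i l * w j l) = delta i j) \<and>
      (\<forall>k<n. \<forall>l<n. (\<Sum>i<n. w i k * w i l) = delta k l) \<and>
      (\<forall>i<n. \<forall>k<n. (\<Sum>l<n. A $$ (k, l) * w i l) = eigvals A ! i * w i k)"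
    by (intro exI[of _ w]) simp
qed

text \<open>Pad the system to a singular square matrix.\<close>

lemma homogeneous_system_nontrivial:
  fixes M :: "nat \<Rightarrow> nat \<Rightarrow> real"
  assumes "m < n"
  obtains c where "\<exists>l<n. c l \<noteq> 0" "\<And>i. i < m \<Longrightarrow> (\<Sum>l<n. M i l * c l) = 0"
proof -
  define A where "A = mat\<^sub>r n n (\<lambda>i. if i = m then 0\<^sub>v n else vec n (\<lambda>l. M i l))"
  have A: "A \<in> carrier_mat n n" by (simp add: A_def)
  have "det A = 0" unfolding A_def by (rule det_row_0[OF assms]) auto
  then obtain v where v: "v \<in> carrier_vec n" "v \<noteq> 0\<^sub>v n" "A *\<^sub>v v = 0\<^sub>v n"
    using det_0_iff_vec_prod_zero[OF A] by blast
  show thesis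
  proof (rule that[of "\<lambda>l. v $ l"])
    show "\<exists>l<n. v $ l \<noteq> 0"
    proof (rule ccontr)
      assume "\<not> (\<exists>l<n. v $ l \<noteq> 0)"
      then have "v = 0\<^sub>v n" using v(1) by (intro eq_vecI) auto
      then show False using v(2) by simp
    qed
    fix i assume i: "i < m"
    have "(A *\<^sub>v v) $ i = (\<Sum>l<n. M i l * v $ l)"
      using i assms v(1) by (simp add: A_def scalar_prod_def atLeast0LessThan)
    then show "(\<Sum>l<n. M i l * v $ l) = 0" unfolding v(3) using i assms by simp
  qed
qed

text \<open>\<open>X\<close> and \<open>a\<close> have the same column space, \<open>fac\<close> and
  \<open>surj\<close> giving the two inclusions, and \<open>inj\<close> makes the \<open>r\<close>
  columns of \<open>a\<close> independent.\<close>

lemma rank_eq_of_factor: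
  fixes X :: "real mat" and a b :: "nat \<Rightarrow> nat \<Rightarrow> real"
  assumes X: "X \<in> carrier_mat p q"
    and fac: "\<And>i j. i < p \<Longrightarrow> j < q \<Longrightarrow> X $$ (i, j) = (\<Sum>k<r. a i k * b j k)"
    and inj: "\<And>c. (\<And>i. i < p \<Longrightarrow> (\<Sum>k<r. a i k * c k) = 0) \<Longrightarrow> (\<forall>k<r. c k = 0)"
    and surj: "\<And>k. k < r \<Longrightarrow> \<exists>g. \<forall>i<p. a i k = (\<Sum>j<q. X $$ (i, j) * g j)"
  shows "vec_space.rank p X = r"
proof -
  define Z where "Z = mat p r (\<lambda>(i, k). a i k)"
  have Z: "Z \<in> carrier_mat p r" by (simp add: Z_def)
  interpret vec_space "TYPE(real)" p .
  have Zv: "(Z *\<^sub>v v) $ i = (\<Sum>k<r. a i k * v $ k)" if "v \<in> carrier_vec r" "i < p" for v i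
    using that by (simp add: Z_def scalar_prod_def atLeast0LessThan)
  have Xv: "(X *\<^sub>v v) $ i = (\<Sum>j<q. X $$ (i, j) * v $ j)" if "v \<in> carrier_vec q" "i < p" for v i
    using that X by (simp add: scalar_prod_def atLeast0LessThan)
  have Zinj: "v = 0\<^sub>v r" if "v \<in> carrier_vec r" "Z *\<^sub>v v = 0\<^sub>v p" for v
  proof -
    have "\<forall>k<r. v $ k = 0"
    proof (rule inj)
      fix i assume "i < p"
      then show "(\<Sum>k<r. a i k * v $ k) = 0" using Zv[OF that(1)] that(2) by simp
    qed
    then show ?thesis using that(1) by (intro eq_vecI) auto
  qed
  have dist: "distinct (cols Z)"
  proof (rule ccontr)
    assume "\<not> distinct (cols Z)"
    then obtain k l where kl: "k < r" "l < r" "k \<noteq> l" "col Z k = col Z l"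
      using Z by (auto simp: distinct_conv_nth)
    have "\<forall>k'<r. delta k k' - delta l k' = 0"
    proof (rule inj)
      fix i assume i: "i < p"
      have "col Z k $ i = col Z l $ i" using kl by simp
      then have "a i k = a i l" using i kl by (simp add: Z_def)
      then show "(\<Sum>k'<r. a i k' * (delta k k' - delta l k')) = 0"
        using kl by (simp add: right_diff_distrib sum_subtractf)
    qed
    then show False using kl by (auto simp: delta_def)
  qed
  have indpt: "lin_indpt (set (cols Z))"
  proof
    assume "lin_dep (set (cols Z))"
    then obtain v where "v \<in> carrier_vec r" "v \<noteq> 0\<^sub>v r" "Z *\<^sub>v v = 0\<^sub>v p"
      using lin_depE[OF Z _ dist] by blast
    then show False using Zinj by blast
  qed
  have "col_space X = col_space Z"
  proof -
    have "(\<exists>x\<in>carrier_vec q. X *\<^sub>v x = y) \<longleftrightarrow> (\<exists>x\<in>carrier_vec r. Z *\<^sub>v x = y)" (is "?L \<longleftrightarrow> ?R") for y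
    proof
      assume ?L
      then obtain x where x: "x \<in> carrier_vec q" "X *\<^sub>v x = y" by blast
      define u where "u = vec r (\<lambda>k. \<Sum>j<q. b j k * x $ j)"
      have "Z *\<^sub>v u = y"
      proof (rule eq_vecI)
        fix i assume "i < dim_vec y"
        then have i: "i < p" using x X by auto
        have "(Z *\<^sub>v u) $ i = (\<Sum>k<r. \<Sum>j<q. a i k * (b j k * x $ j))"
          using Zv[of u i] i by (simp add: u_def sum_distrib_left)
        also have "\<dots> = (\<Sum>j<q. \<Sum>k<r. a i k * (b j k * x $ j))" by (rule sum.swap)
        also have "\<dots> = (\<Sum>j<q. X $$ (i, j) * x $ j)"
          using i by (intro sum.cong refl) (simp add: fac sum_distrib_left sum_distrib_right mult_ac)
        finally show "(Z *\<^sub>v u) $ i = y $ i" using Xv[OF x(1) i] x(2) by simp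
      qed (use x X Z in auto)
      then show ?R by (intro bexI[of _ u]) (auto simp: u_def)
    next
      assume ?R
      then obtain x where x: "x \<in> carrier_vec r" "Z *\<^sub>v x = y" by blast
      obtain g where g: "\<And>k i. k < r \<Longrightarrow> i < p \<Longrightarrow> a i k = (\<Sum>j<q. X $$ (i, j) * g k j)"
        using surj by metis
      define u where "u = vec q (\<lambda>j. \<Sum>k<r. g k j * x $ k)"
      have "X *\<^sub>v u = y"
      proof (rule eq_vecI)
        fix i assume "i < dim_vec y"
        then have i: "i < p" using x Z by auto
        have "(X *\<^sub>v u) $ i = (\<Sum>j<q. \<Sum>k<r. X $$ (i, j) * (g k j * x $ k))"
          using Xv[of u i] i by (simp add: u_def sum_distrib_left)
        also have "\<dots> = (\<Sum>k<r. \<Sum>j<q. X $$ (i, j) * (g k j * x $ k))" by (rule sum.swap)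
        also have "\<dots> = (\<Sum>k<r. a i k * x $ k)"
          using i by (intro sum.cong refl) (simp add: g sum_distrib_left sum_distrib_right mult_ac)
        finally show "(X *\<^sub>v u) $ i = y $ i" using Zv[OF x(1) i] x(2) by simp
      qed (use x X Z in auto)
      then show ?L by (intro bexI[of _ u]) (auto simp: u_def)
    qed
    then show "col_space X = col_space Z"
      unfolding col_space_eq[OF X] col_space_eq[OF Z] using X Z by auto
  qed
  then have "rank X = rank Z" by (simp add: rank_def col_space_def)
  also have "\<dots> = r" by (rule lin_indpt_full_rank[OF Z dist indpt])
  finally show ?thesis .
qed

section \<open>Singular values and vectors of a factored matrix\<close>

lemma sing_val_eq:
  assumes "X \<in> carrier_mat p q" "k < q"
  shows "sing_val (Suc k) X = sqrt (eigvals (transpose_mat X * X) ! k)"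
proof -
  have "length (eigvals (transpose_mat X * X)) = q"
    using assms(1) by (intro symmetric_spectral) (auto simp: transpose_mult[of _ q p _ q])
  then show ?thesis using assms(2) by (simp add: sing_val_def sing_vals_def eigvals_def)
qed

text \<open>The right singular vectors \<open>w\<close>, their images \<open>xw\<close> under
  \<open>X\<close>, and the squared singular values \<open>d\<close>, as plain functions. The q
  vectors form a full basis, so some of the images may vanish.\<close>

locale gram_eigenbasis =
  fixes p q :: nat and X :: "real mat" and d :: "real list" and w xw :: "nat \<Rightarrow> nat \<Rightarrow> real"
  assumes X: "X \<in> carrier_mat p q"
    and d_def: "d = eigvals (transpose_mat X * X)"
    and d_mono: "\<And>i j. i \<le> j \<Longrightarrow> j < q \<Longrightarrow> d ! j \<le> d ! i"
    and w_orth: "\<And>i j. i < q \<Longrightarrow> j < q \<Longrightarrow> (\<Sum>l<q. w i l * w j l) = delta i j"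
    and w_complete: "\<And>k l. k < q \<Longrightarrow> l < q \<Longrightarrow> (\<Sum>i<q. w i k * w i l) = delta k l"
    and xw_def: "xw = (\<lambda>i l. \<Sum>j<q. X $$ (i, j) * w l j)"
    and gram: "\<And>k l. k < q \<Longrightarrow> l < q \<Longrightarrow> (\<Sum>i<p. xw i k * xw i l) = d ! l * delta k l"

lemma gram_eigenbasis_exists:
  assumes X: "X \<in> carrier_mat p q"
  obtains d w xw where "gram_eigenbasis p q X d w xw"
proof -
  define A where "A = transpose_mat X * X"
  have A: "A \<in> carrier_mat q q" "transpose_mat A = A"
    using X by (auto simp: A_def transpose_mult[of _ q p _ q])
  have Ae: "A $$ (k, l) = (\<Sum>i<p. X $$ (i, k) * X $$ (i, l))" if "k < q" "l < q" for k l
    using that X by (simp add: A_def scalar_prod_def atLeast0LessThan)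
  obtain w where w': "\<forall>i<q. \<forall>j<q. (\<Sum>l<q. w i l * w j l) = delta i j"
    "\<forall>k<q. \<forall>l<q. (\<Sum>i<q. w i k * w i l) = delta k l"
    "\<forall>i<q. \<forall>k<q. (\<Sum>l<q. A $$ (k, l) * w i l) = eigvals A ! i * w i k"
    using symmetric_spectral(3)[OF A] by (elim exE conjE)
  have w: "(\<Sum>l<q. w i l * w j l) = delta i j" "(\<Sum>k<q. w k i * w k j) = delta i j"
    "(\<Sum>l<q. A $$ (j, l) * w i l) = eigvals A ! i * w i j" if "i < q" "j < q" for i j
    using w' that by simp_all
  define xw where "xw = (\<lambda>i l. \<Sum>j<q. X $$ (i, j) * w l j)"
  have gram: "(\<Sum>i<p. xw i k * xw i l) = eigvals A ! l * delta k l" if "k < q" "l < q" for k l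
  proof -
    have "(\<Sum>i<p. xw i k * xw i l) = (\<Sum>i<p. \<Sum>j<q. \<Sum>j'<q. w k j * (X $$ (i, j) * X $$ (i, j') * w l j'))"
      unfolding xw_def sum_product by (intro sum.cong refl) (simp add: mult_ac)
    also have "\<dots> = (\<Sum>j<q. \<Sum>i<p. \<Sum>j'<q. w k j * (X $$ (i, j) * X $$ (i, j') * w l j'))"
      by (rule sum.swap)
    also have "\<dots> = (\<Sum>j<q. \<Sum>j'<q. \<Sum>i<p. w k j * (X $$ (i, j) * X $$ (i, j') * w l j'))"
      by (rule sum.cong[OF refl], rule sum.swap)
    also have "\<dots> = (\<Sum>j<q. w k j * (\<Sum>j'<q. A $$ (j, j') * w l j'))"
    proof (rule sum.cong[OF refl])
      fix j assume j: "j \<in> {..<q}"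
      have "(\<Sum>i<p. w k j * (X $$ (i, j) * X $$ (i, j') * w l j')) = w k j * (A $$ (j, j') * w l j')"
        if "j' \<in> {..<q}" for j'
        using Ae[of j j'] j that by (simp add: sum_distrib_left sum_distrib_right)
      then show "(\<Sum>j'<q. \<Sum>i<p. w k j * (X $$ (i, j) * X $$ (i, j') * w l j')) = w k j * (\<Sum>j'<q. A $$ (j, j') * w l j')"
        by (simp only: sum_distrib_left cong: sum.cong)
    qed
    also have "\<dots> = (\<Sum>j<q. eigvals A ! l * (w k j * w l j))"
      using that by (intro sum.cong refl) (simp add: w(3))
    also have "\<dots> = eigvals A ! l * delta k l"
      using w(1)[OF that] by (simp add: sum_distrib_left[symmetric])
    finally show ?thesis .
  qed
  have "gram_eigenbasis p q X (eigvals A) w xw"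
  proof (rule gram_eigenbasis.intro)
    show "eigvals A = eigvals (transpose_mat X * X)" by (simp only: A_def)
    show "xw = (\<lambda>i l. \<Sum>j<q. X $$ (i, j) * w l j)" by (rule xw_def)
    show "eigvals A ! j \<le> eigvals A ! i" if "i \<le> j" "j < q" for i j
      using symmetric_spectral(2)[OF A] that .
    show "(\<Sum>l<q. w i l * w j l) = delta i j" if "i < q" "j < q" for i j using w(1) that .
    show "(\<Sum>i<q. w i k * w i l) = delta k l" if "k < q" "l < q" for k l using w(2) that .
    show "(\<Sum>i<p. xw i k * xw i l) = eigvals A ! l * delta k l" if "k < q" "l < q" for k l using gram that .
  qed (rule X)
  then show thesis by (rule that)
qed

context gram_eigenbasis
begin

lemma norm_comb:
  assumes "n \<le> q"
  shows "(\<Sum>i<p. (\<Sum>l<n. c l * xw i l)\<^sup>2) = (\<Sum>l<n. (c l)\<^sup>2 * d ! l)"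
proof -
  have "(\<Sum>i<p. (\<Sum>l<n. c l * xw i l)\<^sup>2) = (\<Sum>i<p. \<Sum>k<n. \<Sum>l<n. c k * c l * (xw i k * xw i l))"
    unfolding power2_eq_square sum_product by (intro sum.cong refl) (simp add: mult_ac)
  also have "\<dots> = (\<Sum>k<n. \<Sum>i<p. \<Sum>l<n. c k * c l * (xw i k * xw i l))" by (rule sum.swap)
  also have "\<dots> = (\<Sum>k<n. \<Sum>l<n. \<Sum>i<p. c k * c l * (xw i k * xw i l))" by (rule sum.cong[OF refl], rule sum.swap)
  also have "\<dots> = (\<Sum>k<n. \<Sum>l<n. delta k l * (c k * c l * d ! l))"
    using assms by (intro sum.cong refl) (simp add: sum_distrib_left[symmetric] gram mult_ac)
  also have "\<dots> = (\<Sum>k<n. c k * c k * d ! k)" by (intro sum.cong refl) simp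
  finally show ?thesis by (simp add: power2_eq_square)
qed

lemma d_eq: "l < q \<Longrightarrow> d ! l = (\<Sum>i<p. (xw i l)\<^sup>2)"
  using gram[of l l] by (simp add: delta_def power2_eq_square)

lemma d_nonneg: "l < q \<Longrightarrow> 0 \<le> d ! l"
  by (simp add: d_eq sum_nonneg)

lemma expand: "j < q \<Longrightarrow> z j = (\<Sum>l<q. (\<Sum>i<q. z i * w l i) * w l j)"
proof -
  assume j: "j < q"
  have "(\<Sum>l<q. (\<Sum>i<q. z i * w l i) * w l j) = (\<Sum>l<q. \<Sum>i<q. z i * (w l i * w l j))"
    by (simp add: sum_distrib_left sum_distrib_right mult_ac)
  also have "\<dots> = (\<Sum>i<q. \<Sum>l<q. z i * (w l i * w l j))" by (rule sum.swap)
  also have "\<dots> = (\<Sum>i<q. z i * delta i j)"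
    using j by (simp add: sum_distrib_left[symmetric] w_complete)
  finally show ?thesis using j by simp
qed

lemma parseval: "(\<Sum>j<q. (z j)\<^sup>2) = (\<Sum>l<q. (\<Sum>i<q. z i * w l i)\<^sup>2)"
proof -
  have "(\<Sum>l<q. (\<Sum>i<q. z i * w l i)\<^sup>2) = (\<Sum>l<q. \<Sum>j<q. z j * ((\<Sum>i<q. z i * w l i) * w l j))"
    unfolding power2_eq_square by (intro sum.cong refl) (simp add: sum_distrib_left mult_ac)
  also have "\<dots> = (\<Sum>j<q. \<Sum>l<q. z j * ((\<Sum>i<q. z i * w l i) * w l j))" by (rule sum.swap)
  also have "\<dots> = (\<Sum>j<q. z j * z j)"
    by (intro sum.cong refl) (simp add: sum_distrib_left[symmetric] expand[symmetric])
  finally show ?thesis by (simp add: power2_eq_square)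
qed

lemma apply_expand:
  "(\<Sum>j<q. X $$ (i, j) * z j) = (\<Sum>l<q. (\<Sum>i<q. z i * w l i) * xw i l)"
proof -
  have "(\<Sum>j<q. X $$ (i, j) * z j) = (\<Sum>j<q. X $$ (i, j) * (\<Sum>l<q. (\<Sum>i<q. z i * w l i) * w l j))"
    by (intro sum.cong refl arg_cong2[of _ _ _ _ "(*)"] expand) auto
  also have "\<dots> = (\<Sum>j<q. \<Sum>l<q. (\<Sum>i<q. z i * w l i) * (X $$ (i, j) * w l j))"
    by (simp add: sum_distrib_left mult_ac)
  also have "\<dots> = (\<Sum>l<q. \<Sum>j<q. (\<Sum>i<q. z i * w l i) * (X $$ (i, j) * w l j))" by (rule sum.swap)
  finally show ?thesis by (simp add: xw_def sum_distrib_left)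
qed

lemma trace: "(\<Sum>l<q. d ! l) = (\<Sum>i<p. \<Sum>j<q. (X $$ (i, j))\<^sup>2)"
proof -
  have "(\<Sum>l<q. d ! l) = (\<Sum>l<q. \<Sum>i<p. (\<Sum>j<q. X $$ (i, j) * w l j)\<^sup>2)"
    by (simp add: d_eq xw_def)
  also have "\<dots> = (\<Sum>i<p. \<Sum>l<q. (\<Sum>j<q. X $$ (i, j) * w l j)\<^sup>2)" by (rule sum.swap)
  finally show ?thesis by (simp add: parseval[symmetric])
qed

end

lemma L2_set_cauchy_schwarz: "(\<Sum>k\<in>A. f k * g k) \<le> L2_set f A * L2_set g A"
proof -
  have "(\<Sum>k\<in>A. f k * g k) \<le> (\<Sum>k\<in>A. \<bar>f k\<bar> * \<bar>g k\<bar>)"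
    by (intro sum_mono) (metis abs_ge_self abs_mult)
  then show ?thesis using L2_set_mult_ineq[of f g A] by linarith
qed

text \<open>\<open>X\<close> is the product of \<open>a\<close> and the transpose of
  \<open>b\<close>, with lower bounds for the singular values of both. Separate constants \<alpha>
  and \<beta> allow the nearly isometric factor to stand on either side.\<close>

locale factored = gram_eigenbasis p q X d w xw
  for p q X d w xw +
  fixes r :: nat and a b :: "nat \<Rightarrow> nat \<Rightarrow> real" and \<alpha> \<beta> t :: real
  assumes fac: "\<And>i j. i < p \<Longrightarrow> j < q \<Longrightarrow> X $$ (i, j) = (\<Sum>k<r. a i k * b j k)"
    and a_inj: "\<And>y. \<alpha> * L2_set y {..<r} \<le> L2_set (\<lambda>i. \<Sum>k<r. a i k * y k) {..<p}"
    and b_inj: "\<And>y. \<beta> * L2_set y {..<r} \<le> L2_set (\<lambda>j. \<Sum>k<r. b j k * y k) {..<q}"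
    and pos: "0 < \<alpha>" "0 < \<beta>" "0 < t" "t \<le> \<alpha> * \<beta>" and r: "1 \<le> r" "r \<le> q"
begin

lemma apply_fac: "i < p \<Longrightarrow> (\<Sum>j<q. X $$ (i, j) * z j) = (\<Sum>k<r. a i k * (\<Sum>j<q. b j k * z j))"
proof -
  assume i: "i < p"
  have "(\<Sum>j<q. X $$ (i, j) * z j) = (\<Sum>j<q. \<Sum>k<r. a i k * (b j k * z j))"
    using i by (intro sum.cong refl) (simp add: fac sum_distrib_left sum_distrib_right mult_ac)
  also have "\<dots> = (\<Sum>k<r. \<Sum>j<q. a i k * (b j k * z j))" by (rule sum.swap)
  finally show ?thesis by (simp add: sum_distrib_left)
qed

text \<open>Min-max argument: the range of \<open>b\<close> has dimension r > i, so it contains a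
  nonzero z orthogonal to the first i eigenvectors. Then |X z|^2 <= d_i |z|^2, while |X z| >=
  \<alpha> |b^T z| >= \<alpha> \<beta> |z|.\<close>

lemma d_large:
  assumes i: "i < r"
  shows "t\<^sup>2 \<le> d ! i"
proof -
  obtain y where y: "\<exists>k<r. y k \<noteq> 0" "\<And>l. l < i \<Longrightarrow> (\<Sum>k<r. (\<Sum>j<q. b j k * w l j) * y k) = 0"
    by (rule homogeneous_system_nontrivial[OF i, of "\<lambda>l k. \<Sum>j<q. b j k * w l j"]) blast
  define z where "z = (\<lambda>j. \<Sum>k<r. b j k * y k)"
  define c where "c = (\<lambda>l. \<Sum>j<q. z j * w l j)"
  define u where "u = (\<lambda>k. \<Sum>j<q. b j k * z j)"
  define ny nz nu where "ny = L2_set y {..<r}" and "nz = L2_set z {..<q}" and "nu = L2_set u {..<r}"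
  have c0: "c l = 0" if "l < i" for l
  proof -
    have "c l = (\<Sum>j<q. \<Sum>k<r. b j k * w l j * y k)"
      unfolding c_def z_def by (simp add: sum_distrib_left sum_distrib_right mult_ac)
    also have "\<dots> = (\<Sum>k<r. \<Sum>j<q. b j k * w l j * y k)" by (rule sum.swap)
    finally show ?thesis using y(2)[OF that] by (simp add: sum_distrib_right)
  qed
  have ny: "0 < ny" unfolding ny_def using y(1) by (auto simp: less_le L2_set_eq_0_iff)
  have nz: "\<beta> * ny \<le> nz" using b_inj[of y] by (simp add: ny_def nz_def z_def)
  have "0 < \<beta> * ny" using ny pos by simp
  then have nz0: "0 < nz" using nz by linarith
  \<comment> \<open>The bound for \<open>b\<close> passes to its transpose on the range of
    \<open>b\<close>: |z|^2 = <b^T z, y> <= |b^T z| |y|, and |y| <= |z| / \<beta>.\<close>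
  have "nz\<^sup>2 = (\<Sum>k<r. u k * y k)"
  proof -
    have "nz\<^sup>2 = (\<Sum>j<q. (z j)\<^sup>2)" by (simp add: nz_def L2_set_sq)
    also have "\<dots> = (\<Sum>j<q. z j * z j)" by (simp only: power2_eq_square)
    also have "\<dots> = (\<Sum>j<q. \<Sum>k<r. b j k * z j * y k)"
    proof (rule sum.cong[OF refl])
      fix j
      have "(\<Sum>k<r. b j k * z j * y k) = (\<Sum>k<r. b j k * y k) * z j"
        by (simp add: sum_distrib_left sum_distrib_right mult_ac)
      also have "\<dots> = z j * z j" unfolding z_def ..
      finally show "z j * z j = (\<Sum>k<r. b j k * z j * y k)" ..
    qed
    also have "\<dots> = (\<Sum>k<r. \<Sum>j<q. b j k * z j * y k)" by (rule sum.swap)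
    finally show ?thesis by (simp add: u_def sum_distrib_right)
  qed
  also have "\<dots> \<le> nu * ny" unfolding nu_def ny_def by (rule L2_set_cauchy_schwarz)
  finally have uy: "nz * nz \<le> nu * ny" by (simp only: power2_eq_square)
  have "\<beta> * nz * ny = nz * (\<beta> * ny)" by simp
  also have "\<dots> \<le> nz * nz" using nz nz0 by (intro mult_left_mono) auto
  also note uy
  finally have nu: "\<beta> * nz \<le> nu" using ny by simp
  define Xz where "Xz = (\<lambda>i. \<Sum>j<q. X $$ (i, j) * z j)"
  have "\<alpha> * nu \<le> L2_set (\<lambda>i. \<Sum>k<r. a i k * u k) {..<p}" unfolding nu_def by (rule a_inj)
  also have "\<dots> = L2_set Xz {..<p}" unfolding Xz_def by (intro L2_set_cong) (simp_all add: apply_fac u_def)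
  finally have au: "\<alpha> * nu \<le> L2_set Xz {..<p}" .
  have "t * nz \<le> \<alpha> * \<beta> * nz" using pos nz0 by (intro mult_right_mono) auto
  also have "\<dots> = \<alpha> * (\<beta> * nz)" by simp
  also have "\<dots> \<le> \<alpha> * nu" using nu pos by (intro mult_left_mono) auto
  also note au
  finally have "t * nz \<le> L2_set Xz {..<p}" .
  then have "(t * nz)\<^sup>2 \<le> (L2_set Xz {..<p})\<^sup>2" using pos nz0 by (intro power_mono) auto
  also have "\<dots> = (\<Sum>i<p. (\<Sum>l<q. c l * xw i l)\<^sup>2)"
    unfolding L2_set_sq Xz_def apply_expand c_def ..
  also have "\<dots> = (\<Sum>l<q. (c l)\<^sup>2 * d ! l)" by (rule norm_comb) simp
  also have "\<dots> \<le> (\<Sum>l<q. (c l)\<^sup>2 * d ! i)"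
  proof (intro sum_mono)
    fix l assume l: "l \<in> {..<q}"
    show "(c l)\<^sup>2 * d ! l \<le> (c l)\<^sup>2 * d ! i"
      using c0[of l] d_mono[of i l] l by (cases "l < i") (auto intro: mult_left_mono)
  qed
  also have "\<dots> = nz\<^sup>2 * d ! i"
  proof -
    have "nz\<^sup>2 = (\<Sum>l<q. (c l)\<^sup>2)" unfolding nz_def L2_set_sq c_def by (rule parseval)
    then show ?thesis by (simp add: sum_distrib_right)
  qed
  finally have "t\<^sup>2 * nz\<^sup>2 \<le> d ! i * nz\<^sup>2" by (simp add: power_mult_distrib mult.commute)
  then show ?thesis using nz0 by simp
qed

text \<open>Some nontrivial combination of the first r + 1 eigenvectors is killed by the transpose
  of \<open>b\<close>, hence by \<open>X\<close>. The images are orthogonal, so one of these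
  eigenvalues is 0, and monotonicity takes care of index i.\<close>

lemma d_zero:
  assumes i: "r \<le> i" "i < q"
  shows "d ! i = 0"
proof -
  obtain c where c: "\<exists>l<Suc r. c l \<noteq> 0" "\<And>k. k < r \<Longrightarrow> (\<Sum>l<Suc r. (\<Sum>j<q. b j k * w l j) * c l) = 0"
    by (rule homogeneous_system_nontrivial[of r "Suc r" "\<lambda>k l. \<Sum>j<q. b j k * w l j"]) auto
  have rq: "Suc r \<le> q" using i by simp
  have "(\<Sum>l<Suc r. c l * xw i l) = 0" if "i < p" for i
  proof -
    have "(\<Sum>l<Suc r. c l * xw i l) = (\<Sum>l<Suc r. \<Sum>k<r. a i k * ((\<Sum>j<q. b j k * w l j) * c l))"
      unfolding xw_def apply_fac[OF that] by (simp add: sum_distrib_left mult_ac del: sum.lessThan_Suc)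
    also have "\<dots> = (\<Sum>k<r. \<Sum>l<Suc r. a i k * ((\<Sum>j<q. b j k * w l j) * c l))" by (rule sum.swap)
    also have "\<dots> = 0" unfolding sum_distrib_left[symmetric] using c(2) by simp
    finally show ?thesis .
  qed
  then have "(\<Sum>l<Suc r. (c l)\<^sup>2 * d ! l) = 0" unfolding norm_comb[OF rq, symmetric] by simp
  moreover have "0 \<le> (c l)\<^sup>2 * d ! l" if "l < Suc r" for l using d_nonneg that rq by simp
  ultimately have "\<forall>l<Suc r. (c l)\<^sup>2 * d ! l = 0"
    by (subst (asm) sum_nonneg_eq_0_iff) auto
  then obtain l where "l < Suc r" "d ! l = 0" using c(1) by auto
  then have "d ! i \<le> 0" using d_mono[of l i] i by simp
  then show ?thesis using d_nonneg[of i] i by simp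
qed

definition u :: "nat \<Rightarrow> nat \<Rightarrow> real" where
  "u i k = xw i k / sqrt (d ! k)"

lemma d_pos: "k < r \<Longrightarrow> 0 < d ! k"
  using d_large[of k] pos by (smt (verit) zero_less_power2)

lemma u_orth: "k < r \<Longrightarrow> l < r \<Longrightarrow> (\<Sum>i<p. u i k * u i l) = delta k l"
proof -
  assume kl: "k < r" "l < r"
  have "(\<Sum>i<p. u i k * u i l) = (\<Sum>i<p. xw i k * xw i l) / (sqrt (d ! k) * sqrt (d ! l))"
    by (simp add: u_def sum_divide_distrib)
  also have "\<dots> = d ! l * delta k l / (sqrt (d ! k) * sqrt (d ! l))" using kl r by (simp add: gram)
  also have "\<dots> = delta k l" using d_pos[OF kl(1)] by (auto simp: delta_def)
  finally show ?thesis .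
qed

lemma svd: "i < p \<Longrightarrow> j < q \<Longrightarrow> X $$ (i, j) = (\<Sum>k<r. u i k * (sqrt (d ! k) * w k j))"
proof -
  assume i: "i < p" and j: "j < q"
  have z: "xw i k = 0" if "k \<in> {..<q} - {..<r}" for k
  proof -
    have "(\<Sum>i<p. (xw i k)\<^sup>2) = 0" using d_zero[of k] d_eq[of k] that by auto
    then show ?thesis using i by (simp add: sum_nonneg_eq_0_iff)
  qed
  have "(\<Sum>k<r. u i k * (sqrt (d ! k) * w k j)) = (\<Sum>k<r. xw i k * w k j)"
  proof (rule sum.cong[OF refl])
    fix k assume "k \<in> {..<r}"
    then have "sqrt (d ! k) \<noteq> 0" using d_pos[of k] by simp
    then show "u i k * (sqrt (d ! k) * w k j) = xw i k * w k j" by (simp add: u_def)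
  qed
  also have "\<dots> = (\<Sum>k<q. xw i k * w k j)" using r z by (intro sum.mono_neutral_left) auto
  also have "\<dots> = (\<Sum>k<q. \<Sum>j'<q. X $$ (i, j') * (w k j' * w k j))"
    by (simp add: xw_def sum_distrib_left sum_distrib_right mult_ac)
  also have "\<dots> = (\<Sum>j'<q. \<Sum>k<q. X $$ (i, j') * (w k j' * w k j))" by (rule sum.swap)
  also have "\<dots> = X $$ (i, j)" using j by (simp add: sum_distrib_left[symmetric] w_complete)
  finally show ?thesis by simp
qed

text \<open>Ensures that the choices in \<open>left_sing_vecs\<close> and
  \<open>right_sing_vecs\<close> pick genuine singular vectors of this \<open>X\<close>.\<close>

lemma compact_svd_exists: "\<exists>U V. compact_svd r X U V"
proof -
  define U where "U = mat p r (\<lambda>(i, k). u i k)"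
  define V where "V = mat q r (\<lambda>(j, k). w k j)"
  have "U \<in> orthonormal_cols p r"
    unfolding orthonormal_cols_def
    by (auto simp: U_def scalar_prod_def atLeast0LessThan u_orth delta_def intro!: eq_matI)
  moreover have "V \<in> orthonormal_cols q r"
    unfolding orthonormal_cols_def using r
    by (auto simp: V_def scalar_prod_def atLeast0LessThan w_orth delta_def intro!: eq_matI)
  moreover have "X = U * mat_diag r (\<lambda>i. sing_val (Suc i) X) * transpose_mat V"
  proof (rule eq_matI)
    fix i j assume "i < dim_row (U * mat_diag r (\<lambda>i. sing_val (Suc i) X) * transpose_mat V)"
      "j < dim_col (U * mat_diag r (\<lambda>i. sing_val (Suc i) X) * transpose_mat V)"
    then have ij: "i < p" "j < q" by (simp_all add: U_def V_def)
    have "U * mat_diag r (\<lambda>i. sing_val (Suc i) X) = mat p r (\<lambda>(i, k). u i k * sqrt (d ! k))"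
      using r by (subst mat_diag_mult_right[of _ p r]) (auto simp: U_def sing_val_eq[OF X] d_def intro!: eq_matI)
    then have "(U * mat_diag r (\<lambda>i. sing_val (Suc i) X) * transpose_mat V) $$ (i, j) = (\<Sum>k<r. u i k * sqrt (d ! k) * w k j)"
      using ij by (simp add: V_def scalar_prod_def atLeast0LessThan)
    then show "X $$ (i, j) = (U * mat_diag r (\<lambda>i. sing_val (Suc i) X) * transpose_mat V) $$ (i, j)"
      using svd[OF ij] by (simp add: mult.assoc)
  qed (use X in \<open>simp_all add: U_def V_def\<close>)
  ultimately show ?thesis using X by (auto simp: compact_svd_def)
qed

lemma in_low_rank_class: "X \<in> low_rank_class p q r t"
proof -
  have "vec_space.rank p X = r"
  proof (rule rank_eq_of_factor[OF X])
    show "X $$ (i, j) = (\<Sum>k<r. u i k * (sqrt (d ! k) * w k j))" if "i < p" "j < q" for i j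
      using svd that .
    show "\<forall>k<r. c k = 0" if c: "\<And>i. i < p \<Longrightarrow> (\<Sum>k<r. u i k * c k) = 0" for c
    proof -
      have "(\<Sum>k<r. (c k / sqrt (d ! k))\<^sup>2 * d ! k) = (\<Sum>i<p. (\<Sum>k<r. (c k / sqrt (d ! k)) * xw i k)\<^sup>2)"
        using r by (intro norm_comb[symmetric])
      also have "\<dots> = (\<Sum>i<p. (\<Sum>k<r. u i k * c k)\<^sup>2)" by (simp add: u_def mult.commute)
      also have "\<dots> = 0" using c by simp
      finally have "(\<Sum>k<r. (c k / sqrt (d ! k))\<^sup>2 * d ! k) = 0" .
      moreover have "(c k / sqrt (d ! k))\<^sup>2 * d ! k = (c k)\<^sup>2" if "k < r" for k
        using d_pos[OF that] by (simp add: power_divide)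
      ultimately have "(\<Sum>k<r. (c k)\<^sup>2) = 0" by simp
      then show ?thesis by (simp add: sum_nonneg_eq_0_iff)
    qed
    show "\<exists>g. \<forall>i<p. u i k = (\<Sum>j<q. X $$ (i, j) * g j)" if "k < r" for k
      by (rule exI[of _ "\<lambda>j. w k j / sqrt (d ! k)"]) (unfold u_def, unfold xw_def, simp add: sum_divide_distrib)
  qed
  moreover have "t \<le> sing_val r X"
  proof -
    have "sing_val r X = sqrt (d ! (r - 1))"
      using sing_val_eq[OF X, of "r - 1"] r by (simp add: d_def)
    moreover have "t \<le> sqrt (d ! (r - 1))" using d_large[of "r - 1"] r pos by (intro real_le_rsqrt) auto
    ultimately show ?thesis by simp
  qed
  ultimately show ?thesis using X by (simp add: low_rank_class_def)
qed

end

section \<open>Complementary projections and the sin Theta distance\<close>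

definition orth :: "nat \<Rightarrow> nat \<Rightarrow> (nat \<Rightarrow> nat \<Rightarrow> real) \<Rightarrow> bool" where
  "orth q r V \<longleftrightarrow> (\<forall>c<r. \<forall>c'<r. (\<Sum>j<q. V j c * V j c') = delta c c')"

definition proj_compl :: "nat \<Rightarrow> (nat \<Rightarrow> nat \<Rightarrow> real) \<Rightarrow> nat \<Rightarrow> nat \<Rightarrow> real" where
  "proj_compl r V j l = delta j l - (\<Sum>c<r. V j c * V l c)"

text \<open>Agrees with \<open>resid\<close> for M = \<open>proj_compl r V\<close> and the prior's
  \<open>W T\<close>, but is free of the prior, so that it can be compared with sin Theta.\<close>

definition col_loss :: "nat \<Rightarrow> nat \<Rightarrow> (nat \<Rightarrow> nat \<Rightarrow> real) \<Rightarrow> (nat \<Rightarrow> nat \<Rightarrow> real) \<Rightarrow> real" where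
  "col_loss q r V W = (\<Sum>j<q. \<Sum>k<r. (\<Sum>l<q. proj_compl r V j l * W l k)\<^sup>2)"

lemma orth_sum_sq:
  assumes "orth q r V"
  shows "(\<Sum>j<q. (\<Sum>c<r. V j c * x c)\<^sup>2) = (\<Sum>c<r. (x c)\<^sup>2)"
proof -
  have "(\<Sum>j<q. (\<Sum>c<r. V j c * x c)\<^sup>2) = (\<Sum>j<q. \<Sum>c<r. \<Sum>c'<r. x c * x c' * (V j c * V j c'))"
    unfolding power2_eq_square sum_product by (intro sum.cong refl) (simp add: mult_ac)
  also have "\<dots> = (\<Sum>c<r. \<Sum>j<q. \<Sum>c'<r. x c * x c' * (V j c * V j c'))" by (rule sum.swap)
  also have "\<dots> = (\<Sum>c<r. \<Sum>c'<r. \<Sum>j<q. x c * x c' * (V j c * V j c'))"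
    by (rule sum.cong[OF refl], rule sum.swap)
  also have "\<dots> = (\<Sum>c<r. \<Sum>c'<r. delta c c' * (x c * x c'))"
    using assms by (intro sum.cong refl) (simp add: orth_def sum_distrib_left[symmetric])
  also have "\<dots> = (\<Sum>c<r. x c * x c)" by (intro sum.cong refl) simp
  finally show ?thesis by (simp add: power2_eq_square)
qed

lemma proj_compl_apply:
  assumes "j < q"
  shows "(\<Sum>l<q. proj_compl r V j l * z l) = z j - (\<Sum>c<r. V j c * (\<Sum>l<q. V l c * z l))"
proof -
  have "(\<Sum>l<q. (\<Sum>c<r. V j c * V l c) * z l) = (\<Sum>l<q. \<Sum>c<r. V j c * (V l c * z l))"
    by (simp add: sum_distrib_right mult.assoc)
  also have "\<dots> = (\<Sum>c<r. \<Sum>l<q. V j c * (V l c * z l))" by (rule sum.swap)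
  also have "\<dots> = (\<Sum>c<r. V j c * (\<Sum>l<q. V l c * z l))" by (simp add: sum_distrib_left)
  finally show ?thesis unfolding proj_compl_def left_diff_distrib sum_subtractf using assms by simp
qed

lemma proj_compl_norm:
  assumes "orth q r V"
  shows "(\<Sum>j<q. (\<Sum>l<q. proj_compl r V j l * z l)\<^sup>2) = (\<Sum>j<q. (z j)\<^sup>2) - (\<Sum>c<r. (\<Sum>l<q. V l c * z l)\<^sup>2)"
proof -
  define y where "y = (\<lambda>c. \<Sum>l<q. V l c * z l)"
  have cross: "(\<Sum>j<q. z j * (\<Sum>c<r. V j c * y c)) = (\<Sum>c<r. (y c)\<^sup>2)"
  proof -
    have "(\<Sum>j<q. z j * (\<Sum>c<r. V j c * y c)) = (\<Sum>j<q. \<Sum>c<r. y c * (V j c * z j))"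
      by (simp add: sum_distrib_left mult_ac)
    also have "\<dots> = (\<Sum>c<r. \<Sum>j<q. y c * (V j c * z j))" by (rule sum.swap)
    also have "\<dots> = (\<Sum>c<r. y c * y c)" unfolding sum_distrib_left[symmetric] by (simp only: y_def)
    finally show ?thesis by (simp only: power2_eq_square)
  qed
  have "(\<Sum>j<q. (\<Sum>l<q. proj_compl r V j l * z l)\<^sup>2) = (\<Sum>j<q. (z j - (\<Sum>c<r. V j c * y c))\<^sup>2)"
    by (intro sum.cong refl) (simp add: proj_compl_apply y_def)
  also have "\<dots> = (\<Sum>j<q. (z j)\<^sup>2) + (\<Sum>j<q. (\<Sum>c<r. V j c * y c)\<^sup>2) - 2 * (\<Sum>j<q. z j * (\<Sum>c<r. V j c * y c))"
    unfolding power2_diff by (simp add: sum.distrib sum_subtractf sum_distrib_left mult.assoc)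
  also have "\<dots> = (\<Sum>j<q. (z j)\<^sup>2) - (\<Sum>c<r. (y c)\<^sup>2)"
    unfolding cross orth_sum_sq[OF assms] by simp
  finally show ?thesis by (simp only: y_def)
qed

lemma orth_bessel:
  assumes "orth q r V"
  shows "(\<Sum>c<r. (\<Sum>l<q. V l c * z l)\<^sup>2) \<le> (\<Sum>j<q. (z j)\<^sup>2)"
proof -
  have "0 \<le> (\<Sum>j<q. (\<Sum>l<q. proj_compl r V j l * z l)\<^sup>2)" by (simp add: sum_nonneg)
  then show ?thesis unfolding proj_compl_norm[OF assms] by simp
qed

lemma projection_proj_compl:
  assumes V: "orth q r V"
  shows "projection q r (proj_compl r V)"
proof
  show sym: "proj_compl r V j l = proj_compl r V l j" for j l
    by (simp add: proj_compl_def delta_def mult.commute)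
  show "(\<Sum>i<q. proj_compl r V j i * proj_compl r V i l) = proj_compl r V j l" if "j < q" "l < q" for j l
  proof -
    have kill: "(\<Sum>i<q. V i c * proj_compl r V i l) = 0" if "c < r" for c
    proof -
      have "(\<Sum>i<q. V i c * proj_compl r V i l) = (\<Sum>i<q. proj_compl r V l i * V i c)"
        by (intro sum.cong refl) (subst sym, simp)
      also have "\<dots> = V l c - (\<Sum>c'<r. V l c' * (\<Sum>i<q. V i c' * V i c))"
        using \<open>l < q\<close> by (rule proj_compl_apply)
      also have "(\<Sum>c'<r. V l c' * (\<Sum>i<q. V i c' * V i c)) = (\<Sum>c'<r. V l c' * delta c' c)"
        using V that by (intro sum.cong refl) (simp add: orth_def)
      also have "\<dots> = V l c" using that by simp
      finally show ?thesis by simp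
    qed
    show ?thesis unfolding proj_compl_apply[OF that(1)] using kill by simp
  qed
  have "(\<Sum>j<q. proj_compl r V j j) = (\<Sum>j<q. 1) - (\<Sum>j<q. \<Sum>c<r. V j c * V j c)"
    by (simp add: proj_compl_def delta_def sum_subtractf)
  also have "(\<Sum>j<q. \<Sum>c<r. V j c * V j c) = (\<Sum>c<r. \<Sum>j<q. V j c * V j c)" by (rule sum.swap)
  also have "\<dots> = (\<Sum>c<r. 1)" using V by (intro sum.cong refl) (simp add: orth_def delta_def)
  finally show "(\<Sum>j<q. proj_compl r V j j) = real q - real r" by simp
  show "(\<Sum>j<q. (\<Sum>l<q. proj_compl r V j l * v l)\<^sup>2) \<le> (\<Sum>l<q. (v l)\<^sup>2)" for v
    unfolding proj_compl_norm[OF V] by (simp add: sum_nonneg)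
qed

text \<open>Here W = S N with N = S^T W, so the loss is the squared norm of E N with E = (I - V V^T)
  S. Multiplication by N costs at most a factor 2, and |E|_F^2 = r - |V^T S|_F^2.\<close>

lemma subspace_loss:
  assumes S: "orth q r S" and V: "orth q r V"
    and span: "\<And>l k. l < q \<Longrightarrow> k < r \<Longrightarrow> W l k = (\<Sum>j<q. (\<Sum>c<r. S j c * S l c) * W j k)"
    and W: "\<And>x. L2_set (\<lambda>j. \<Sum>k<r. W j k * x k) {..<q} \<le> sqrt 2 * L2_set x {..<r}"
  shows "col_loss q r V W \<le> 2 * (real r - (\<Sum>c<r. \<Sum>k<r. (\<Sum>j<q. V j c * S j k)\<^sup>2))"
proof -
  define N where "N = (\<lambda>c k. \<Sum>j<q. S j c * W j k)"
  have WN: "W l k = (\<Sum>c<r. S l c * N c k)" if "l < q" "k < r" for l k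
  proof -
    have "W l k = (\<Sum>j<q. \<Sum>c<r. S l c * (S j c * W j k))"
      unfolding span[OF that] by (simp add: sum_distrib_left sum_distrib_right mult_ac)
    also have "\<dots> = (\<Sum>c<r. \<Sum>j<q. S l c * (S j c * W j k))" by (rule sum.swap)
    finally show ?thesis by (simp add: N_def sum_distrib_left)
  qed
  define E where "E = (\<lambda>j c. \<Sum>l<q. proj_compl r V j l * S l c)"
  have EN: "(\<Sum>l<q. proj_compl r V j l * W l k) = (\<Sum>c<r. E j c * N c k)" if "k < r" for j k
  proof -
    have "(\<Sum>l<q. proj_compl r V j l * W l k) = (\<Sum>l<q. \<Sum>c<r. proj_compl r V j l * S l c * N c k)"
      using that by (intro sum.cong refl) (simp add: WN sum_distrib_left mult.assoc)
    also have "\<dots> = (\<Sum>c<r. \<Sum>l<q. proj_compl r V j l * S l c * N c k)" by (rule sum.swap)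
    finally show ?thesis by (simp add: E_def sum_distrib_right)
  qed
  \<comment> \<open>The hypothesis controls N acting on columns, but rows of E need its transpose.
    By duality, h = x N satisfies |h|^2 = <x, N h> <= sqrt 2 |x| |h|.\<close>
  have row: "(\<Sum>k<r. (\<Sum>c<r. x c * N c k)\<^sup>2) \<le> 2 * (\<Sum>c<r. (x c)\<^sup>2)" for x
  proof -
    define h where "h = (\<lambda>k. \<Sum>c<r. x c * N c k)"
    define y where "y = (\<lambda>c. \<Sum>k<r. N c k * h k)"
    define nh nx where "nh = L2_set h {..<r}" and "nx = L2_set x {..<r}"
    have yW: "y c = (\<Sum>j<q. S j c * (\<Sum>k<r. W j k * h k))" for c
    proof -
      have "y c = (\<Sum>k<r. \<Sum>j<q. S j c * (W j k * h k))"
        by (simp add: y_def N_def sum_distrib_right mult.assoc)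
      also have "\<dots> = (\<Sum>j<q. \<Sum>k<r. S j c * (W j k * h k))" by (rule sum.swap)
      finally show ?thesis by (simp add: sum_distrib_left)
    qed
    have "L2_set y {..<r} \<le> L2_set (\<lambda>j. \<Sum>k<r. W j k * h k) {..<q}"
      unfolding L2_set_def yW by (intro real_sqrt_le_mono orth_bessel[OF S])
    also have "\<dots> \<le> sqrt 2 * nh" unfolding nh_def by (rule W)
    finally have ny: "L2_set y {..<r} \<le> sqrt 2 * nh" .
    have "nh\<^sup>2 = (\<Sum>k<r. h k * h k)" unfolding nh_def L2_set_sq by (simp only: power2_eq_square)
    also have "\<dots> = (\<Sum>k<r. \<Sum>c<r. x c * (N c k * h k))"
    proof (rule sum.cong[OF refl])
      fix k
      have "(\<Sum>c<r. x c * (N c k * h k)) = (\<Sum>c<r. x c * N c k) * h k"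
        by (simp add: sum_distrib_right mult.assoc)
      also have "\<dots> = h k * h k" unfolding h_def ..
      finally show "h k * h k = (\<Sum>c<r. x c * (N c k * h k))" ..
    qed
    also have "\<dots> = (\<Sum>c<r. \<Sum>k<r. x c * (N c k * h k))" by (rule sum.swap)
    also have "\<dots> = (\<Sum>c<r. x c * y c)" by (simp add: y_def sum_distrib_left)
    also have "\<dots> \<le> nx * L2_set y {..<r}" unfolding nx_def by (rule L2_set_cauchy_schwarz)
    also have "\<dots> \<le> nx * (sqrt 2 * nh)" using ny by (intro mult_left_mono) (auto simp: nx_def)
    finally have "nh * nh \<le> sqrt 2 * nx * nh" by (simp add: power2_eq_square mult_ac)
    moreover have "0 \<le> nh" "0 \<le> nx" by (simp_all add: nh_def nx_def)
    ultimately have "nh \<le> sqrt 2 * nx" by (cases "nh = 0") auto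
    then have "nh\<^sup>2 \<le> (sqrt 2 * nx)\<^sup>2" using \<open>0 \<le> nh\<close> by (intro power_mono) auto
    then show ?thesis by (simp add: nh_def nx_def L2_set_sq h_def power_mult_distrib)
  qed
  have "col_loss q r V W = (\<Sum>j<q. \<Sum>k<r. (\<Sum>c<r. E j c * N c k)\<^sup>2)"
    unfolding col_loss_def by (intro sum.cong refl) (simp add: EN)
  also have "\<dots> \<le> (\<Sum>j<q. 2 * (\<Sum>c<r. (E j c)\<^sup>2))" by (intro sum_mono row)
  also have "\<dots> = 2 * (\<Sum>j<q. \<Sum>c<r. (E j c)\<^sup>2)" by (simp add: sum_distrib_left)
  also have "(\<Sum>j<q. \<Sum>c<r. (E j c)\<^sup>2) = (\<Sum>c<r. \<Sum>j<q. (E j c)\<^sup>2)" by (rule sum.swap)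
  also have "\<dots> = (\<Sum>k<r. (\<Sum>j<q. (S j k)\<^sup>2) - (\<Sum>c<r. (\<Sum>l<q. V l c * S l k)\<^sup>2))"
    unfolding E_def by (intro sum.cong refl proj_compl_norm[OF V])
  also have "\<dots> = (\<Sum>k<r. 1 - (\<Sum>c<r. (\<Sum>l<q. V l c * S l k)\<^sup>2))"
    using S by (intro sum.cong refl) (simp add: orth_def delta_def power2_eq_square)
  also have "\<dots> = real r - (\<Sum>k<r. \<Sum>c<r. (\<Sum>l<q. V l c * S l k)\<^sup>2)" by (simp add: sum_subtractf)
  also have "(\<Sum>k<r. \<Sum>c<r. (\<Sum>l<q. V l c * S l k)\<^sup>2) = (\<Sum>c<r. \<Sum>k<r. (\<Sum>l<q. V l c * S l k)\<^sup>2)"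
    by (rule sum.swap)
  finally show ?thesis .
qed

lemma orthonormal_cols_orth:
  assumes "V \<in> orthonormal_cols q r"
  shows "orth q r (\<lambda>j c. V $$ (j, c))"
  unfolding orth_def
proof (intro allI impI)
  fix c c' assume c: "c < r" "c' < r"
  have V: "V \<in> carrier_mat q r" "transpose_mat V * V = 1\<^sub>m r" using assms by (auto simp: orthonormal_cols_def)
  have "(transpose_mat V * V) $$ (c, c') = (\<Sum>j<q. V $$ (j, c) * V $$ (j, c'))"
    using V(1) c by (simp add: scalar_prod_def atLeast0LessThan)
  then show "(\<Sum>j<q. V $$ (j, c) * V $$ (j, c')) = delta c c'" unfolding V(2) using c by (simp add: delta_def)
qed

text \<open>The squared cosines are the eigenvalues \<open>d\<close> of the Gram matrix of S^T V,
  whose trace is a squared Frobenius norm. The spectral norm dominates every sine, hence their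
  quadratic mean.\<close>

lemma sin_Theta_norms:
  assumes S: "S \<in> orthonormal_cols q r" and V: "V \<in> orthonormal_cols q r"
  defines "L \<equiv> real r - (\<Sum>c<r. \<Sum>k<r. (\<Sum>j<q. V $$ (j, c) * S $$ (j, k))\<^sup>2)"
  shows "(frobenius_norm (sin_Theta S V))\<^sup>2 = L"
    and "L \<le> real r * (spectral_norm (sin_Theta S V))\<^sup>2"
proof -
  have Sc: "S \<in> carrier_mat q r" and Vc: "V \<in> carrier_mat q r"
    using S V by (auto simp: orthonormal_cols_def)
  note oS = orthonormal_cols_orth[OF S] and oV = orthonormal_cols_orth[OF V]
  define C where "C = transpose_mat S * V"
  have C: "C \<in> carrier_mat r r" using Sc Vc by (simp add: C_def)
  have Ce: "C $$ (k, c) = (\<Sum>j<q. S $$ (j, k) * V $$ (j, c))" if "k < r" "c < r" for k c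
    using that Sc Vc by (simp add: C_def scalar_prod_def atLeast0LessThan)
  obtain d w xw where "gram_eigenbasis r r C d w xw" by (rule gram_eigenbasis_exists[OF C])
  then interpret gram_eigenbasis r r C d w xw .
  \<comment> \<open>Places the singular values in the domain where sin (arccos x) = sqrt (1 - x^2)
    holds.\<close>
  have d1: "d ! l \<le> 1" if l: "l < r" for l
  proof -
    define z where "z = (\<lambda>j. \<Sum>c<r. V $$ (j, c) * w l c)"
    have "xw i l = (\<Sum>j<q. S $$ (j, i) * z j)" if i: "i < r" for i
    proof -
      have "xw i l = (\<Sum>c<r. \<Sum>j<q. S $$ (j, i) * (V $$ (j, c) * w l c))"
        unfolding xw_def using i by (intro sum.cong refl) (simp add: Ce sum_distrib_right mult.assoc)
      also have "\<dots> = (\<Sum>j<q. \<Sum>c<r. S $$ (j, i) * (V $$ (j, c) * w l c))" by (rule sum.swap)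
      finally show ?thesis by (simp add: z_def sum_distrib_left)
    qed
    then have "d ! l = (\<Sum>i<r. (\<Sum>j<q. S $$ (j, i) * z j)\<^sup>2)" unfolding d_eq[OF l] by simp
    also have "\<dots> \<le> (\<Sum>j<q. (z j)\<^sup>2)" by (rule orth_bessel[OF oS])
    also have "\<dots> = (\<Sum>c<r. (w l c)\<^sup>2)" unfolding z_def by (rule orth_sum_sq[OF oV])
    also have "\<dots> = 1" using w_orth[OF l l] by (simp add: delta_def power2_eq_square)
    finally show ?thesis .
  qed
  define f where "f = (\<lambda>i. sqrt (1 - d ! i))"
  have sT: "sin_Theta S V = mat_diag r f"
  proof (rule eq_matI)
    fix i j assume "i < dim_row (mat_diag r f)" "j < dim_col (mat_diag r f)"
    then have ij: "i < r" "j < r" by (simp_all add: mat_diag_def)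
    have "sing_val (Suc i) (transpose_mat S * V) = sqrt (d ! i)"
      unfolding C_def[symmetric] d_def by (rule sing_val_eq[OF C ij(1)])
    moreover have "sin (arccos (sqrt (d ! i))) = f i"
    proof -
      have "- 1 \<le> sqrt (d ! i)" using real_sqrt_ge_zero[OF d_nonneg[OF ij(1)]] by linarith
      then show ?thesis using d_nonneg[OF ij(1)] d1[OF ij(1)] by (subst sin_arccos) (auto simp: f_def)
    qed
    ultimately show "sin_Theta S V $$ (i, j) = mat_diag r f $$ (i, j)"
      using ij Sc by (auto simp: sin_Theta_def Theta_def mat_diag_def)
  qed (use Sc in \<open>simp_all add: sin_Theta_def mat_diag_def\<close>)
  have fsq: "(f i)\<^sup>2 = 1 - d ! i" if "i < r" for i using d1[OF that] by (simp add: f_def)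
  have dsum: "(\<Sum>i<r. d ! i) = (\<Sum>c<r. \<Sum>k<r. (\<Sum>j<q. V $$ (j, c) * S $$ (j, k))\<^sup>2)"
  proof -
    have "(\<Sum>i<r. d ! i) = (\<Sum>k<r. \<Sum>c<r. (\<Sum>j<q. V $$ (j, c) * S $$ (j, k))\<^sup>2)"
      unfolding trace by (intro sum.cong refl) (simp add: Ce mult.commute)
    also have "\<dots> = (\<Sum>c<r. \<Sum>k<r. (\<Sum>j<q. V $$ (j, c) * S $$ (j, k))\<^sup>2)" by (rule sum.swap)
    finally show ?thesis .
  qed
  have L: "L = (\<Sum>i<r. (f i)\<^sup>2)" by (simp add: L_def dsum[symmetric] fsq sum_subtractf)
  have "(\<Sum>i<r. \<Sum>j<r. (mat_diag r f $$ (i, j))\<^sup>2) = (\<Sum>i<r. \<Sum>j<r. delta i j * (f j)\<^sup>2)"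
    by (intro sum.cong refl) (auto simp: mat_diag_def delta_def)
  also have "\<dots> = (\<Sum>i<r. (f i)\<^sup>2)" by (intro sum.cong refl) simp
  finally show "(frobenius_norm (sin_Theta S V))\<^sup>2 = L"
    unfolding sT frobenius_norm_def L by (simp add: mat_diag_def sum_nonneg)
  have app: "(mat_diag r f *\<^sub>v v) $ i = f i * v $ i" if "v \<in> carrier_vec r" "i < r" for v i
  proof -
    have "(mat_diag r f *\<^sub>v v) $ i = (\<Sum>j<r. delta i j * (f j * v $ j))"
      using that by (auto simp: mat_diag_def scalar_prod_def atLeast0LessThan delta_def intro!: sum.cong)
    then show ?thesis using that by simp
  qed
  define nrm where "nrm = (\<lambda>v. sqrt (scalar_prod (mat_diag r f *\<^sub>v v) (mat_diag r f *\<^sub>v v)))"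
  define B where "B = {v \<in> carrier_vec r. scalar_prod v v \<le> (1::real)}"
  have nrm_eq: "nrm v = sqrt (\<Sum>i<r. (f i * v $ i)\<^sup>2)" if "v \<in> carrier_vec r" for v
  proof -
    have "scalar_prod (mat_diag r f *\<^sub>v v) (mat_diag r f *\<^sub>v v) = (\<Sum>i<r. (f i * v $ i)\<^sup>2)"
      using app[OF that] by (simp add: scalar_prod_def atLeast0LessThan power2_eq_square mat_diag_def)
    then show ?thesis by (simp add: nrm_def)
  qed
  \<comment> \<open>\<open>spectral_norm\<close> is a supremum of reals, so it dominates its members
    only once boundedness is known.\<close>
  have bdd: "bdd_above (nrm ` B)"
  proof (rule bdd_aboveI2)
    fix v assume v: "v \<in> B"
    then have vc: "v \<in> carrier_vec r" and v1: "(\<Sum>i<r. (v $ i)\<^sup>2) \<le> 1"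
      by (auto simp: B_def scalar_prod_def atLeast0LessThan power2_eq_square)
    have "(\<Sum>i<r. (f i * v $ i)\<^sup>2) \<le> (\<Sum>i<r. (v $ i)\<^sup>2)"
    proof (rule sum_mono)
      fix i assume "i \<in> {..<r}"
      then have "(f i)\<^sup>2 \<le> 1" using fsq d_nonneg by simp
      then show "(f i * v $ i)\<^sup>2 \<le> (v $ i)\<^sup>2" by (simp add: power_mult_distrib mult_left_le_one_le)
    qed
    then show "nrm v \<le> 1" unfolding nrm_eq[OF vc] using v1 by simp
  qed
  have spec: "spectral_norm (sin_Theta S V) = Sup (nrm ` B)"
    unfolding sT spectral_norm_def nrm_def B_def by (simp add: mat_diag_def)
  have "\<bar>f i\<bar> \<le> spectral_norm (sin_Theta S V)" if i: "i < r" for i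
  proof -
    have "unit_vec r i \<in> B" using i by (simp add: B_def)
    then have "nrm (unit_vec r i) \<le> Sup (nrm ` B)" using bdd by (intro cSUP_upper)
    moreover have "nrm (unit_vec r i) = \<bar>f i\<bar>"
    proof -
      have "(\<Sum>k<r. (f k * unit_vec r i $ k)\<^sup>2) = (\<Sum>k<r. delta i k * (f k)\<^sup>2)"
        using i by (intro sum.cong refl) (auto simp: delta_def)
      then show ?thesis using i by (simp add: nrm_eq)
    qed
    ultimately show ?thesis unfolding spec by simp
  qed
  then have "(f i)\<^sup>2 \<le> (spectral_norm (sin_Theta S V))\<^sup>2" if "i < r" for i
    using that by (metis abs_ge_zero power2_abs power_mono)
  then have "(\<Sum>i<r. (f i)\<^sup>2) \<le> (\<Sum>i<r. (spectral_norm (sin_Theta S V))\<^sup>2)" by (intro sum_mono) simp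
  then show "L \<le> real r * (spectral_norm (sin_Theta S V))\<^sup>2" unfolding L by simp
qed

text \<open>The singular subspaces absorb \<open>X\<close>: X V V^T = X and U U^T X = X. With
  orthonormality this is all that enters about the chosen vectors, so the choice among them is
  immaterial.\<close>

lemma compact_svd_projections:
  assumes X: "X \<in> carrier_mat p q" and svd: "compact_svd r X U V"
  shows "U \<in> orthonormal_cols p r" "V \<in> orthonormal_cols q r"
    and "i < p \<Longrightarrow> l < q \<Longrightarrow> (\<Sum>j<q. X $$ (i, j) * (\<Sum>c<r. V $$ (j, c) * V $$ (l, c))) = X $$ (i, l)"
    and "i < p \<Longrightarrow> l < q \<Longrightarrow> (\<Sum>j<p. (\<Sum>c<r. U $$ (i, c) * U $$ (j, c)) * X $$ (j, l)) = X $$ (i, l)"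
proof -
  show U: "U \<in> orthonormal_cols p r" and V: "V \<in> orthonormal_cols q r"
    using svd X by (auto simp: compact_svd_def)
  define D where "D = mat_diag r (\<lambda>i. sing_val (Suc i) X)"
  have D: "D \<in> carrier_mat r r" by (simp add: D_def)
  have Uc: "U \<in> carrier_mat p r" "transpose_mat U * U = 1\<^sub>m r"
    and Vc: "V \<in> carrier_mat q r" "transpose_mat V * V = 1\<^sub>m r"
    using U V by (auto simp: orthonormal_cols_def)
  have XD: "X = U * D * transpose_mat V" using svd by (simp add: compact_svd_def D_def)
  have "transpose_mat V * (V * transpose_mat V) = transpose_mat V * V * transpose_mat V"
    using Vc(1) by (intro assoc_mult_mat[symmetric, of _ r q _ r _ q]) auto
  also have "\<dots> = transpose_mat V" unfolding Vc(2) using Vc(1) by simp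
  finally have VVV: "transpose_mat V * (V * transpose_mat V) = transpose_mat V" .
  have "X * (V * transpose_mat V) = U * D * (transpose_mat V * (V * transpose_mat V))"
    unfolding XD using Uc(1) Vc(1) D by (intro assoc_mult_mat[of _ p r _ q _ q]) auto
  then have 1: "X * (V * transpose_mat V) = X" unfolding VVV XD[symmetric] .
  have "(U * transpose_mat U) * X = U * (transpose_mat U * U) * (D * transpose_mat V)"
    unfolding XD using Uc(1) Vc(1) D
    by (simp add: assoc_mult_mat[of _ p r _ p _ q] assoc_mult_mat[of _ p r _ r _ q] assoc_mult_mat[of _ r p _ r _ q])
  also have "\<dots> = X" unfolding Uc(2) using XD Uc(1) Vc(1) D by (simp add: assoc_mult_mat[of _ p r _ r _ q])
  finally have 2: "(U * transpose_mat U) * X = X" .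
  show "(\<Sum>j<q. X $$ (i, j) * (\<Sum>c<r. V $$ (j, c) * V $$ (l, c))) = X $$ (i, l)" if "i < p" "l < q"
  proof -
    have "(X * (V * transpose_mat V)) $$ (i, l) = (\<Sum>j<q. X $$ (i, j) * (\<Sum>c<r. V $$ (j, c) * V $$ (l, c)))"
      using that X Vc by (simp add: scalar_prod_def atLeast0LessThan)
    then show ?thesis unfolding 1 by simp
  qed
  show "(\<Sum>j<p. (\<Sum>c<r. U $$ (i, c) * U $$ (j, c)) * X $$ (j, l)) = X $$ (i, l)" if "i < p" "l < q"
  proof -
    define P where "P = U * transpose_mat U"
    have P: "P \<in> carrier_mat p p" using Uc(1) by (simp add: P_def)
    have Pe: "P $$ (i, j) = (\<Sum>c<r. U $$ (i, c) * U $$ (j, c))" if "j < p" for j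
      using that \<open>i < p\<close> Uc(1) by (simp add: P_def scalar_prod_def atLeast0LessThan)
    have "(P * X) $$ (i, l) = (\<Sum>j<p. P $$ (i, j) * X $$ (j, l))"
      using that X P by (simp add: scalar_prod_def atLeast0LessThan)
    then show ?thesis using 2 by (simp add: P_def[symmetric] Pe)
  qed
qed

context factored
begin

lemma a_zero: "(\<And>i. i < p \<Longrightarrow> (\<Sum>k<r. a i k * g k) = 0) \<Longrightarrow> k < r \<Longrightarrow> g k = 0"
proof -
  assume z: "\<And>i. i < p \<Longrightarrow> (\<Sum>k<r. a i k * g k) = 0" and k: "k < r"
  have "L2_set (\<lambda>i. \<Sum>k<r. a i k * g k) {..<p} = 0" using z by (simp add: L2_set_eq_0_iff)
  then have "\<alpha> * L2_set g {..<r} \<le> 0" using a_inj[of g] by simp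
  then have "L2_set g {..<r} = 0" using pos L2_set_nonneg[of g "{..<r}"] by (simp add: mult_le_0_iff)
  then show ?thesis using k by (simp add: L2_set_eq_0_iff)
qed

lemma b_zero: "(\<And>j. j < q \<Longrightarrow> (\<Sum>k<r. b j k * g k) = 0) \<Longrightarrow> k < r \<Longrightarrow> g k = 0"
proof -
  assume z: "\<And>j. j < q \<Longrightarrow> (\<Sum>k<r. b j k * g k) = 0" and k: "k < r"
  have "L2_set (\<lambda>j. \<Sum>k<r. b j k * g k) {..<q} = 0" using z by (simp add: L2_set_eq_0_iff)
  then have "\<beta> * L2_set g {..<r} \<le> 0" using b_inj[of g] by simp
  then have "L2_set g {..<r} = 0" using pos L2_set_nonneg[of g "{..<r}"] by (simp add: mult_le_0_iff)
  then show ?thesis using k by (simp add: L2_set_eq_0_iff)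
qed

text \<open>In X V V^T = X the injective factor \<open>a\<close> can be cancelled, which leaves V
  V^T b = b: the columns of \<open>b\<close> lie in the right singular space.\<close>

lemma right_sing_vecs_span:
  shows "right_sing_vecs r X \<in> orthonormal_cols q r"
    and "l < q \<Longrightarrow> k < r \<Longrightarrow> b l k = (\<Sum>j<q. (\<Sum>c<r. right_sing_vecs r X $$ (j, c) * right_sing_vecs r X $$ (l, c)) * b j k)"
proof -
  define V where "V = right_sing_vecs r X"
  have "\<exists>V U. compact_svd r X U V" using compact_svd_exists by blast
  then have "\<exists>U. compact_svd r X U V" unfolding V_def right_sing_vecs_def by (rule someI_ex)
  then obtain U where svd: "compact_svd r X U V" by blast
  show "right_sing_vecs r X \<in> orthonormal_cols q r"
    using compact_svd_projections(2)[OF X svd] by (simp add: V_def)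
  show "b l k = (\<Sum>j<q. (\<Sum>c<r. right_sing_vecs r X $$ (j, c) * right_sing_vecs r X $$ (l, c)) * b j k)"
    if l: "l < q" and k: "k < r"
  proof -
    define P where "P = (\<lambda>j. \<Sum>c<r. V $$ (j, c) * V $$ (l, c))"
    have "(\<Sum>j<q. b j k * P j) - b l k = 0"
    proof (rule a_zero[OF _ k])
      fix i assume i: "i < p"
      have "(\<Sum>k<r. a i k * ((\<Sum>j<q. b j k * P j) - b l k)) = (\<Sum>j<q. X $$ (i, j) * P j) - X $$ (i, l)"
        unfolding apply_fac[OF i] fac[OF i l] by (simp add: right_diff_distrib sum_subtractf)
      also have "\<dots> = 0" using compact_svd_projections(3)[OF X svd i l] by (simp add: P_def)
      finally show "(\<Sum>k<r. a i k * ((\<Sum>j<q. b j k * P j) - b l k)) = 0" .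
    qed
    then show ?thesis by (simp add: P_def V_def mult.commute)
  qed
qed

lemma left_sing_vecs_span:
  shows "left_sing_vecs r X \<in> orthonormal_cols p r"
    and "i < p \<Longrightarrow> k < r \<Longrightarrow> a i k = (\<Sum>j<p. (\<Sum>c<r. left_sing_vecs r X $$ (j, c) * left_sing_vecs r X $$ (i, c)) * a j k)"
proof -
  define U where "U = left_sing_vecs r X"
  have "\<exists>V. compact_svd r X U V" unfolding U_def left_sing_vecs_def using compact_svd_exists by (rule someI_ex)
  then obtain V where svd: "compact_svd r X U V" by blast
  show "left_sing_vecs r X \<in> orthonormal_cols p r"
    using compact_svd_projections(1)[OF X svd] by (simp add: U_def)
  show "a i k = (\<Sum>j<p. (\<Sum>c<r. left_sing_vecs r X $$ (j, c) * left_sing_vecs r X $$ (i, c)) * a j k)"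
    if i: "i < p" and k: "k < r"
  proof -
    define P where "P = (\<lambda>j. \<Sum>c<r. U $$ (i, c) * U $$ (j, c))"
    have "(\<Sum>j<p. P j * a j k) - a i k = 0"
    proof (rule b_zero[OF _ k])
      fix l assume l: "l < q"
      have "(\<Sum>j<p. P j * X $$ (j, l)) = (\<Sum>j<p. \<Sum>k<r. b l k * (P j * a j k))"
        using l by (intro sum.cong refl) (simp add: fac sum_distrib_left mult_ac)
      also have "\<dots> = (\<Sum>k<r. \<Sum>j<p. b l k * (P j * a j k))" by (rule sum.swap)
      finally have "(\<Sum>k<r. b l k * ((\<Sum>j<p. P j * a j k) - a i k)) = (\<Sum>j<p. P j * X $$ (j, l)) - X $$ (i, l)"
        unfolding fac[OF i l] by (simp add: right_diff_distrib sum_subtractf sum_distrib_left mult_ac)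
      also have "\<dots> = 0" using compact_svd_projections(4)[OF X svd i l] by (simp add: P_def)
      finally show "(\<Sum>k<r. b l k * ((\<Sum>j<p. P j * a j k) - a i k)) = 0" .
    qed
    then show ?thesis by (simp add: P_def U_def mult.commute)
  qed
qed

end

section \<open>The minimax lower bound\<close>

lemma integral_le_nn_integral: "ennreal (\<integral>x. f x \<partial>M) \<le> (\<integral>\<^sup>+ x. ennreal (f x) \<partial>M)"
  if "\<And>x. 0 \<le> f x" for f :: "'a \<Rightarrow> real"
proof (cases "integrable M f")
  case True
  then show ?thesis using nn_integral_eq_integral[OF True] that by simp
qed (simp add: not_integrable_integral_eq)

text \<open>The factors are: \<open>38400\<close> from the choice of \<open>e\<^sup>2\<close> and from \<open>n \<ge> p / 2\<close>, \<open>m \<ge> q / 2\<close>;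
  \<open>64\<close> from the Bayes risk; and \<open>2 \<cdot> 15360168\<close> from the number \<open>s\<close> of random columns.\<close>

definition rate_const :: real where
  "rate_const = 1 / (38400 * 64 * 2 * 15360168)"

lemma rate_const_pos: "0 < rate_const"
  by (simp add: rate_const_def)

definition risk_bound :: "nat \<Rightarrow> nat \<Rightarrow> nat \<Rightarrow> real \<Rightarrow> real" where
  "risk_bound p q r t = rate_const * min (q * r * (t\<^sup>2 + p) / t ^ 4) r"

definition noisy :: "nat \<Rightarrow> nat \<Rightarrow> nat \<Rightarrow> (nat \<Rightarrow> nat \<Rightarrow> real) \<Rightarrow> (nat \<Rightarrow> nat \<Rightarrow> real) \<Rightarrow>
    (nat \<times> nat \<Rightarrow> real) \<Rightarrow> nat \<times> nat \<Rightarrow> real" where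
  "noisy p q r G W z = (\<lambda>x\<in>{..<p} \<times> {..<q}. (\<Sum>k<r. G (fst x) k * W (snd x) k) + z x)"

text \<open>15360168 is the ratio of rows to columns that \<open>sign_mats_lower\<close> demands. If
  \<open>r\<close> is too small for a fixed fraction of it, one random column suffices.\<close>

lemma active_rank_exists:
  assumes "1 \<le> r" "r \<le> n"
  obtains s where "1 \<le> s" "s \<le> r" "s = 1 \<or> 15360168 * s \<le> n" "real r \<le> 2 * 15360168 * real s"
proof (cases "r < 2 * 15360168")
  case True
  then have "real r \<le> 2 * 15360168 * real 1" by simp
  then show thesis using that[of 1] assms by simp
next
  case False
  define s where "s = r div 15360168"
  have s1: "1 \<le> s" using False by (simp add: s_def)
  have le: "15360168 * s \<le> r" by (simp add: s_def)
  have "r < 15360168 * s + 15360168"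
    using mod_less_divisor[of 15360168 r] div_mult_mod_eq[of r 15360168] by (simp add: s_def)
  then have "r \<le> 2 * 15360168 * s" using s1 by simp
  then have "real r \<le> real (2 * 15360168 * s)" by (rule of_nat_mono)
  then show thesis using that[of s] s1 le assms by simp
qed

text \<open>\<open>G\<close> and \<open>W\<close> are known only through the norm bounds that
  \<open>factored\<close> and \<open>subspace_loss\<close> need. The factor \<kappa> rescales the
  loss for the two norms, and measurability is exported for the change of variables under
  transposition.\<close>

lemma core_lower:
  fixes p q r :: nat and t :: real and V :: "(nat \<times> nat \<Rightarrow> real) \<Rightarrow> nat \<Rightarrow> nat \<Rightarrow> real"
  assumes r: "1 \<le> r" "2 * r \<le> p" "2 * r \<le> q" and t: "0 < t"
    and V: "\<And>y. orth q r (V y)"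
    and meas: "\<And>j c. j < q \<Longrightarrow> c < r \<Longrightarrow> (\<lambda>y. V y j c) \<in> borel_measurable (PiM ({..<p} \<times> {..<q}) (\<lambda>_. borel))"
  obtains G W where
    "\<And>x. t * L2_set x {..<r} \<le> L2_set (\<lambda>i. \<Sum>k<r. G i k * x k) {..<p}"
    "\<And>x. 1 * L2_set x {..<r} \<le> L2_set (\<lambda>j. \<Sum>k<r. W j k * x k) {..<q}"
    "\<And>x. L2_set (\<lambda>j. \<Sum>k<r. W j k * x k) {..<q} \<le> sqrt 2 * L2_set x {..<r}"
    "\<And>\<kappa>. 0 \<le> \<kappa> \<Longrightarrow> (\<lambda>z. ennreal (\<kappa> * col_loss q r (V (noisy p q r G W z)) W))
       \<in> borel_measurable (gauss ({..<p} \<times> {..<q}))"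
    "\<And>\<kappa>. 0 \<le> \<kappa> \<Longrightarrow> ennreal (\<kappa> * risk_bound p q r t) \<le>
      (\<integral>\<^sup>+ z. ennreal (\<kappa> * col_loss q r (V (noisy p q r G W z)) W) \<partial>gauss ({..<p} \<times> {..<q}))"
proof -
  define n m where "n = p - r" and "m = q - r"
  have n: "r \<le> n" "real n \<ge> real p / 2" and m: "r \<le> m" "real m \<ge> real q / 2"
    using r by (auto simp: n_def m_def)
  have n0: "0 < real n" and m0: "0 < real m" using n m r by auto
  obtain s where sr: "1 \<le> s" "s \<le> r" "s = 1 \<or> 15360168 * s \<le> n" "real r \<le> 2 * 15360168 * real s"
    by (rule active_rank_exists[OF r(1) n(1)])
  \<comment> \<open>\<open>goodR_G\<close> gives \<open>G\<close> the singular value bound sqrt n /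
    2, so this scale yields exactly t.\<close>
  define a where "a = 2 * t / sqrt n"
  \<comment> \<open>The first term secures \<open>e_small\<close>, the second the affinity
    condition: 9600 = 75 * 128, and \<open>key\<close> below provides 32 / 128 = 1/4.\<close>
  define b where "b = min (1 / (1536 * m)) ((n + t\<^sup>2) / (9600 * t ^ 4))"
  define e where "e = sqrt b"
  have b0: "0 < b" unfolding b_def using n0 m0 t by (simp add: add_pos_pos)
  have e2: "e\<^sup>2 = b" using b0 by (simp add: e_def)
  have a2: "a\<^sup>2 = 4 * t\<^sup>2 / n" using n0 by (simp add: a_def power_divide power_mult_distrib)
  have a4: "a ^ 4 = 16 * t ^ 4 / (real n)\<^sup>2"
  proof -
    have "a ^ 4 = (a\<^sup>2)\<^sup>2" by simp
    then show ?thesis unfolding a2 by (simp add: power_divide power_mult_distrib)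
  qed
  interpret sign_prior p q r s a e
  proof
    show "0 < a" using t n0 by (simp add: a_def)
    show "0 < e" using b0 by (simp add: e_def)
    have "b * (1536 * m) \<le> 1 / (1536 * m) * (1536 * m)" unfolding b_def using m0 by (intro mult_right_mono) auto
    then show "1536 * e\<^sup>2 * real (q - r) \<le> 1" using m0 by (simp add: e2 m_def[symmetric] mult_ac)
  qed (use r sr in auto)
  have cond: "75 * real (p - r) * (e\<^sup>2 * min (a\<^sup>2) (a ^ 4)) \<le> 1/4"
  proof -
    \<comment> \<open>The second power of \<open>a\<close> is used if n <= t^2 and the fourth
      otherwise, with n + t^2 at most twice the larger term.\<close>
    have key: "n * min (a\<^sup>2) (a ^ 4) * (n + t\<^sup>2) \<le> 32 * t ^ 4"
    proof (cases "real n \<le> t\<^sup>2")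
      case True
      have "n * min (a\<^sup>2) (a ^ 4) * (n + t\<^sup>2) \<le> n * a\<^sup>2 * (2 * t\<^sup>2)"
        using True by (intro mult_mono) auto
      also have "\<dots> = 8 * t ^ 4" unfolding a2 using n0 by (simp add: power2_eq_square power4_eq_xxxx)
      also have "\<dots> \<le> 32 * t ^ 4" by simp
      finally show ?thesis .
    next
      case False
      have "n * min (a\<^sup>2) (a ^ 4) * (n + t\<^sup>2) \<le> n * a ^ 4 * (2 * n)"
        using False by (intro mult_mono) auto
      also have "\<dots> = 32 * t ^ 4" unfolding a4 using n0 by (simp add: power2_eq_square)
      finally show ?thesis .
    qed
    have "75 * real n * (b * min (a\<^sup>2) (a ^ 4)) = 75 * (n * min (a\<^sup>2) (a ^ 4)) * b" by simp
    also have "\<dots> \<le> 75 * (n * min (a\<^sup>2) (a ^ 4)) * ((n + t\<^sup>2) / (9600 * t ^ 4))"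
      unfolding b_def by (intro mult_left_mono) auto
    also have "\<dots> = n * min (a\<^sup>2) (a ^ 4) * (n + t\<^sup>2) / (128 * t ^ 4)" by simp
    also have "\<dots> \<le> 32 * t ^ 4 / (128 * t ^ 4)" using key t by (intro divide_right_mono) auto
    also have "\<dots> = 1/4" using t by simp
    finally show ?thesis by (simp add: e2 n_def)
  qed
  then have cond': "real (75 * (p - r)) * (e\<^sup>2 * min (a\<^sup>2) (a ^ 4)) \<le> 1/4" by simp
  have sets_eq: "sets (PiM ({..<p} \<times> {..<q}) (\<lambda>_. borel :: real measure)) = sets (gauss ({..<p} \<times> {..<q}))"
    by (rule sets_PiM_cong) auto
  have pm: "(\<lambda>y. proj_compl r (V y) j l) \<in> borel_measurable (PiM ({..<p} \<times> {..<q}) (\<lambda>_. borel))"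
    if "j < q" "l < q" for j l
    unfolding proj_compl_def using meas that
    by (intro borel_measurable_diff borel_measurable_const borel_measurable_sum borel_measurable_times) auto
  have pm': "(\<lambda>y. proj_compl r (V y) j l) \<in> borel_measurable (gauss (P \<times> Q))" if "j < q" "l < q" for j l
    using pm[OF that] measurable_cong_sets[OF sets_eq refl] by blast
  obtain T R where TR: "goodT T" "goodR R" "e\<^sup>2 * real (q - r) * s / 64 \<le>
    (\<integral>y. tilt (P \<times> Q) (X T R) y * resid (proj_compl r (V y)) T \<partial>gauss (P \<times> Q))"
    using bayes_risk_lower[OF cond', of "\<lambda>y. proj_compl r (V y)"] sr(3) projection_proj_compl[OF V] pm'
    unfolding n_def by blast
  have rate: "risk_bound p q r t \<le> e\<^sup>2 * real (q - r) * s / 64"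
  proof -
    define Rt where "Rt = q * (t\<^sup>2 + p) / t ^ 4"
    have "x + p \<le> 2 * (n + x)" if "0 \<le> x" for x :: real using n(2) that by simp
    then have "t\<^sup>2 + p \<le> 2 * (n + t\<^sup>2)" by simp
    then have "q * (t\<^sup>2 + p) \<le> 2 * m * (2 * (n + t\<^sup>2))"
      using m by (intro mult_mono) auto
    then have "Rt \<le> 2 * m * (2 * (n + t\<^sup>2)) / t ^ 4"
      unfolding Rt_def using t by (intro divide_right_mono) auto
    then have "Rt / 38400 \<le> 2 * m * (2 * (n + t\<^sup>2)) / t ^ 4 / 38400" by simp
    also have "\<dots> = m * ((n + t\<^sup>2) / (9600 * t ^ 4))"
    proof -
      have "real (2 * m) * (2 * x) / y / 38400 = m * (x / (9600 * y))" for x y :: real by simp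
      then show ?thesis .
    qed
    finally have "Rt / 38400 \<le> m * ((n + t\<^sup>2) / (9600 * t ^ 4))" .
    moreover have "1 / 38400 \<le> m * (1 / (1536 * m))" using m0 by simp
    ultimately have "min Rt 1 / 38400 \<le> m * b"
      unfolding b_def by (cases "1 / (1536 * m) \<le> (n + t\<^sup>2) / (9600 * t ^ 4)") (auto simp: min_def)
    then have "min Rt 1 / 38400 * (real r / (2 * 15360168)) \<le> m * b * s"
      using sr(4) b0 m0 by (intro mult_mono) auto
    moreover have "min (q * r * (t\<^sup>2 + p) / t ^ 4) r = min Rt 1 * r"
      unfolding Rt_def using min_mult_distrib_right[of "q * (t\<^sup>2 + p) / t ^ 4" 1 "real r"] by (simp add: mult_ac)
    ultimately show ?thesis unfolding risk_bound_def rate_const_def e2 m_def by (simp add: mult_ac)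
  qed
  define G' where "G' = (\<lambda>i k. a * G R i k)"
  have XG: "(\<lambda>x\<in>P \<times> Q. X T R x + z x) = noisy p q r G' (W T) z" for z
    unfolding noisy_def by (rule restrict_ext) (auto simp: X_eq G'_def sum_distrib_left mult.assoc)
  define F where "F = (\<lambda>\<kappa> y. ennreal (\<kappa> * col_loss q r (V y) (W T)))"
  have F: "F \<kappa> \<in> borel_measurable (PiM (P \<times> Q) (\<lambda>_. borel))" for \<kappa>
    unfolding F_def col_loss_def using pm
    by (intro measurable_compose[OF _ measurable_ennreal] borel_measurable_times borel_measurable_const
        borel_measurable_sum borel_measurable_power) auto
  show thesis
  proof (rule that[of G' "W T"])
    show "t * L2_set x {..<r} \<le> L2_set (\<lambda>i. \<Sum>k<r. G' i k * x k) {..<p}" for x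
    proof -
      have "t * L2_set x {..<r} = a * (sqrt n / 2 * L2_set x {..<r})" using n0 by (simp add: a_def)
      also have "\<dots> \<le> a * L2_set (\<lambda>i. \<Sum>k<r. G R i k * x k) {..<p}"
        using goodR_G[OF TR(2), of x] a by (intro mult_left_mono) (auto simp: n_def)
      also have "\<dots> = L2_set (\<lambda>i. a * (\<Sum>k<r. G R i k * x k)) {..<p}" unfolding L2_set_scale using a by simp
      finally show ?thesis by (simp add: G'_def sum_distrib_left mult.assoc)
    qed
    show "1 * L2_set x {..<r} \<le> L2_set (\<lambda>j. \<Sum>k<r. W T j k * x k) {..<q}" for x
      using goodT_W(1)[OF TR(1)] by simp
    show "L2_set (\<lambda>j. \<Sum>k<r. W T j k * x k) {..<q} \<le> sqrt 2 * L2_set x {..<r}" for x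
      by (rule goodT_W(2)[OF TR(1)])
    have sh: "(\<lambda>z. \<lambda>x\<in>P \<times> Q. X T R x + z x) \<in> measurable (gauss (P \<times> Q)) (PiM (P \<times> Q) (\<lambda>_. borel))"
      by (rule measurable_restrict) measurable
    show "(\<lambda>z. ennreal (\<kappa> * col_loss q r (V (noisy p q r G' (W T) z)) (W T)))
       \<in> borel_measurable (gauss ({..<p} \<times> {..<q}))" for \<kappa>
      using measurable_compose[OF sh F[of \<kappa>]] unfolding F_def XG .
    fix \<kappa> :: real assume \<kappa>: "0 \<le> \<kappa>"
    have "ennreal (\<kappa> * risk_bound p q r t) \<le>
        ennreal (\<kappa> * (\<integral>y. tilt (P \<times> Q) (X T R) y * resid (proj_compl r (V y)) T \<partial>gauss (P \<times> Q)))"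
      using rate TR(3) \<kappa> by (intro ennreal_leI mult_left_mono) auto
    also have "\<dots> = ennreal (\<integral>y. \<kappa> * (tilt (P \<times> Q) (X T R) y * resid (proj_compl r (V y)) T) \<partial>gauss (P \<times> Q))"
      by simp
    also have "\<dots> \<le> (\<integral>\<^sup>+ y. ennreal (\<kappa> * (tilt (P \<times> Q) (X T R) y * resid (proj_compl r (V y)) T)) \<partial>gauss (P \<times> Q))"
      using \<kappa> resid_nonneg by (intro integral_le_nn_integral) auto
    also have "\<dots> = (\<integral>\<^sup>+ y. ennreal (tilt (P \<times> Q) (X T R) y) * F \<kappa> y \<partial>gauss (P \<times> Q))"
      using \<kappa> by (intro nn_integral_cong) (simp add: F_def col_loss_def resid_def ennreal_mult'[symmetric] mult_ac)
    also have "\<dots> = (\<integral>\<^sup>+ z. F \<kappa> (\<lambda>x\<in>P \<times> Q. X T R x + z x) \<partial>gauss (P \<times> Q))"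
      by (rule nn_integral_gauss_shift[symmetric, OF _ F]) simp
    finally show "ennreal (\<kappa> * risk_bound p q r t) \<le>
      (\<integral>\<^sup>+ z. ennreal (\<kappa> * col_loss q r (V (noisy p q r G' (W T) z)) (W T)) \<partial>gauss ({..<p} \<times> {..<q}))"
      unfolding F_def XG .
  qed
qed

section \<open>The Gaussian law as a member of the noise class\<close>

lemma cosh_ge: "1 + x\<^sup>2 / 2 \<le> cosh (x::real)"
proof -
  have "(\<Sum>n<2. (x\<^sup>2) ^ n / fact (2 * n)) \<le> (\<Sum>n. (x\<^sup>2) ^ n / fact (2 * n))"
    using sums_summable[OF cosh_sums_even[of x]] by (intro sum_le_suminf) auto
  then show ?thesis using sums_unique[OF cosh_sums_even[of x]] by (simp add: numeral_2_eq_2)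
qed

text \<open>Unit variance makes the symmetrised moment generating function at least 1 + s^2 / 2, and
  membership makes it at most exp (\<tau> s^2). For \<tau> < 1/2 these contradict each other at
  small s.\<close>

lemma subgaussian_class_half_le:
  assumes \<tau>: "0 < \<tau>" and ne: "subgaussian_class \<tau> \<noteq> {}"
  shows "1/2 \<le> \<tau>"
proof (rule ccontr)
  assume "\<not> 1/2 \<le> \<tau>"
  then have lt: "\<tau> < 1/2" by simp
  obtain \<mu> where \<mu>: "\<mu> \<in> subgaussian_class \<tau>" using ne by blast
  then interpret prob_space \<mu> by (simp add: subgaussian_class_def)
  have i2: "integrable \<mu> (\<lambda>x. x\<^sup>2)" and v: "(\<integral>x. x\<^sup>2 \<partial>\<mu>) = 1"
    and ei: "integrable \<mu> (\<lambda>x. exp (s * x))" and el: "(\<integral>x. exp (s * x) \<partial>\<mu>) \<le> exp (\<tau> * s\<^sup>2)" for s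
    using \<mu> by (auto simp: subgaussian_class_def)
  have le: "1 + s\<^sup>2 / 2 \<le> exp (\<tau> * s\<^sup>2)" for s
  proof -
    have "1 + s\<^sup>2 / 2 = (\<integral>x. 1 + s\<^sup>2 / 2 * x\<^sup>2 \<partial>\<mu>)" using i2 v by (simp add: prob_space)
    also have "\<dots> \<le> (\<integral>x. (exp (s * x) + exp (- s * x)) / 2 \<partial>\<mu>)"
    proof (rule integral_mono)
      show "1 + s\<^sup>2 / 2 * x\<^sup>2 \<le> (exp (s * x) + exp (- s * x)) / 2" for x
        using cosh_ge[of "s * x"] by (simp add: cosh_def power_mult_distrib)
    qed (use i2 ei[of s] ei[of "- s"] in auto)
    also have "\<dots> = ((\<integral>x. exp (s * x) \<partial>\<mu>) + (\<integral>x. exp (- s * x) \<partial>\<mu>)) / 2"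
      using ei[of s] ei[of "- s"] by simp
    also have "\<dots> \<le> exp (\<tau> * s\<^sup>2)" using el[of s] el[of "- s"] by simp
    finally show ?thesis .
  qed
  \<comment> \<open>u plays the part of s^2: the first bound makes exp (\<tau> u) <= 1 + \<tau> u +
    (\<tau> u)^2 available, the second keeps the quadratic term below half of the gap (1/2 - \<tau>)
    u.\<close>
  define u where "u = min (1 / \<tau>) ((1/2 - \<tau>) / (2 * \<tau>\<^sup>2))"
  have u0: "0 < u" using \<tau> lt by (simp add: u_def)
  have u1: "\<tau> * u \<le> 1" using \<tau> mult_left_mono[of u "1 / \<tau>" \<tau>] by (simp add: u_def)
  have u2: "\<tau>\<^sup>2 * u \<le> (1/2 - \<tau>) / 2"
    using \<tau> mult_left_mono[of u "(1/2 - \<tau>) / (2 * \<tau>\<^sup>2)" "\<tau>\<^sup>2"] by (simp add: u_def)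
  have "1 + u / 2 \<le> exp (\<tau> * u)" using le[of "sqrt u"] u0 by simp
  also have "\<dots> \<le> 1 + \<tau> * u + (\<tau> * u)\<^sup>2" using \<tau> u0 u1 by (intro exp_bound) auto
  also have "(\<tau> * u)\<^sup>2 = \<tau>\<^sup>2 * u * u" by (simp add: power2_eq_square)
  also have "\<tau>\<^sup>2 * u * u \<le> (1/2 - \<tau>) / 2 * u" using u2 u0 by (intro mult_right_mono) auto
  finally have "(1/2 - \<tau>) * u \<le> (1/2 - \<tau>) * u / 2" by (simp add: field_simps)
  moreover have "0 < (1/2 - \<tau>) * u" using lt u0 by simp
  ultimately show False by linarith
qed

lemma std_gauss_exp:
  shows "integrable std_gauss (\<lambda>x. exp (s * x))" "(\<integral>x. exp (s * x) \<partial>std_gauss) = exp (s\<^sup>2 / 2)"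
proof -
  have "(\<integral>\<^sup>+ y. ennreal (exp (s * y - s\<^sup>2 / 2)) \<partial>std_gauss) = 1"
    using emeasure_std_gauss_shift[of UNIV s] std_gauss.emeasure_space_1 by simp
  then have i: "integrable std_gauss (\<lambda>y. exp (s * y - s\<^sup>2 / 2))"
    and v: "(\<integral>y. exp (s * y - s\<^sup>2 / 2) \<partial>std_gauss) = 1"
    by (auto intro!: integrableI_nonneg simp: integral_eq_nn_integral)
  have eq: "exp (s * y) = exp (s\<^sup>2 / 2) * exp (s * y - s\<^sup>2 / 2)" for y by (simp add: exp_add[symmetric])
  show "integrable std_gauss (\<lambda>x. exp (s * x))" "(\<integral>x. exp (s * x) \<partial>std_gauss) = exp (s\<^sup>2 / 2)"
    unfolding eq using i v by simp_all
qed

lemma std_gauss_in_subgaussian_class: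
  assumes "1/2 \<le> \<tau>"
  shows "std_gauss \<in> subgaussian_class \<tau>"
proof -
  have 1: "has_bochner_integral std_gauss (\<lambda>x. x) 0"
    using std_normal_moment_odd[of 0] unfolding std_gauss_def
    by (intro has_bochner_integral_density) auto
  have 2: "has_bochner_integral std_gauss (\<lambda>x. x\<^sup>2) 1"
    using std_normal_moment_even[of 1] unfolding std_gauss_def
    by (intro has_bochner_integral_density) auto
  have m: "(\<integral>x. x \<partial>std_gauss) = 0" using 1 by (simp add: has_bochner_integral_iff)
  have "exp (s\<^sup>2 / 2) \<le> exp (\<tau> * s\<^sup>2)" for s :: real
    using mult_right_mono[OF assms, of "s\<^sup>2"] by simp
  then show ?thesis unfolding subgaussian_class_def
    using 1 2 prob_space_std_gauss by (auto simp: has_bochner_integral_iff std_gauss_exp m)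
qed

section \<open>Lower bounds for a given estimator and the final assembly\<close>

lemma mat_add_mat_fun:
  fixes M :: "nat \<Rightarrow> nat \<Rightarrow> real"
  shows "mat p q (\<lambda>(i, j). M i j) + mat p q z = mat p q (\<lambda>x\<in>{..<p} \<times> {..<q}. M (fst x) (snd x) + z x)"
  by (rule eq_matI) auto

text \<open>One signal serves both norms: the loss is at most twice the squared Frobenius norm,
  which is at most \<open>r\<close> times the squared spectral norm. Hence \<kappa> = 1/2 and
  \<kappa> = 1 / (2 r).\<close>

lemma right_risk_lower:
  fixes p q r :: nat and t :: real
  assumes r: "1 \<le> r" "2 * r \<le> p" "2 * r \<le> q" and t: "0 < t" and E: "E \<in> estimators p q q r"
  obtains X where "X \<in> low_rank_class p q r t"
    "ennreal (1/2 * risk_bound p q r t) \<le>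
      (\<integral>\<^sup>+ z. ennreal ((frobenius_norm (sin_Theta (right_sing_vecs r X) (E (X + mat p q z))))\<^sup>2) \<partial>gauss ({..<p} \<times> {..<q}))"
    "ennreal (1 / (2 * r) * risk_bound p q r t) \<le>
      (\<integral>\<^sup>+ z. ennreal ((spectral_norm (sin_Theta (right_sing_vecs r X) (E (X + mat p q z))))\<^sup>2) \<partial>gauss ({..<p} \<times> {..<q}))"
proof -
  define V where "V = (\<lambda>y j c. E (mat p q y) $$ (j, c))"
  have Ecols: "E (mat p q y) \<in> orthonormal_cols q r" for y using E by (auto simp: estimators_def)
  have V: "orth q r (V y)" for y unfolding V_def by (rule orthonormal_cols_orth[OF Ecols])
  have meas: "(\<lambda>y. V y j c) \<in> borel_measurable (PiM ({..<p} \<times> {..<q}) (\<lambda>_. borel))" if "j < q" "c < r" for j c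
    using E that by (auto simp: estimators_def V_def)
  obtain G W where
    G: "\<And>x. t * L2_set x {..<r} \<le> L2_set (\<lambda>i. \<Sum>k<r. G i k * x k) {..<p}" and
    W: "\<And>x. 1 * L2_set x {..<r} \<le> L2_set (\<lambda>j. \<Sum>k<r. W j k * x k) {..<q}"
      "\<And>x. L2_set (\<lambda>j. \<Sum>k<r. W j k * x k) {..<q} \<le> sqrt 2 * L2_set x {..<r}" and
    "\<And>\<kappa>. 0 \<le> \<kappa> \<Longrightarrow> (\<lambda>z. ennreal (\<kappa> * col_loss q r (V (noisy p q r G W z)) W))
       \<in> borel_measurable (gauss ({..<p} \<times> {..<q}))" and
    risk: "\<And>\<kappa>. 0 \<le> \<kappa> \<Longrightarrow> ennreal (\<kappa> * risk_bound p q r t) \<le>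
      (\<integral>\<^sup>+ z. ennreal (\<kappa> * col_loss q r (V (noisy p q r G W z)) W) \<partial>gauss ({..<p} \<times> {..<q}))"
    using core_lower[OF r t, of V] V meas by blast
  define X where "X = mat p q (\<lambda>(i, j). \<Sum>k<r. G i k * W j k)"
  have X: "X \<in> carrier_mat p q" by (simp add: X_def)
  obtain d w xw where "gram_eigenbasis p q X d w xw" by (rule gram_eigenbasis_exists[OF X])
  then interpret factored p q X d w xw r G W t 1 t
    using G W t r by (intro factored.intro factored_axioms.intro) (auto simp: X_def)
  let ?S = "right_sing_vecs r X"
  let ?Y = "\<lambda>z. E (X + mat p q z)"
  have Y: "?Y z = E (mat p q (noisy p q r G W z))" for z
    unfolding X_def noisy_def by (rule arg_cong[OF mat_add_mat_fun])
  have Yc: "?Y z \<in> orthonormal_cols q r" for z unfolding Y by (rule Ecols)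
  note norms = sin_Theta_norms[OF right_sing_vecs_span(1) Yc]
  have loss: "col_loss q r (V (noisy p q r G W z)) W \<le>
      2 * (frobenius_norm (sin_Theta ?S (?Y z)))\<^sup>2" for z
    unfolding norms(1) V_def Y[symmetric]
    by (rule subspace_loss[OF orthonormal_cols_orth[OF right_sing_vecs_span(1)] orthonormal_cols_orth[OF Yc]
        right_sing_vecs_span(2) W(2)])
  show thesis
  proof (rule that[of X])
    show "X \<in> low_rank_class p q r t" by (rule in_low_rank_class)
    show "ennreal (1/2 * risk_bound p q r t) \<le>
        (\<integral>\<^sup>+ z. ennreal ((frobenius_norm (sin_Theta ?S (?Y z)))\<^sup>2) \<partial>gauss ({..<p} \<times> {..<q}))"
      using loss by (intro order.trans[OF risk] nn_integral_mono ennreal_leI) (auto simp: mult.commute)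
    show "ennreal (1 / (2 * r) * risk_bound p q r t) \<le>
        (\<integral>\<^sup>+ z. ennreal ((spectral_norm (sin_Theta ?S (?Y z)))\<^sup>2) \<partial>gauss ({..<p} \<times> {..<q}))"
    proof (intro order.trans[OF risk] nn_integral_mono ennreal_leI)
      fix z
      have "col_loss q r (V (noisy p q r G W z)) W \<le>
          2 * r * (spectral_norm (sin_Theta ?S (?Y z)))\<^sup>2"
        using loss[of z] norms[of z] by simp
      then show "1 / (2 * r) * col_loss q r (V (noisy p q r G W z)) W \<le>
          (spectral_norm (sin_Theta ?S (?Y z)))\<^sup>2"
        using r(1) by (simp add: divide_le_eq mult.commute)
    qed simp
  qed
qed

text \<open>\<open>core_lower\<close> is applied to the transposed problem. \<open>sw\<close>
  transposes the data fed to the estimator and \<open>tr\<close> the noise, whose law is invariant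
  under reindexing; \<open>W\<close> becomes the left factor.\<close>

lemma left_risk_lower:
  fixes p q r :: nat and t :: real
  assumes r: "1 \<le> r" "2 * r \<le> p" "2 * r \<le> q" and t: "0 < t" and E: "E \<in> estimators q p q r"
  obtains X where "X \<in> low_rank_class q p r t"
    "ennreal (1/2 * risk_bound p q r t) \<le>
      (\<integral>\<^sup>+ z. ennreal ((frobenius_norm (sin_Theta (left_sing_vecs r X) (E (X + mat q p z))))\<^sup>2) \<partial>gauss ({..<q} \<times> {..<p}))"
    "ennreal (1 / (2 * r) * risk_bound p q r t) \<le>
      (\<integral>\<^sup>+ z. ennreal ((spectral_norm (sin_Theta (left_sing_vecs r X) (E (X + mat q p z))))\<^sup>2) \<partial>gauss ({..<q} \<times> {..<p}))"
proof -
  define sw where "sw = (\<lambda>(y :: nat \<times> nat \<Rightarrow> real). \<lambda>x\<in>{..<q} \<times> {..<p}. y (snd x, fst x))"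
  define V where "V = (\<lambda>y j c. E (mat q p (sw y)) $$ (j, c))"
  have Ecols: "E (mat q p y) \<in> orthonormal_cols q r" for y using E by (auto simp: estimators_def)
  have V: "orth q r (V y)" for y unfolding V_def by (rule orthonormal_cols_orth[OF Ecols])
  have meas: "(\<lambda>y. V y j c) \<in> borel_measurable (PiM ({..<p} \<times> {..<q}) (\<lambda>_. borel))" if "j < q" "c < r" for j c
  proof -
    have "sw \<in> measurable (PiM ({..<p} \<times> {..<q}) (\<lambda>_. borel)) (PiM ({..<q} \<times> {..<p}) (\<lambda>_. borel))"
      unfolding sw_def by (rule measurable_restrict) (auto intro!: measurable_component_singleton)
    moreover have "(\<lambda>y. E (mat q p y) $$ (j, c)) \<in> borel_measurable (PiM ({..<q} \<times> {..<p}) (\<lambda>_. borel))"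
      using E that by (auto simp: estimators_def)
    ultimately show ?thesis unfolding V_def by (rule measurable_compose)
  qed
  obtain G W where
    G: "\<And>x. t * L2_set x {..<r} \<le> L2_set (\<lambda>i. \<Sum>k<r. G i k * x k) {..<p}" and
    W: "\<And>x. 1 * L2_set x {..<r} \<le> L2_set (\<lambda>j. \<Sum>k<r. W j k * x k) {..<q}"
      "\<And>x. L2_set (\<lambda>j. \<Sum>k<r. W j k * x k) {..<q} \<le> sqrt 2 * L2_set x {..<r}" and
    rmeas: "\<And>\<kappa>. 0 \<le> \<kappa> \<Longrightarrow> (\<lambda>z. ennreal (\<kappa> * col_loss q r (V (noisy p q r G W z)) W))
       \<in> borel_measurable (gauss ({..<p} \<times> {..<q}))" and
    risk: "\<And>\<kappa>. 0 \<le> \<kappa> \<Longrightarrow> ennreal (\<kappa> * risk_bound p q r t) \<le>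
      (\<integral>\<^sup>+ z. ennreal (\<kappa> * col_loss q r (V (noisy p q r G W z)) W) \<partial>gauss ({..<p} \<times> {..<q}))"
    using core_lower[OF r t, of V] V meas by blast
  define X where "X = mat q p (\<lambda>(i, j). \<Sum>k<r. W i k * G j k)"
  have X: "X \<in> carrier_mat q p" by (simp add: X_def)
  obtain d w xw where "gram_eigenbasis q p X d w xw" by (rule gram_eigenbasis_exists[OF X])
  then interpret factored q p X d w xw r W G 1 t t
    using G W t r by (intro factored.intro factored_axioms.intro) (auto simp: X_def)
  let ?S = "left_sing_vecs r X"
  let ?Y = "\<lambda>z. E (X + mat q p z)"
  define tr where "tr = (\<lambda>(z :: nat \<times> nat \<Rightarrow> real). \<lambda>x\<in>{..<p} \<times> {..<q}. z (prod.swap x))"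
  have dist: "distr (gauss ({..<q} \<times> {..<p})) (gauss ({..<p} \<times> {..<q})) tr = gauss ({..<p} \<times> {..<q})"
    unfolding tr_def by (rule distr_PiM_reindex) (auto intro: prob_space_std_gauss)
  have trm: "tr \<in> measurable (gauss ({..<q} \<times> {..<p})) (gauss ({..<p} \<times> {..<q}))"
    unfolding tr_def by (rule measurable_restrict) (auto intro!: measurable_component_singleton)
  have Y: "?Y z = E (mat q p (sw (noisy p q r G W (tr z))))" for z
    unfolding X_def by (rule arg_cong[of _ _ E], rule eq_matI) (auto simp: sw_def tr_def noisy_def mult.commute)
  have Yc: "?Y z \<in> orthonormal_cols q r" for z unfolding Y by (rule Ecols)
  note norms = sin_Theta_norms[OF left_sing_vecs_span(1) Yc]
  have loss: "col_loss q r (V (noisy p q r G W (tr z))) W \<le>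
      2 * (frobenius_norm (sin_Theta ?S (?Y z)))\<^sup>2" for z
    unfolding norms(1) V_def Y[symmetric]
    by (rule subspace_loss[OF orthonormal_cols_orth[OF left_sing_vecs_span(1)] orthonormal_cols_orth[OF Yc]
        left_sing_vecs_span(2) W(2)])
  have risk': "ennreal (\<kappa> * risk_bound p q r t) \<le>
      (\<integral>\<^sup>+ z. ennreal (\<kappa> * col_loss q r (V (noisy p q r G W (tr z))) W) \<partial>gauss ({..<q} \<times> {..<p}))"
    if "0 \<le> \<kappa>" for \<kappa>
    using risk[OF that] nn_integral_distr[OF trm, unfolded dist, OF rmeas[OF that]] by simp
  show thesis
  proof (rule that[of X])
    show "X \<in> low_rank_class q p r t" by (rule in_low_rank_class)
    show "ennreal (1/2 * risk_bound p q r t) \<le>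
        (\<integral>\<^sup>+ z. ennreal ((frobenius_norm (sin_Theta ?S (?Y z)))\<^sup>2) \<partial>gauss ({..<q} \<times> {..<p}))"
      using loss by (intro order.trans[OF risk'] nn_integral_mono ennreal_leI) (auto simp: mult.commute)
    show "ennreal (1 / (2 * r) * risk_bound p q r t) \<le>
        (\<integral>\<^sup>+ z. ennreal ((spectral_norm (sin_Theta ?S (?Y z)))\<^sup>2) \<partial>gauss ({..<q} \<times> {..<p}))"
    proof (intro order.trans[OF risk'] nn_integral_mono ennreal_leI)
      fix z
      have "col_loss q r (V (noisy p q r G W (tr z))) W \<le>
          2 * r * (spectral_norm (sin_Theta ?S (?Y z)))\<^sup>2"
        using loss[of z] norms[of z] by simp
      then show "1 / (2 * r) * col_loss q r (V (noisy p q r G W (tr z))) W \<le>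
          (spectral_norm (sin_Theta ?S (?Y z)))\<^sup>2"
        using r(1) by (simp add: divide_le_eq mult.commute)
    qed simp
  qed
qed

text \<open>Over an empty class the supremum in \<open>minimax_risk\<close> would be 0 and the
  bounds would fail, so nonemptiness of the noise model is assumed; it forces \<tau> >= 1/2.\<close>

theorem theorem4:
  fixes \<tau> :: real
  assumes "\<tau> > 0" and "subgaussian_class \<tau> \<noteq> {}"
  shows "\<exists>c::real. c > 0 \<and>
    (\<forall>(p1::nat) (p2::nat) (r::nat) (t::real).
       p1 \<ge> 1 \<longrightarrow> p2 \<ge> 1 \<longrightarrow> r \<ge> 1 \<longrightarrow> real r \<le> min (real p1 / 16) (real p2 / 2) \<longrightarrow> t > 0 \<longrightarrow>
         minimax_risk \<tau> p1 p2 r t spectral_norm (right_sing_vecs r) (estimators p1 p2 p2 r)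
           \<ge> ennreal (c * min (real p2 * (t\<^sup>2 + real p1) / t ^ 4) 1) \<and>
         minimax_risk \<tau> p1 p2 r t frobenius_norm (right_sing_vecs r) (estimators p1 p2 p2 r)
           \<ge> ennreal (c * min (real p2 * real r * (t\<^sup>2 + real p1) / t ^ 4) (real r)) \<and>
         minimax_risk \<tau> p1 p2 r t spectral_norm (left_sing_vecs r) (estimators p1 p2 p1 r)
           \<ge> ennreal (c * min (real p1 * (t\<^sup>2 + real p2) / t ^ 4) 1) \<and>
         minimax_risk \<tau> p1 p2 r t frobenius_norm (left_sing_vecs r) (estimators p1 p2 p1 r)
           \<ge> ennreal (c * min (real p1 * real r * (t\<^sup>2 + real p2) / t ^ 4) (real r)))"
proof (intro exI[of _ "rate_const / 2"] conjI allI impI)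
  show "0 < rate_const / 2" using rate_const_pos by simp
  fix p1 p2 r :: nat and t :: real
  assume r: "1 \<le> r" and b: "real r \<le> min (real p1 / 16) (real p2 / 2)" and t: "0 < t"
  have r1: "2 * r \<le> p1" and r2: "2 * r \<le> p2" using b by linarith+
  have gauss_class: "std_gauss \<in> subgaussian_class \<tau>"
    by (rule std_gauss_in_subgaussian_class[OF subgaussian_class_half_le[OF assms]])
  \<comment> \<open>The risk takes the supremum over all noise laws, so for each estimator one
    signal under Gaussian noise is enough.\<close>
  have below: "c \<le> minimax_risk \<tau> p1 p2 r t N S Est"
    if ex: "\<And>E. E \<in> Est \<Longrightarrow> \<exists>X\<in>low_rank_class p1 p2 r t. c \<le>
        (\<integral>\<^sup>+ z. ennreal ((N (sin_Theta (S X) (E (X + mat p1 p2 z))))\<^sup>2) \<partial>gauss ({..<p1} \<times> {..<p2}))"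
    for c N S Est
    unfolding minimax_risk_def
  proof (rule INF_greatest)
    fix E assume E: "E \<in> Est"
    obtain X where X: "X \<in> low_rank_class p1 p2 r t" "c \<le>
        (\<integral>\<^sup>+ z. ennreal ((N (sin_Theta (S X) (E (X + mat p1 p2 z))))\<^sup>2) \<partial>gauss ({..<p1} \<times> {..<p2}))"
      using ex[OF E] by blast
    show "c \<le> (SUP \<mu>\<in>subgaussian_class \<tau>. SUP X\<in>low_rank_class p1 p2 r t.
        \<integral>\<^sup>+ z. ennreal ((N (sin_Theta (S X) (E (X + mat p1 p2 z))))\<^sup>2) \<partial>iid_entries \<mu> p1 p2)"
      by (rule SUP_upper2[OF gauss_class], rule SUP_upper2[OF X(1)]) (simp add: iid_entries_def X(2))
  qed
  have scale: "1 / real (2 * r) * (rate_const * min (real p * real r * x / t ^ 4) r) = rate_const / 2 * min (real p * x / t ^ 4) 1"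
    for p :: nat and x :: real
  proof -
    have "min (real p * real r * x / t ^ 4) r = min (real p * x / t ^ 4) 1 * r"
      using min_mult_distrib_right[of "real p * x / t ^ 4" 1 "real r"] by (simp add: mult_ac)
    then show ?thesis using r by simp
  qed
  have half: "1/2 * (rate_const * min (real p * real r * x / t ^ 4) r) = rate_const / 2 * min (real p * real r * x / t ^ 4) r"
    for p :: nat and x :: real by simp
  have right: "\<exists>X\<in>low_rank_class p1 p2 r t.
      ennreal (rate_const / 2 * min (real p2 * (t\<^sup>2 + real p1) / t ^ 4) 1) \<le> (\<integral>\<^sup>+ z. ennreal ((spectral_norm (sin_Theta (right_sing_vecs r X) (E (X + mat p1 p2 z))))\<^sup>2) \<partial>gauss ({..<p1} \<times> {..<p2})) \<and>
      ennreal (rate_const / 2 * min (real p2 * real r * (t\<^sup>2 + real p1) / t ^ 4) (real r)) \<le> (\<integral>\<^sup>+ z. ennreal ((frobenius_norm (sin_Theta (right_sing_vecs r X) (E (X + mat p1 p2 z))))\<^sup>2) \<partial>gauss ({..<p1} \<times> {..<p2}))"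
    if E: "E \<in> estimators p1 p2 p2 r" for E
  proof -
    obtain X where "X \<in> low_rank_class p1 p2 r t"
      "ennreal (rate_const / 2 * min (real p2 * real r * (t\<^sup>2 + real p1) / t ^ 4) (real r)) \<le> (\<integral>\<^sup>+ z. ennreal ((frobenius_norm (sin_Theta (right_sing_vecs r X) (E (X + mat p1 p2 z))))\<^sup>2) \<partial>gauss ({..<p1} \<times> {..<p2}))"
      "ennreal (rate_const / 2 * min (real p2 * (t\<^sup>2 + real p1) / t ^ 4) 1) \<le> (\<integral>\<^sup>+ z. ennreal ((spectral_norm (sin_Theta (right_sing_vecs r X) (E (X + mat p1 p2 z))))\<^sup>2) \<partial>gauss ({..<p1} \<times> {..<p2}))"
      by (rule right_risk_lower[OF r r1 r2 t E, unfolded risk_bound_def scale half])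
    then show ?thesis by (intro bexI[of _ X] conjI)
  qed
  have left: "\<exists>X\<in>low_rank_class p1 p2 r t.
      ennreal (rate_const / 2 * min (real p1 * (t\<^sup>2 + real p2) / t ^ 4) 1) \<le> (\<integral>\<^sup>+ z. ennreal ((spectral_norm (sin_Theta (left_sing_vecs r X) (E (X + mat p1 p2 z))))\<^sup>2) \<partial>gauss ({..<p1} \<times> {..<p2})) \<and>
      ennreal (rate_const / 2 * min (real p1 * real r * (t\<^sup>2 + real p2) / t ^ 4) (real r)) \<le> (\<integral>\<^sup>+ z. ennreal ((frobenius_norm (sin_Theta (left_sing_vecs r X) (E (X + mat p1 p2 z))))\<^sup>2) \<partial>gauss ({..<p1} \<times> {..<p2}))"
    if E: "E \<in> estimators p1 p2 p1 r" for E
  proof -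
    obtain X where "X \<in> low_rank_class p1 p2 r t"
      "ennreal (rate_const / 2 * min (real p1 * real r * (t\<^sup>2 + real p2) / t ^ 4) (real r)) \<le> (\<integral>\<^sup>+ z. ennreal ((frobenius_norm (sin_Theta (left_sing_vecs r X) (E (X + mat p1 p2 z))))\<^sup>2) \<partial>gauss ({..<p1} \<times> {..<p2}))"
      "ennreal (rate_const / 2 * min (real p1 * (t\<^sup>2 + real p2) / t ^ 4) 1) \<le> (\<integral>\<^sup>+ z. ennreal ((spectral_norm (sin_Theta (left_sing_vecs r X) (E (X + mat p1 p2 z))))\<^sup>2) \<partial>gauss ({..<p1} \<times> {..<p2}))"
      by (rule left_risk_lower[OF r r2 r1 t E, unfolded risk_bound_def scale half])
    then show ?thesis by (intro bexI[of _ X] conjI)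
  qed
  show "ennreal (rate_const / 2 * min (real p2 * (t\<^sup>2 + real p1) / t ^ 4) 1)
      \<le> minimax_risk \<tau> p1 p2 r t spectral_norm (right_sing_vecs r) (estimators p1 p2 p2 r)"
    by (rule below) (drule right, erule bexE, erule conjE, erule bexI[rotated], assumption)
  show "ennreal (rate_const / 2 * min (real p2 * real r * (t\<^sup>2 + real p1) / t ^ 4) (real r))
      \<le> minimax_risk \<tau> p1 p2 r t frobenius_norm (right_sing_vecs r) (estimators p1 p2 p2 r)"
    by (rule below) (drule right, erule bexE, erule conjE, erule bexI[rotated], assumption)
  show "ennreal (rate_const / 2 * min (real p1 * (t\<^sup>2 + real p2) / t ^ 4) 1)
      \<le> minimax_risk \<tau> p1 p2 r t spectral_norm (left_sing_vecs r) (estimators p1 p2 p1 r)"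
    by (rule below) (drule left, erule bexE, erule conjE, erule bexI[rotated], assumption)
  show "ennreal (rate_const / 2 * min (real p1 * real r * (t\<^sup>2 + real p2) / t ^ 4) (real r))
      \<le> minimax_risk \<tau> p1 p2 r t frobenius_norm (left_sing_vecs r) (estimators p1 p2 p1 r)"
    by (rule below) (drule left, erule bexE, erule conjE, erule bexI[rotated], assumption)
qed

end
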